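(* Let $(M,g)$ be a two-dimensional oriented Riemannian manifold with curvature $K$ such that $\Sigma=\{x\in M:K(x)=0\}$ is a closed one-dimensional submanifold of $M$, and let $\hat\Sigma=\pi^{-1}(\Sigma)\subset SO(M,g)$. Any generalized geodesic $\hat\gamma(t)$ of the Wagner lift $\hat g$ that is transversal to $\hat\Sigma$ intersects $\hat\Sigma$ horizontally; that is, if $\hat\gamma(t_0)$ lies in $\hat\Sigma$, then $\frac{d}{dt}\big|_{t=t_0}\hat\gamma(t)$ lies in $\mathcal{H}_{\hat\gamma(t_0)}$.
   Context: Let $\pi:SO(M,g)\to M$ be the principal $SO(2)$-bundle of positively oriented orthonormal frames, with right action $\{e_1,e_2\}\cdot r(\varphi)=\{\cos\varphi\, e_1+\sin\varphi\, e_2,\,-\sin\varphi\, e_1+\cos\varphi\, e_2\}$. The Levi-Civita connection of $g$ determines the $SO(2)$-invariant horizontal distribution $\mathcal{H}$ on $SO(M,g)$, complementary to the vertical distribution $V$ (tangent to the fibers). Let $\partial_\varphi|_p=\frac{d}{d\varphi}|_{\varphi=0}\, p\cdot r(\varphi)$; it spans $V$. The Wagner lift $\hat g$ of $g$ is the Riemannian metric on $SO(M,g)\setminus\hat\Sigma$ defined by: $\hat g(X,Y)_p=g(d\pi X,d\pi Y)$ for $X,Y\in\mathcal{H}_p$; $\hat g(X,Y)_p=0$ for $X\in\mathcal{H}_p$, $Y\in V_p$; and $\hat g(\partial_\varphi,\partial_\varphi)_p=1/K^2(\pi(p))$. A (smooth) curve $\hat\gamma:(a,b)\to SO(M,g)$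 is called a generalized geodesic of $\hat g$ if $\hat\gamma(t)$ is a geodesic of $\hat g$ for $t\in\hat\gamma^{-1}(SO(M,g)\setminus\hat\Sigma)$. *)

theory Defs
  imports "HOL-Analysis.Analysis"
begin

section \<open>Smooth maps between open sets of normed spaces\<close>

text \<open>Only meant for open sets \<open>S\<close> of a Euclidean space, where it agrees with the usual notion of
  a map of class C^k: continuity of all iterated directional derivatives up to order k.\<close>

primrec Ck_on :: "nat \<Rightarrow> 'a::real_normed_vector set \<Rightarrow> ('a \<Rightarrow> 'b::real_normed_vector) \<Rightarrow> bool" where
  "Ck_on 0 S f \<longleftrightarrow> continuous_on S f"
| "Ck_on (Suc k) S f \<longleftrightarrow>
     (\<forall>x\<in>S. f differentiable (at x)) \<and> (\<forall>v. Ck_on k S (\<lambda>x. frechet_derivative f (at x) v))"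

definition smooth_on :: "'a::real_normed_vector set \<Rightarrow> ('a \<Rightarrow> 'b::real_normed_vector) \<Rightarrow> bool" where
  "smooth_on S f \<longleftrightarrow> (\<forall>k. Ck_on k S f)"


section \<open>Smooth manifolds\<close>

text \<open>A chart is a pair of a domain and a coordinate map with values in the model space \<open>'e\<close>; the
  dimension of the manifold is \<open>DIM('e)\<close>. The coordinate map is arbitrary outside the domain.\<close>

type_synonym ('a, 'e) chart = "'a set \<times> ('a \<Rightarrow> 'e)"

abbreviation cdom :: "('a, 'e) chart \<Rightarrow> 'a set" where "cdom \<equiv> fst"
abbreviation cmap :: "('a, 'e) chart \<Rightarrow> 'a \<Rightarrow> 'e" where "cmap \<equiv> snd"

definition cinv :: "('a, 'e) chart \<Rightarrow> 'e \<Rightarrow> 'a" where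
  "cinv c = inv_into (cdom c) (cmap c)"

definition transition :: "('a, 'e) chart \<Rightarrow> ('a, 'e) chart \<Rightarrow> 'e \<Rightarrow> 'e" where
  "transition c c' = cmap c' \<circ> cinv c"

definition is_chart :: "'a topology \<Rightarrow> ('a, 'e::euclidean_space) chart \<Rightarrow> bool" where
  "is_chart T c \<longleftrightarrow> openin T (cdom c) \<and> open (cmap c ` cdom c) \<and>
     homeomorphic_map (subtopology T (cdom c)) (top_of_set (cmap c ` cdom c)) (cmap c)"

definition compatible :: "('a, 'e::euclidean_space) chart \<Rightarrow> ('a, 'e) chart \<Rightarrow> bool" where
  "compatible c c' \<longleftrightarrow>
     smooth_on (cmap c ` (cdom c \<inter> cdom c')) (transition c c') \<and>
     smooth_on (cmap c' ` (cdom c \<inter> cdom c')) (transition c' c)"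

definition carrier_of :: "('a, 'e) chart set \<Rightarrow> 'a set" where
  "carrier_of A = (\<Union>c\<in>A. cdom c)"

definition smooth_manifold :: "'a topology \<Rightarrow> ('a, 'e::euclidean_space) chart set \<Rightarrow> bool" where
  "smooth_manifold T A \<longleftrightarrow> Hausdorff_space T \<and> second_countable T \<and>
     carrier_of A = topspace T \<and>
     (\<forall>c\<in>A. is_chart T c) \<and> (\<forall>c\<in>A. \<forall>c'\<in>A. compatible c c')"

definition oriented_atlas :: "('a, real^2) chart set \<Rightarrow> bool" where
  "oriented_atlas A \<longleftrightarrow> (\<forall>c\<in>A. \<forall>c'\<in>A. \<forall>y \<in> cmap c ` (cdom c \<inter> cdom c').
     0 < det (matrix (frechet_derivative (transition c c') (at y))))"

text \<open>Embedded submanifolds of dimension k, by means of slice charts. The slice charts are taken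
  from the maximal atlas determined by \<open>A\<close>.\<close>

definition embedded_submanifold ::
    "'a topology \<Rightarrow> ('a, 'e::euclidean_space) chart set \<Rightarrow> nat \<Rightarrow> 'a set \<Rightarrow> bool" where
  "embedded_submanifold T A k S \<longleftrightarrow> S \<subseteq> topspace T \<and>
     (\<forall>p\<in>S. \<exists>c L. is_chart T c \<and> (\<forall>c'\<in>A. compatible c c') \<and> p \<in> cdom c \<and>
        subspace L \<and> dim L = k \<and> cmap c ` (cdom c \<inter> S) = cmap c ` cdom c \<inter> L)"


section \<open>Tangent vectors and curves\<close>

text \<open>A tangent vector at p is the family of its coordinate representations in all charts of the
  atlas around p, any two of which are related by the derivative of the transition map. The family
  is set to 0 at the charts that do not contain p. Vector space operations are pointwise.\<close>

type_synonym ('a, 'e) tvec = "('a, 'e) chart \<Rightarrow> 'e"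

definition tangent_space :: "('a, 'e::euclidean_space) chart set \<Rightarrow> 'a \<Rightarrow> ('a, 'e) tvec set" where
  "tangent_space A p = {X.
     (\<forall>c\<in>A. \<forall>c'\<in>A. p \<in> cdom c \<inter> cdom c' \<longrightarrow>
        X c' = frechet_derivative (transition c c') (at (cmap c p)) (X c)) \<and>
     (\<forall>c. \<not> (c \<in> A \<and> p \<in> cdom c) \<longrightarrow> X c = 0)}"

definition lincomb :: "real \<Rightarrow> ('a, 'e::real_vector) tvec \<Rightarrow> real \<Rightarrow> ('a, 'e) tvec \<Rightarrow> ('a, 'e) tvec" where
  "lincomb a X b Y = (\<lambda>c. a *\<^sub>R X c + b *\<^sub>R Y c)"

text \<open>The tangent vector at p with coordinate representation u in the chart c.\<close>

definition coord_tvec ::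
    "('a, 'e::euclidean_space) chart set \<Rightarrow> ('a, 'e) chart \<Rightarrow> 'a \<Rightarrow> 'e \<Rightarrow> ('a, 'e) tvec" where
  "coord_tvec A c p u = (\<lambda>c'. if c' \<in> A \<and> p \<in> cdom c'
     then frechet_derivative (transition c c') (at (cmap c p)) u else 0)"

text \<open>In the following definition \<open>J\<close> is an open set of parameters.\<close>

definition smooth_curve :: "('a, 'e::euclidean_space) chart set \<Rightarrow> real set \<Rightarrow> (real \<Rightarrow> 'a) \<Rightarrow> bool" where
  "smooth_curve A J \<gamma> \<longleftrightarrow> \<gamma> ` J \<subseteq> carrier_of A \<and>
     (\<forall>c\<in>A. open {t\<in>J. \<gamma> t \<in> cdom c} \<and> smooth_on {t\<in>J. \<gamma> t \<in> cdom c} (cmap c \<circ> \<gamma>))"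

definition velocity ::
    "('a, 'e::euclidean_space) chart set \<Rightarrow> (real \<Rightarrow> 'a) \<Rightarrow> real \<Rightarrow> ('a, 'e) tvec" where
  "velocity A \<gamma> t = (\<lambda>c. if c \<in> A \<and> \<gamma> t \<in> cdom c
     then vector_derivative (cmap c \<circ> \<gamma>) (at t) else 0)"

text \<open>Vectors at p tangent to a subset S (for a submanifold S: its tangent space at p).\<close>

definition tangent_to ::
    "('a, 'e::euclidean_space) chart set \<Rightarrow> 'a set \<Rightarrow> 'a \<Rightarrow> ('a, 'e) tvec set" where
  "tangent_to A S p = {velocity A \<sigma> 0 | \<sigma> \<epsilon>. \<epsilon> > 0 \<and> smooth_curve A {-\<epsilon><..<\<epsilon>} \<sigma> \<and>
     \<sigma> ` {-\<epsilon><..<\<epsilon>} \<subseteq> S \<and> \<sigma> 0 = p}"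

text \<open>Transversality of a curve with a submanifold S: at every intersection the velocity and the
  tangent space of S together span the tangent space of the ambient manifold.\<close>

definition transversal_curve ::
    "('a, 'e::euclidean_space) chart set \<Rightarrow> real set \<Rightarrow> (real \<Rightarrow> 'a) \<Rightarrow> 'a set \<Rightarrow> bool" where
  "transversal_curve A J \<gamma> S \<longleftrightarrow> (\<forall>t\<in>J. \<gamma> t \<in> S \<longrightarrow>
     (\<forall>X \<in> tangent_space A (\<gamma> t). \<exists>a. \<exists>Y \<in> tangent_to A S (\<gamma> t).
        X = lincomb a (velocity A \<gamma> t) 1 Y))"

text \<open>The differential of a smooth map f at p; its value is independent of the chart chosen at p.\<close>

definition differential ::
    "('a, 'e::euclidean_space) chart set \<Rightarrow> ('b, 'f::euclidean_space) chart set \<Rightarrow>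
     ('a \<Rightarrow> 'b) \<Rightarrow> 'a \<Rightarrow> ('a, 'e) tvec \<Rightarrow> ('b, 'f) tvec" where
  "differential A B f p X =
     (let c = (SOME c. c \<in> A \<and> p \<in> cdom c) in
      (\<lambda>d. if d \<in> B \<and> f p \<in> cdom d
          then frechet_derivative (cmap d \<circ> f \<circ> cinv c) (at (cmap c p)) (X c) else 0))"


section \<open>Riemannian metrics\<close>

type_synonym ('a, 'e) metric = "'a \<Rightarrow> ('a, 'e) tvec \<Rightarrow> ('a, 'e) tvec \<Rightarrow> real"

definition metric_rep ::
    "('a, 'e::euclidean_space) chart set \<Rightarrow> ('a, 'e) metric \<Rightarrow> ('a, 'e) chart \<Rightarrow>
     'e \<Rightarrow> 'e \<Rightarrow> 'e \<Rightarrow> real" where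
  "metric_rep A g c y u v =
     g (cinv c y) (coord_tvec A c (cinv c y) u) (coord_tvec A c (cinv c y) v)"

text \<open>Riemannian metrics on an open subset W of the manifold with atlas \<open>A\<close>. Values at points
  outside W and at non-tangent vectors are irrelevant.\<close>

definition riemannian_metric_on ::
    "('a, 'e::euclidean_space) chart set \<Rightarrow> 'a set \<Rightarrow> ('a, 'e) metric \<Rightarrow> bool" where
  "riemannian_metric_on A W g \<longleftrightarrow>
     (\<forall>p\<in>W. \<forall>X\<in>tangent_space A p. \<forall>Y\<in>tangent_space A p.
        g p X Y = g p Y X \<and>
        (\<forall>Z\<in>tangent_space A p. \<forall>a b. g p (lincomb a X b Y) Z = a * g p X Z + b * g p Y Z) \<and>
        (X \<noteq> (\<lambda>_. 0) \<longrightarrow> g p X X > 0)) \<and>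
     (\<forall>c\<in>A. \<forall>u v. smooth_on (cmap c ` (cdom c \<inter> W)) (\<lambda>y. metric_rep A g c y u v))"

text \<open>Christoffel symbols as a bilinear map \<open>(u, v) \<mapsto> \<Gamma>(u, v)\<close> on the model space, at the
  point with coordinates y.\<close>

definition christoffel ::
    "('a, 'e::euclidean_space) chart set \<Rightarrow> ('a, 'e) metric \<Rightarrow> ('a, 'e) chart \<Rightarrow>
     'e \<Rightarrow> 'e \<Rightarrow> 'e \<Rightarrow> 'e" where
  "christoffel A g c y u v = (THE w. \<forall>z. metric_rep A g c y w z =
     (frechet_derivative (\<lambda>y'. metric_rep A g c y' v z) (at y) u +
      frechet_derivative (\<lambda>y'. metric_rep A g c y' u z) (at y) v -
      frechet_derivative (\<lambda>y'. metric_rep A g c y' u v) (at y) z) / 2)"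

text \<open>The Levi-Civita covariant derivative at time t of a vector field E along the curve \<open>\<gamma>\<close>.\<close>

definition cov_deriv ::
    "('a, 'e::euclidean_space) chart set \<Rightarrow> ('a, 'e) metric \<Rightarrow> (real \<Rightarrow> 'a) \<Rightarrow>
     (real \<Rightarrow> ('a, 'e) tvec) \<Rightarrow> real \<Rightarrow> ('a, 'e) tvec" where
  "cov_deriv A g \<gamma> E t = (\<lambda>c. if c \<in> A \<and> \<gamma> t \<in> cdom c
     then vector_derivative (\<lambda>s. E s c) (at t) +
          christoffel A g c (cmap c (\<gamma> t)) (velocity A \<gamma> t c) (E t c)
     else 0)"

definition geodesic_on ::
    "('a, 'e::euclidean_space) chart set \<Rightarrow> ('a, 'e) metric \<Rightarrow> real set \<Rightarrow> (real \<Rightarrow> 'a) \<Rightarrow> bool" where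
  "geodesic_on A g J \<gamma> \<longleftrightarrow> smooth_curve A J \<gamma> \<and>
     (\<forall>t\<in>J. cov_deriv A g \<gamma> (velocity A \<gamma>) t = (\<lambda>_. 0))"

text \<open>The curvature operator \<open>R(u, v) w\<close>, with \<open>R(X, Y) = [\<nabla>\<^sub>X, \<nabla>\<^sub>Y] - \<nabla>\<^bsub>[X, Y]\<^esub>\<close>.\<close>

definition riemann_rep ::
    "('a, 'e::euclidean_space) chart set \<Rightarrow> ('a, 'e) metric \<Rightarrow> ('a, 'e) chart \<Rightarrow>
     'e \<Rightarrow> 'e \<Rightarrow> 'e \<Rightarrow> 'e \<Rightarrow> 'e" where
  "riemann_rep A g c y u v w =
     frechet_derivative (\<lambda>y'. christoffel A g c y' v w) (at y) u -
     frechet_derivative (\<lambda>y'. christoffel A g c y' u w) (at y) v +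
     christoffel A g c y u (christoffel A g c y v w) -
     christoffel A g c y v (christoffel A g c y u w)"

definition gauss_rep ::
    "('a, real^2) chart set \<Rightarrow> ('a, real^2) metric \<Rightarrow> ('a, real^2) chart \<Rightarrow> real^2 \<Rightarrow> real" where
  "gauss_rep A g c y =
     (let u = axis 1 1; v = axis 2 1; G = metric_rep A g c y
      in G (riemann_rep A g c y u v v) u / (G u u * G v v - (G u v)\<^sup>2))"

text \<open>The Gaussian curvature, as the scalar function with the usual expression in every chart; it
  exists because that expression does not depend on the chart, and is unique on the surface.\<close>

definition gaussian_curvature ::
    "('a, real^2) chart set \<Rightarrow> ('a, real^2) metric \<Rightarrow> ('a \<Rightarrow> real) \<Rightarrow> bool" where
  "gaussian_curvature A g K \<longleftrightarrow> (\<forall>c\<in>A. \<forall>x\<in>cdom c. K x = gauss_rep A g c (cmap c x))"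

definition oriented_riemannian_surface ::
    "'a topology \<Rightarrow> ('a, real^2) chart set \<Rightarrow> ('a, real^2) metric \<Rightarrow> bool" where
  "oriented_riemannian_surface T A g \<longleftrightarrow>
     smooth_manifold T A \<and> oriented_atlas A \<and> riemannian_metric_on A (topspace T) g"


section \<open>The bundle of positively oriented orthonormal frames\<close>

text \<open>A frame \<open>(x, e\<^sub>1, e\<^sub>2)\<close> consists of a point and two tangent vectors at it; \<open>\<pi>\<close> is \<open>fst\<close>.\<close>

type_synonym 'a frame = "'a \<times> ('a, real^2) tvec \<times> ('a, real^2) tvec"

abbreviation frame1 :: "'a frame \<Rightarrow> ('a, real^2) tvec" where "frame1 p \<equiv> fst (snd p)"
abbreviation frame2 :: "'a frame \<Rightarrow> ('a, real^2) tvec" where "frame2 p \<equiv> snd (snd p)"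

definition SO :: "('a, real^2) chart set \<Rightarrow> ('a, real^2) metric \<Rightarrow> 'a frame set" where
  "SO A g = {(x, e1, e2). x \<in> carrier_of A \<and> e1 \<in> tangent_space A x \<and> e2 \<in> tangent_space A x \<and>
     g x e1 e1 = 1 \<and> g x e2 e2 = 1 \<and> g x e1 e2 = 0 \<and>
     (\<forall>c\<in>A. x \<in> cdom c \<longrightarrow> 0 < det (vector [e1 c, e2 c] :: real^2^2))}"

definition rot :: "real \<Rightarrow> 'a frame \<Rightarrow> 'a frame" where
  "rot \<phi> p = (fst p,
     lincomb (cos \<phi>) (frame1 p) (sin \<phi>) (frame2 p),
     lincomb (- sin \<phi>) (frame1 p) (cos \<phi>) (frame2 p))"

text \<open>The smooth structure of the principal bundle: a smooth orthonormal frame field s over the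
  domain of a chart c of the base trivialises the bundle by \<open>(x, \<theta>) \<mapsto> s(x) \<sqdot> r(\<theta>)\<close>; restricting
  the angle to an interval of length \<open>2\<pi>\<close> gives a chart with values in \<open>(real^2) \<times> real\<close>.\<close>

definition smooth_frame_field ::
    "('a, real^2) chart set \<Rightarrow> ('a, real^2) metric \<Rightarrow> ('a, real^2) chart \<Rightarrow> ('a \<Rightarrow> 'a frame) \<Rightarrow> bool" where
  "smooth_frame_field A g c s \<longleftrightarrow> (\<forall>x\<in>cdom c. s x \<in> SO A g \<and> fst (s x) = x) \<and>
     smooth_on (cmap c ` cdom c) (\<lambda>y. frame1 (s (cinv c y)) c) \<and>
     smooth_on (cmap c ` cdom c) (\<lambda>y. frame2 (s (cinv c y)) c)"

definition frame_chart ::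
    "('a, real^2) chart \<Rightarrow> ('a \<Rightarrow> 'a frame) \<Rightarrow> real \<Rightarrow> ('a frame, (real^2) \<times> real) chart" where
  "frame_chart c s \<alpha> =
     ({rot \<theta> (s x) | x \<theta>. x \<in> cdom c \<and> \<theta> \<in> {\<alpha><..<\<alpha> + 2 * pi}},
      \<lambda>p. (cmap c (fst p), THE \<theta>. \<theta> \<in> {\<alpha><..<\<alpha> + 2 * pi} \<and> p = rot \<theta> (s (fst p))))"

definition frame_atlas ::
    "('a, real^2) chart set \<Rightarrow> ('a, real^2) metric \<Rightarrow> ('a frame, (real^2) \<times> real) chart set" where
  "frame_atlas A g = {frame_chart c s \<alpha> | c s \<alpha>. c \<in> A \<and> smooth_frame_field A g c s}"

definition dproj ::
    "('a, real^2) chart set \<Rightarrow> ('a, real^2) metric \<Rightarrow> 'a frame \<Rightarrow>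
     ('a frame, (real^2) \<times> real) tvec \<Rightarrow> ('a, real^2) tvec" where
  "dproj A g p X = differential (frame_atlas A g) A fst p X"

definition vertical ::
    "('a, real^2) chart set \<Rightarrow> ('a, real^2) metric \<Rightarrow> 'a frame \<Rightarrow>
     ('a frame, (real^2) \<times> real) tvec set" where
  "vertical A g p = tangent_to (frame_atlas A g) {q \<in> SO A g. fst q = fst p} p"

definition d_phi ::
    "('a, real^2) chart set \<Rightarrow> ('a, real^2) metric \<Rightarrow> 'a frame \<Rightarrow>
     ('a frame, (real^2) \<times> real) tvec" where
  "d_phi A g p = velocity (frame_atlas A g) (\<lambda>\<phi>. rot \<phi> p) 0"

text \<open>The horizontal space of the Levi-Civita connection at p: velocities at p of the curves of
  frames whose two members have vanishing covariant derivative (along the projected curve) at p.\<close>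

definition horizontal ::
    "('a, real^2) chart set \<Rightarrow> ('a, real^2) metric \<Rightarrow> 'a frame \<Rightarrow>
     ('a frame, (real^2) \<times> real) tvec set" where
  "horizontal A g p = {velocity (frame_atlas A g) \<sigma> 0 | \<sigma> \<epsilon>.
     \<epsilon> > 0 \<and> smooth_curve (frame_atlas A g) {-\<epsilon><..<\<epsilon>} \<sigma> \<and> \<sigma> 0 = p \<and>
     cov_deriv A g (fst \<circ> \<sigma>) (\<lambda>t. frame1 (\<sigma> t)) 0 = (\<lambda>_. 0) \<and>
     cov_deriv A g (fst \<circ> \<sigma>) (\<lambda>t. frame2 (\<sigma> t)) 0 = (\<lambda>_. 0)}"


section \<open>The Wagner lift\<close>

definition zero_set :: "('a, real^2) chart set \<Rightarrow> ('a \<Rightarrow> real) \<Rightarrow> 'a set" where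
  "zero_set A K = {x \<in> carrier_of A. K x = 0}"

definition zero_set_lift ::
    "('a, real^2) chart set \<Rightarrow> ('a, real^2) metric \<Rightarrow> ('a \<Rightarrow> real) \<Rightarrow> 'a frame set" where
  "zero_set_lift A g K = {p \<in> SO A g. fst p \<in> zero_set A K}"

text \<open>\<open>wagner_lift A g K gh\<close> and \<open>generalized_geodesic A g K gh J \<gamma>\<close> are meant for the Gaussian
  curvature K of g. The conditions below determine \<open>gh\<close> on tangent vectors off the lifted zero set,
  since the tangent spaces are the sums of the horizontal and the vertical spaces and the latter
  are spanned by \<open>d_phi\<close>.\<close>

definition wagner_lift ::
    "('a, real^2) chart set \<Rightarrow> ('a, real^2) metric \<Rightarrow> ('a \<Rightarrow> real) \<Rightarrow>
     ('a frame, (real^2) \<times> real) metric \<Rightarrow> bool" where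
  "wagner_lift A g K gh \<longleftrightarrow>
     riemannian_metric_on (frame_atlas A g) (SO A g - zero_set_lift A g K) gh \<and>
     (\<forall>p \<in> SO A g - zero_set_lift A g K.
        (\<forall>X\<in>horizontal A g p. \<forall>Y\<in>horizontal A g p.
           gh p X Y = g (fst p) (dproj A g p X) (dproj A g p Y)) \<and>
        (\<forall>X\<in>horizontal A g p. \<forall>Y\<in>vertical A g p. gh p X Y = 0) \<and>
        gh p (d_phi A g p) (d_phi A g p) = 1 / (K (fst p))\<^sup>2)"

definition generalized_geodesic ::
    "('a, real^2) chart set \<Rightarrow> ('a, real^2) metric \<Rightarrow> ('a \<Rightarrow> real) \<Rightarrow>
     ('a frame, (real^2) \<times> real) metric \<Rightarrow> real set \<Rightarrow> (real \<Rightarrow> 'a frame) \<Rightarrow> bool" where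
  "generalized_geodesic A g K gh J \<gamma> \<longleftrightarrow> smooth_curve (frame_atlas A g) J \<gamma> \<and>
     geodesic_on (frame_atlas A g) gh {t\<in>J. \<gamma> t \<in> SO A g - zero_set_lift A g K} \<gamma>"

end

theory Submission
  imports Defs
begin

text \<open>Over a framed chart the frame bundle has coordinates \<open>(y, \<theta>)\<close>, and with the connection form
  \<open>\<omega>\<close> of the frame field the velocity of \<open>\<gamma>\<close> is horizontal iff \<open>\<mu> = \<theta>' + \<omega>(y')\<close> vanishes. The
  lifted metric is \<open>G(u, u') + (\<tau> + \<omega>(u)) (\<tau>' + \<omega>(u')) / K\<^sup>2\<close>, which does not depend on \<open>\<theta>\<close>. Hence
  \<open>\<mu>/K\<^sup>2\<close> is constant along geodesics (Clairaut's integral), so \<open>\<mu>\<close> has to tend to 0 as \<open>K\<close> does.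
  No control of \<open>K\<close> along \<open>\<gamma>\<close> is needed for this: if \<open>\<mu>(t\<^sub>0) \<noteq> 0\<close> then \<open>K\<^sup>2/\<mu>\<close> is continuous near
  \<open>t\<^sub>0\<close> and locally constant off its zero set, so it vanishes identically near \<open>t\<^sub>0\<close>; but then \<open>\<gamma>\<close>
  runs inside the lifted zero set, contradicting transversality.\<close>

section \<open>Smooth maps\<close>

text \<open>The constancy of \<open>\<mu>/K\<^sup>2\<close> is available only off the lifted zero
  set, where the geodesic equation holds. On that set nothing is known about \<open>gh\<close>, so
  the passage to \<open>t\<^sub>0\<close> uses only quantities that stay continuous there:
  \<open>\<mu>\<close>, built from the velocity and \<open>\<omega>\<close>, and \<open>K\<close>
  along the curve. Most of the work is forced by the encodings. The bundle is given by charts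
  without a topology, so its transition maps must be shown to be smooth before velocities in
  different charts can be compared. A vector is \<open>horizontal\<close> if some curve of frames
  realises it with covariant derivatives that vanish in every chart of the base; passing from one
  chart to all takes the inhomogeneous transformation law of the Christoffel symbols, hence the
  symmetry of second derivatives. Slice charts of the zero set need not belong to \<open>A\<close>,
  so transversality is tested in the atlas \<open>insert c' A\<close>. There a curve that stays over
  the zero set has a base velocity annihilated by the normal of the slice; if
  \<open>\<gamma>\<close> were such a curve, the span in \<open>transversal_curve\<close> would
  project into a line.\<close>

lemma linear_expand:
  fixes f :: "'a::euclidean_space \<Rightarrow> 'b::real_vector"
  assumes "linear f" shows "f w = (\<Sum>b\<in>Basis. (w \<bullet> b) *\<^sub>R f b)"
proof -
  have "f w = f (\<Sum>b\<in>Basis. (w \<bullet> b) *\<^sub>R b)" by (simp add: euclidean_representation)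
  also have "\<dots> = (\<Sum>b\<in>Basis. (w \<bullet> b) *\<^sub>R f b)"
    by (simp add: linear_sum[OF assms] linear_scale[OF assms])
  finally show ?thesis .
qed

lemma frechet_derivativeI:
  "(f has_derivative f') (at x) \<Longrightarrow> frechet_derivative f (at x) = f'"
  using frechet_derivative_at by metis

lemma frechet_derivative_cong_open:
  assumes "open S" "x \<in> S" "\<And>y. y \<in> S \<Longrightarrow> f y = g y"
  shows "frechet_derivative f (at x) = frechet_derivative g (at x)"
proof -
  have "(f has_derivative F) (at x) \<longleftrightarrow> (g has_derivative F) (at x)" for F
    using assms by (metis has_derivative_transform_within_open)
  then show ?thesis unfolding frechet_derivative_def by simp
qed

lemma differentiable_cong_open:
  assumes "open S" "x \<in> S" "\<And>y. y \<in> S \<Longrightarrow> f y = g y"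
  shows "f differentiable (at x) \<longleftrightarrow> g differentiable (at x)"
  unfolding differentiable_def using assms
  by (metis has_derivative_transform_within_open)

lemma Ck_on_cong:
  assumes "open S" "\<And>x. x \<in> S \<Longrightarrow> f x = g x"
  shows "Ck_on k S f \<longleftrightarrow> Ck_on k S g"
  using assms(2)
proof (induction k arbitrary: f g)
  case 0
  then show ?case by (simp cong: continuous_on_cong)
next
  case (Suc k)
  have "Ck_on k S (\<lambda>x. frechet_derivative f (at x) v) \<longleftrightarrow> Ck_on k S (\<lambda>x. frechet_derivative g (at x) v)" for v
    by (rule Suc.IH) (metis frechet_derivative_cong_open assms(1) Suc.prems)
  moreover have "f differentiable (at x) \<longleftrightarrow> g differentiable (at x)" if "x \<in> S" for x
    using differentiable_cong_open assms(1) Suc.prems that by metis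
  ultimately show ?case by simp
qed

lemma Ck_on_subset: "Ck_on k S f \<Longrightarrow> U \<subseteq> S \<Longrightarrow> Ck_on k U f"
  by (induction k arbitrary: f) (auto intro: continuous_on_subset)

lemma Ck_on_continuous: "Ck_on k S f \<Longrightarrow> continuous_on S f"
  by (cases k) (auto intro!: continuous_at_imp_continuous_on differentiable_imp_continuous_within)

lemma Ck_on_SucD: "Ck_on (Suc k) S f \<Longrightarrow> Ck_on k S f"
proof (induction k arbitrary: f)
  case 0
  then show ?case using Ck_on_continuous by fastforce
next
  case (Suc k)
  then show ?case by (metis Ck_on.simps(2))
qed

text \<open>Admits any explicit family of derivatives in place of \<open>frechet_derivative\<close>;
  the rules for sums, products and compositions are inductions through this rule and its converse
  \<open>Ck_on_SucE\<close>.\<close>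

lemma Ck_on_SucI:
  assumes "\<And>x. x \<in> S \<Longrightarrow> (f has_derivative f' x) (at x)" "open S"
    and "\<And>v. Ck_on k S (\<lambda>x. f' x v)"
  shows "Ck_on (Suc k) S f"
proof -
  have "Ck_on k S (\<lambda>x. frechet_derivative f (at x) v)" for v
    using assms(3)[of v] Ck_on_cong[OF assms(2), of "\<lambda>x. frechet_derivative f (at x) v" "\<lambda>x. f' x v"]
      frechet_derivativeI[OF assms(1)] by simp
  then show ?thesis using assms(1) by (auto simp: differentiable_def)
qed

lemma Ck_on_SucE:
  assumes "Ck_on (Suc k) S f"
  obtains f' where "\<And>x. x \<in> S \<Longrightarrow> (f has_derivative f' x) (at x)" "\<And>v. Ck_on k S (\<lambda>x. f' x v)"
  using assms frechet_derivative_works that[of "\<lambda>x. frechet_derivative f (at x)"]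
  by auto

lemma Ck_on_const: "Ck_on k S (\<lambda>_. c)"
  by (induction k arbitrary: c) simp_all

lemma Ck_on_bounded_linear:
  assumes "bounded_linear f" "open S" shows "Ck_on k S f"
proof (cases k)
  case 0
  then show ?thesis using assms by (simp add: linear_continuous_on)
next
  case (Suc n)
  show ?thesis unfolding Suc
    by (rule Ck_on_SucI[where f' = "\<lambda>_. f"])
      (use assms in \<open>auto intro: bounded_linear_imp_has_derivative Ck_on_const\<close>)
qed

lemma Ck_on_add:
  assumes "open S" "Ck_on k S f" "Ck_on k S g" shows "Ck_on k S (\<lambda>x. f x + g x)"
  using assms(2,3)
proof (induction k arbitrary: f g)
  case 0
  then show ?case by (simp add: continuous_on_add)
next
  case (Suc k)
  obtain f' where f: "\<And>x. x \<in> S \<Longrightarrow> (f has_derivative f' x) (at x)" "\<And>v. Ck_on k S (\<lambda>x. f' x v)"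
    using Suc.prems(1) by (rule Ck_on_SucE) blast
  obtain g' where g: "\<And>x. x \<in> S \<Longrightarrow> (g has_derivative g' x) (at x)" "\<And>v. Ck_on k S (\<lambda>x. g' x v)"
    using Suc.prems(2) by (rule Ck_on_SucE) blast
  show ?case
    by (rule Ck_on_SucI[where f' = "\<lambda>x v. f' x v + g' x v"])
      (use f g assms(1) Suc.IH in \<open>auto intro: has_derivative_add\<close>)
qed

lemma Ck_on_sum:
  assumes "open S" "\<And>i. i \<in> I \<Longrightarrow> Ck_on k S (f i)" shows "Ck_on k S (\<lambda>x. \<Sum>i\<in>I. f i x)"
  using assms(2)
proof (induction I rule: infinite_finite_induct)
  case (insert i I)
  then show ?case using Ck_on_add[OF assms(1), of k "f i"] by simp
qed (simp_all add: Ck_on_const)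

lemma (in bounded_bilinear) Ck_on_prod:
  assumes "open S" "Ck_on k S f" "Ck_on k S g" shows "Ck_on k S (\<lambda>x. prod (f x) (g x))"
  using assms(2,3)
proof (induction k arbitrary: f g)
  case 0
  then show ?case by (simp add: continuous_on)
next
  case (Suc k)
  obtain f' where f: "\<And>x. x \<in> S \<Longrightarrow> (f has_derivative f' x) (at x)" "\<And>v. Ck_on k S (\<lambda>x. f' x v)"
    using Suc.prems(1) by (rule Ck_on_SucE) blast
  obtain g' where g: "\<And>x. x \<in> S \<Longrightarrow> (g has_derivative g' x) (at x)" "\<And>v. Ck_on k S (\<lambda>x. g' x v)"
    using Suc.prems(2) by (rule Ck_on_SucE) blast
  show ?case
    by (rule Ck_on_SucI[where f' = "\<lambda>x v. prod (f x) (g' x v) + prod (f' x v) (g x)"])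
      (intro FDERIV Ck_on_add Suc.IH Suc.prems[THEN Ck_on_SucD] f g assms(1); assumption)+
qed

text \<open>The chain rule evaluates \<open>f'\<close> in the direction \<open>g' x v\<close>, which
  moves with \<open>x\<close>, whereas \<open>Ck_on\<close> speaks of fixed directions. Expanding
  the moving direction in the basis leaves sums of products of functions of class \<open>k\<close>,
  the factor \<open>f' (g x) b\<close> by the induction hypothesis.\<close>

lemma Ck_on_compose:
  fixes g :: "'a::euclidean_space \<Rightarrow> 'b::euclidean_space"
  assumes "open S" "open U" "g ` S \<subseteq> U" "Ck_on k S g" "Ck_on k U f"
  shows "Ck_on k S (\<lambda>x. f (g x))"
  using assms(4,5)
proof (induction k arbitrary: f)
  case 0
  then have "continuous_on (g ` S) f" using assms(3) continuous_on_subset by auto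
  with 0 show ?case using continuous_on_compose[of S g f] by (simp add: comp_def)
next
  case (Suc k)
  obtain f' where f: "\<And>x. x \<in> U \<Longrightarrow> (f has_derivative f' x) (at x)" "\<And>v. Ck_on k U (\<lambda>x. f' x v)"
    using Suc.prems(2) by (rule Ck_on_SucE) blast
  obtain g' where g: "\<And>x. x \<in> S \<Longrightarrow> (g has_derivative g' x) (at x)" "\<And>v. Ck_on k S (\<lambda>x. g' x v)"
    using Suc.prems(1) by (rule Ck_on_SucE) blast
  have der: "((\<lambda>x. f (g x)) has_derivative (\<lambda>v. \<Sum>b\<in>Basis. (g' x v \<bullet> b) *\<^sub>R f' (g x) b)) (at x)"
    if x: "x \<in> S" for x
  proof -
    have d: "(f has_derivative f' (g x)) (at (g x))" using f(1) assms(3) x by blast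
    then have "linear (f' (g x))" by (rule has_derivative_linear)
    then have lin: "f' (g x) w = (\<Sum>b\<in>Basis. (w \<bullet> b) *\<^sub>R f' (g x) b)" for w
      by (rule linear_expand)
    have "f' (g x) \<circ> g' x = (\<lambda>v. \<Sum>b\<in>Basis. (g' x v \<bullet> b) *\<^sub>R f' (g x) b)"
      by (intro ext, simp only: comp_apply) (rule lin)
    then show ?thesis
      using diff_chain_at[OF g(1)[OF x] d] by (simp add: comp_def)
  qed
  show ?case
  proof (rule Ck_on_SucI[OF der \<open>open S\<close>])
    fix v
    show "Ck_on k S (\<lambda>x. \<Sum>b\<in>Basis. (g' x v \<bullet> b) *\<^sub>R f' (g x) b)"
      by (intro Ck_on_sum bounded_bilinear.Ck_on_prod[OF bounded_bilinear_scaleR]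
          bounded_bilinear.Ck_on_prod[OF bounded_bilinear_inner] Ck_on_const g Suc.IH f
          Ck_on_SucD[OF Suc.prems(1)] \<open>open S\<close>)
  qed
qed

lemma smooth_on_cong:
  "open S \<Longrightarrow> (\<And>x. x \<in> S \<Longrightarrow> f x = g x) \<Longrightarrow> smooth_on S f \<longleftrightarrow> smooth_on S g"
  unfolding smooth_on_def using Ck_on_cong by metis

lemma smooth_on_subset: "smooth_on S f \<Longrightarrow> U \<subseteq> S \<Longrightarrow> smooth_on U f"
  unfolding smooth_on_def using Ck_on_subset by metis

lemma smooth_on_continuous: "smooth_on S f \<Longrightarrow> continuous_on S f"
  unfolding smooth_on_def using Ck_on_continuous by blast

lemma smooth_on_const: "smooth_on S (\<lambda>_. c)"
  unfolding smooth_on_def using Ck_on_const by blast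

lemma smooth_on_bounded_linear: "bounded_linear f \<Longrightarrow> open S \<Longrightarrow> smooth_on S f"
  unfolding smooth_on_def using Ck_on_bounded_linear by blast

lemma smooth_on_ident: "open S \<Longrightarrow> smooth_on S (\<lambda>x. x)"
  by (rule smooth_on_bounded_linear) (rule bounded_linear_ident)

lemma smooth_on_add: "open S \<Longrightarrow> smooth_on S f \<Longrightarrow> smooth_on S g \<Longrightarrow> smooth_on S (\<lambda>x. f x + g x)"
  unfolding smooth_on_def using Ck_on_add by blast

lemma smooth_on_sum:
  "open S \<Longrightarrow> (\<And>i. i \<in> I \<Longrightarrow> smooth_on S (f i)) \<Longrightarrow> smooth_on S (\<lambda>x. \<Sum>i\<in>I. f i x)"
  unfolding smooth_on_def by (simp add: Ck_on_sum)

lemma (in bounded_bilinear) smooth_on_prod: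
  "open S \<Longrightarrow> smooth_on S f \<Longrightarrow> smooth_on S g \<Longrightarrow> smooth_on S (\<lambda>x. prod (f x) (g x))"
  unfolding smooth_on_def using Ck_on_prod by blast

lemmas smooth_on_scaleR = bounded_bilinear.smooth_on_prod[OF bounded_bilinear_scaleR]
lemmas smooth_on_inner = bounded_bilinear.smooth_on_prod[OF bounded_bilinear_inner]

lemma smooth_on_mult:
  fixes f g :: "'a::real_normed_vector \<Rightarrow> real"
  shows "open S \<Longrightarrow> smooth_on S f \<Longrightarrow> smooth_on S g \<Longrightarrow> smooth_on S (\<lambda>x. f x * g x)"
  by (rule bounded_bilinear.smooth_on_prod[OF bounded_bilinear_mult])

lemma smooth_on_minus: "open S \<Longrightarrow> smooth_on S f \<Longrightarrow> smooth_on S (\<lambda>x. - f x)"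
  using smooth_on_scaleR[OF _ smooth_on_const[of S "-1"], of f] by simp

lemma smooth_on_diff: "open S \<Longrightarrow> smooth_on S f \<Longrightarrow> smooth_on S g \<Longrightarrow> smooth_on S (\<lambda>x. f x - g x)"
  using smooth_on_add[OF _ _ smooth_on_minus, of S f g] by simp

lemma smooth_on_compose:
  fixes g :: "'a::euclidean_space \<Rightarrow> 'b::euclidean_space"
  assumes "smooth_on U f" "smooth_on S g" "open S" "open U" "g ` S \<subseteq> U"
  shows "smooth_on S (\<lambda>x. f (g x))"
  using assms Ck_on_compose unfolding smooth_on_def by blast

lemma smooth_on_linear_compose:
  fixes f :: "'a::euclidean_space \<Rightarrow> 'b::euclidean_space"
  assumes "bounded_linear h" "smooth_on S f" "open S"
  shows "smooth_on S (\<lambda>x. h (f x))"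
  by (rule smooth_on_compose[OF smooth_on_bounded_linear[OF assms(1) open_UNIV] assms(2,3)]) auto

lemma smooth_on_Pair:
  fixes f :: "'a::real_normed_vector \<Rightarrow> 'b::euclidean_space" and g :: "'a \<Rightarrow> 'c::euclidean_space"
  assumes "open S" "smooth_on S f" "smooth_on S g"
  shows "smooth_on S (\<lambda>x. (f x, g x))"
proof -
  have "Ck_on k S (\<lambda>x. (f x, g x))" if "Ck_on k S f" "Ck_on k S g" for k
    using that
  proof (induction k arbitrary: f g)
    case 0
    then show ?case by (simp add: continuous_on_Pair)
  next
    case (Suc k)
    obtain f' where f: "\<And>x. x \<in> S \<Longrightarrow> (f has_derivative f' x) (at x)" "\<And>v. Ck_on k S (\<lambda>x. f' x v)"
      using Suc.prems(1) by (rule Ck_on_SucE) blast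
    obtain g' where g: "\<And>x. x \<in> S \<Longrightarrow> (g has_derivative g' x) (at x)" "\<And>v. Ck_on k S (\<lambda>x. g' x v)"
      using Suc.prems(2) by (rule Ck_on_SucE) blast
    show ?case
      by (rule Ck_on_SucI[where f' = "\<lambda>x v. (f' x v, g' x v)"])
        (use f g assms(1) Suc.IH in \<open>auto intro: has_derivative_Pair\<close>)
  qed
  then show ?thesis using assms(2,3) unfolding smooth_on_def by blast
qed

lemma smooth_on_differentiable: "smooth_on S f \<Longrightarrow> x \<in> S \<Longrightarrow> f differentiable (at x)"
  unfolding smooth_on_def by (metis Ck_on.simps(2))

lemma smooth_on_has_derivative:
  "smooth_on S f \<Longrightarrow> x \<in> S \<Longrightarrow> (f has_derivative frechet_derivative f (at x)) (at x)"
  using smooth_on_differentiable frechet_derivative_works by blast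

lemma smooth_on_linear_derivative:
  "smooth_on S f \<Longrightarrow> x \<in> S \<Longrightarrow> linear (frechet_derivative f (at x))"
  using smooth_on_has_derivative has_derivative_linear by blast

lemma smooth_on_derivative: "smooth_on S f \<Longrightarrow> smooth_on S (\<lambda>x. frechet_derivative f (at x) v)"
  unfolding smooth_on_def by (metis Ck_on.simps(2))

text \<open>As in \<open>Ck_on_compose\<close>, the moving direction \<open>w x\<close> is expanded
  in the basis.\<close>

lemma smooth_on_derivative_along:
  fixes f :: "'a::euclidean_space \<Rightarrow> 'b::real_normed_vector"
    and g :: "'c::euclidean_space \<Rightarrow> 'a"
  assumes "smooth_on U f" "open U" "open S" "smooth_on S g" "smooth_on S w" "g ` S \<subseteq> U"
  shows "smooth_on S (\<lambda>x. frechet_derivative f (at (g x)) (w x))"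
proof -
  have sm: "smooth_on S (\<lambda>x. \<Sum>b\<in>Basis. (w x \<bullet> b) *\<^sub>R frechet_derivative f (at (g x)) b)"
    by (intro smooth_on_sum smooth_on_scaleR smooth_on_inner smooth_on_const
        smooth_on_compose[OF smooth_on_derivative[OF assms(1)] assms(4,3,2,6)] assms)
  have eq: "frechet_derivative f (at (g x)) (w x)
      = (\<Sum>b\<in>Basis. (w x \<bullet> b) *\<^sub>R frechet_derivative f (at (g x)) b)" if "x \<in> S" for x
    by (rule linear_expand) (use smooth_on_linear_derivative assms(1,6) that in blast)
  show ?thesis by (rule iffD2[OF smooth_on_cong[OF assms(3) eq] sm])
qed

text \<open>Up to a constant the derivative is a product of the function with itself, so class
  \<open>k\<close> yields class \<open>Suc k\<close>.\<close>

lemma smooth_on_real_inverse: "smooth_on (- {0}) (inverse :: real \<Rightarrow> real)"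
proof -
  have "Ck_on k (- {0}) (inverse :: real \<Rightarrow> real)" for k
  proof (induction k)
    case 0
    then show ?case by (auto intro!: continuous_intros)
  next
    case (Suc k)
    show ?case
    proof (rule Ck_on_SucI)
      show "(inverse has_derivative (\<lambda>v. - (inverse x * v * inverse x))) (at x)" if "x \<in> - {0}" for x :: real
        using has_derivative_inverse' that by fastforce
      show "Ck_on k (- {0}) (\<lambda>x::real. - (inverse x * v * inverse x))" for v
        using bounded_bilinear.Ck_on_prod[OF bounded_bilinear_mult _
            bounded_bilinear.Ck_on_prod[OF bounded_bilinear_mult _ Suc Suc] Ck_on_const[of k _ "-v"]]
        by (simp add: open_Compl mult_ac)
    qed auto
  qed
  then show ?thesis unfolding smooth_on_def by blast
qed

lemma smooth_on_divide:
  fixes f g :: "'a::euclidean_space \<Rightarrow> real"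
  assumes "open S" "smooth_on S f" "smooth_on S g" "\<And>x. x \<in> S \<Longrightarrow> g x \<noteq> 0"
  shows "smooth_on S (\<lambda>x. f x / g x)"
  unfolding divide_inverse
  by (intro smooth_on_mult smooth_on_compose[OF smooth_on_real_inverse] assms) (use assms in auto)

text \<open>One induction has to carry both claims, since each function is the derivative of the
  other up to sign.\<close>

lemma smooth_on_sin_cos: "smooth_on UNIV (sin :: real \<Rightarrow> real)" "smooth_on UNIV (cos :: real \<Rightarrow> real)"
proof -
  have "Ck_on k UNIV (sin :: real \<Rightarrow> real) \<and> Ck_on k UNIV (cos :: real \<Rightarrow> real)" for k
  proof (induction k)
    case 0
    then show ?case by (auto intro!: continuous_intros)
  next
    case (Suc k)
    have m: "Ck_on k UNIV (\<lambda>x. v * f x)" if "Ck_on k UNIV f" for f :: "real \<Rightarrow> real" and v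
      by (rule bounded_bilinear.Ck_on_prod[OF bounded_bilinear_mult _ Ck_on_const that]) simp
    have "Ck_on (Suc k) UNIV (sin :: real \<Rightarrow> real)"
      by (rule Ck_on_SucI[where f' = "\<lambda>x v. v * cos x"])
        (use m Suc in \<open>auto intro!: derivative_eq_intros\<close>)
    moreover have "Ck_on (Suc k) UNIV (cos :: real \<Rightarrow> real)"
      by (rule Ck_on_SucI[where f' = "\<lambda>x v. (-v) * sin x"])
        (use m[OF conjunct1[OF Suc], of "- v" for v] in \<open>auto intro!: derivative_eq_intros\<close>)
    ultimately show ?case by blast
  qed
  then show "smooth_on UNIV (sin :: real \<Rightarrow> real)" "smooth_on UNIV (cos :: real \<Rightarrow> real)"
    unfolding smooth_on_def by auto
qed

lemma smooth_on_arctan: "smooth_on UNIV arctan"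
proof -
  have sm: "smooth_on UNIV (\<lambda>x::real. v * inverse (1 + x * x))" for v
    by (intro smooth_on_mult smooth_on_const smooth_on_compose[OF smooth_on_real_inverse]
        smooth_on_add smooth_on_ident) (auto simp: add_nonneg_eq_0_iff)
  have "Ck_on k UNIV arctan" for k
  proof (cases k)
    case 0
    then show ?thesis using continuous_on_arctan[OF continuous_on_id] by auto
  next
    case (Suc n)
    show ?thesis unfolding Suc
      by (rule Ck_on_SucI[where f' = "\<lambda>x v. v * inverse (1 + x * x)"])
        (use sm in \<open>auto intro!: derivative_eq_intros simp: smooth_on_def power2_eq_square\<close>)
  qed
  then show ?thesis unfolding smooth_on_def by blast
qed

section \<open>Symmetry of second derivatives\<close>

lemma second_difference_mean_value:
  fixes f :: "'a::euclidean_space \<Rightarrow> real"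
  assumes "smooth_on S f" "h > 0"
    and "\<And>s t. 0 \<le> s \<Longrightarrow> s \<le> h \<Longrightarrow> 0 \<le> t \<Longrightarrow> t \<le> h \<Longrightarrow> x + s *\<^sub>R u + t *\<^sub>R v \<in> S"
  obtains s t where "0 < s" "s < h" "0 < t" "t < h"
    "f (x + h *\<^sub>R u + h *\<^sub>R v) - f (x + h *\<^sub>R u) - f (x + h *\<^sub>R v) + f x
      = h * h * frechet_derivative (\<lambda>y. frechet_derivative f (at y) u) (at (x + s *\<^sub>R u + t *\<^sub>R v)) v"
proof -
  define F where "F = (\<lambda>y. frechet_derivative f (at y) u)"
  have smF: "smooth_on S F" unfolding F_def by (rule smooth_on_derivative[OF assms(1)])
  have line: "((\<lambda>s. \<phi> (p + s *\<^sub>R w)) has_real_derivative frechet_derivative \<phi> (at (p + s *\<^sub>R w)) w) (at s)"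
    if "smooth_on S \<phi>" "p + s *\<^sub>R w \<in> S" for \<phi> :: "'a \<Rightarrow> real" and p s w
  proof -
    have "((\<lambda>s. p + s *\<^sub>R w) has_derivative (\<lambda>r. r *\<^sub>R w)) (at s)"
      by (auto intro!: derivative_eq_intros)
    from has_derivative_compose[OF this smooth_on_has_derivative[OF that]]
    show ?thesis
      using linear_scale[OF smooth_on_linear_derivative[OF that]]
      by (simp add: has_field_derivative_def mult_commute_abs)
  qed
  \<comment> \<open>The second difference is the increment in \<open>s\<close> of \<open>f (x + h
    *\<^sub>R v + s *\<^sub>R u) - f (x + s *\<^sub>R u)\<close>; a second mean value step, in
    direction \<open>v\<close>, then reaches the mixed derivative.\<close>
  have "\<exists>z>0. z < h \<and> (f (x + h *\<^sub>R v + h *\<^sub>R u) - f (x + h *\<^sub>R u)) - (f (x + h *\<^sub>R v + 0 *\<^sub>R u) - f (x + 0 *\<^sub>R u))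
      = (h - 0) * (F (x + h *\<^sub>R v + z *\<^sub>R u) - F (x + z *\<^sub>R u))"
    by (rule MVT2[OF assms(2)], unfold F_def)
      (intro DERIV_diff line assms, use assms(2) assms(3)[of _ h] assms(3)[of _ 0] in
        \<open>auto simp: algebra_simps\<close>)
  then obtain s where s: "0 < s" "s < h"
    "f (x + h *\<^sub>R u + h *\<^sub>R v) - f (x + h *\<^sub>R u) - f (x + h *\<^sub>R v) + f x
      = h * (F (x + s *\<^sub>R u + h *\<^sub>R v) - F (x + s *\<^sub>R u))"
    by (auto simp: algebra_simps)
  have "\<exists>z>0. z < h \<and> F (x + s *\<^sub>R u + h *\<^sub>R v) - F (x + s *\<^sub>R u + 0 *\<^sub>R v)
      = (h - 0) * frechet_derivative F (at (x + s *\<^sub>R u + z *\<^sub>R v)) v"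
    by (rule MVT2[OF assms(2)])
      (intro line smF assms, use s in auto)
  then obtain t where "0 < t" "t < h" "F (x + s *\<^sub>R u + h *\<^sub>R v) - F (x + s *\<^sub>R u)
      = h * frechet_derivative F (at (x + s *\<^sub>R u + t *\<^sub>R v)) v"
    by auto
  with s show ?thesis using that[of s t] by (simp add: F_def)
qed

text \<open>Schwarz's theorem by second differences: the same second difference, divided by
  \<open>h * h\<close>, is a value of either mixed derivative at a point near \<open>x\<close>, and
  both are continuous at \<open>x\<close>.\<close>

lemma second_derivative_symmetric_real:
  fixes f :: "'a::euclidean_space \<Rightarrow> real"
  assumes sm: "smooth_on S f" and "open S" "x \<in> S"
  shows "frechet_derivative (\<lambda>y. frechet_derivative f (at y) u) (at x) v
       = frechet_derivative (\<lambda>y. frechet_derivative f (at y) v) (at x) u"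
proof -
  let ?A = "\<lambda>y. frechet_derivative (\<lambda>y. frechet_derivative f (at y) u) (at y) v"
  let ?B = "\<lambda>y. frechet_derivative (\<lambda>y. frechet_derivative f (at y) v) (at y) u"
  have cont: "isCont ?A x" "isCont ?B x"
    using smooth_on_continuous[OF smooth_on_derivative[OF smooth_on_derivative[OF sm]]]
      assms(2,3) continuous_on_eq_continuous_at by blast+
  have "\<bar>?A x - ?B x\<bar> < e" if "e > 0" for e
  proof -
    obtain d1 where d1: "d1 > 0" "\<And>y. dist y x < d1 \<Longrightarrow> dist (?A y) (?A x) < e / 2"
      using cont(1) \<open>e > 0\<close> unfolding continuous_at_eps_delta by (metis half_gt_zero)
    obtain d2 where d2: "d2 > 0" "\<And>y. dist y x < d2 \<Longrightarrow> dist (?B y) (?B x) < e / 2"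
      using cont(2) \<open>e > 0\<close> unfolding continuous_at_eps_delta by (metis half_gt_zero)
    obtain d3 where d3: "d3 > 0" "ball x d3 \<subseteq> S"
      using assms(2,3) open_contains_ball by blast
    define d where "d = min d1 (min d2 d3)"
    \<comment> \<open>Keeps the parallelogram spanned by \<open>h *\<^sub>R u\<close> and
      \<open>h *\<^sub>R v\<close> within \<open>d / 2\<close> of \<open>x\<close>; the summand 1
      covers \<open>u = v = 0\<close>.\<close>
    define h where "h = d / (2 * (norm u + norm v + 1))"
    have "d > 0" "h > 0" unfolding h_def d_def using d1 d2 d3 by (auto intro!: divide_pos_pos add_nonneg_pos)
    have near: "dist (x + s *\<^sub>R u + t *\<^sub>R v) x < d" if "0 \<le> s" "s \<le> h" "0 \<le> t" "t \<le> h" for s t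
    proof -
      have "norm (s *\<^sub>R u + t *\<^sub>R v) \<le> s * norm u + t * norm v"
        using norm_triangle_ineq[of "s *\<^sub>R u" "t *\<^sub>R v"] that by simp
      also have "\<dots> \<le> h * norm u + h * norm v" using that by (intro add_mono mult_right_mono) auto
      also have "\<dots> \<le> h * (norm u + norm v + 1)" using \<open>h > 0\<close> by (simp add: algebra_simps)
      also have "\<dots> = d / 2"
      proof -
        have "norm u + norm v + 1 > 0" by (simp add: add_nonneg_pos)
        then show ?thesis unfolding h_def by (simp add: field_simps)
      qed
      also have "\<dots> < d" using \<open>d > 0\<close> by simp
      finally show ?thesis by (simp add: dist_norm add.assoc)
    qed
    have inS: "y \<in> S" if "dist y x < d" for y
      using that d3 by (auto simp: d_def dist_commute subset_eq)
    obtain s t where st: "0 < s" "s < h" "0 < t" "t < h"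
      "f (x + h *\<^sub>R u + h *\<^sub>R v) - f (x + h *\<^sub>R u) - f (x + h *\<^sub>R v) + f x
        = h * h * ?A (x + s *\<^sub>R u + t *\<^sub>R v)"
      by (rule second_difference_mean_value[OF sm \<open>h > 0\<close>, of x u v]) (use inS near in auto)
    obtain s' t' where st': "0 < s'" "s' < h" "0 < t'" "t' < h"
      "f (x + h *\<^sub>R v + h *\<^sub>R u) - f (x + h *\<^sub>R v) - f (x + h *\<^sub>R u) + f x
        = h * h * ?B (x + s' *\<^sub>R v + t' *\<^sub>R u)"
    proof (rule second_difference_mean_value[OF sm \<open>h > 0\<close>, of x v u])
      show "x + s *\<^sub>R v + t *\<^sub>R u \<in> S" if "0 \<le> s" "s \<le> h" "0 \<le> t" "t \<le> h" for s t
        using inS[OF near[of t s]] that by (simp add: algebra_simps)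
    qed blast
    have "h * h * ?A (x + s *\<^sub>R u + t *\<^sub>R v) = h * h * ?B (x + s' *\<^sub>R v + t' *\<^sub>R u)"
      using st(5) st'(5) by (simp add: algebra_simps)
    then have eq: "?A (x + s *\<^sub>R u + t *\<^sub>R v) = ?B (x + s' *\<^sub>R v + t' *\<^sub>R u)"
      using \<open>h > 0\<close> by simp
    have "dist (?A (x + s *\<^sub>R u + t *\<^sub>R v)) (?A x) < e / 2"
      by (rule d1(2)) (use near[of s t] st in \<open>auto simp: d_def\<close>)
    moreover have "dist (?B (x + s' *\<^sub>R v + t' *\<^sub>R u)) (?B x) < e / 2"
      by (rule d2(2)) (use near[of t' s'] st' in \<open>auto simp: d_def add_ac\<close>)
    ultimately have "dist (?A x) (?B x) < e"
      unfolding eq by (rule dist_triangle_half_r)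
    then show ?thesis by (simp add: dist_real_def)
  qed
  from this[of "\<bar>?A x - ?B x\<bar>"] show ?thesis by auto
qed

lemma second_derivative_symmetric:
  fixes f :: "'a::euclidean_space \<Rightarrow> 'b::euclidean_space"
  assumes sm: "smooth_on S f" and S: "open S" and x: "x \<in> S"
  shows "frechet_derivative (\<lambda>y. frechet_derivative f (at y) u) (at x) v
       = frechet_derivative (\<lambda>y. frechet_derivative f (at y) v) (at x) u"
proof (rule euclidean_eqI)
  fix b :: 'b assume "b \<in> Basis"
  have comp: "frechet_derivative (\<lambda>y. g y \<bullet> b) (at y) w = frechet_derivative g (at y) w \<bullet> b"
    if "smooth_on S g" "y \<in> S" for g :: "'a \<Rightarrow> 'b" and w y
    using frechet_derivativeI[OF has_derivative_inner_left[OF smooth_on_has_derivative[OF that]]] by metis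
  have "frechet_derivative (\<lambda>y. frechet_derivative f (at y) u) (at x) v \<bullet> b
      = frechet_derivative (\<lambda>y. frechet_derivative (\<lambda>y. f y \<bullet> b) (at y) u) (at x) v" for u v
    unfolding comp[OF smooth_on_derivative[OF sm] x, symmetric]
    by (rule fun_cong[OF frechet_derivative_cong_open[OF S x]]) (simp add: comp[OF sm])
  moreover have "smooth_on S (\<lambda>y. f y \<bullet> b)"
    by (intro smooth_on_inner S sm smooth_on_const)
  ultimately show "frechet_derivative (\<lambda>y. frechet_derivative f (at y) u) (at x) v \<bullet> b
      = frechet_derivative (\<lambda>y. frechet_derivative f (at y) v) (at x) u \<bullet> b"
    using second_derivative_symmetric_real[OF _ S x] by metis
qed

section \<open>Smooth atlases\<close>

lemma cinv_in:
  "y \<in> cmap c ` cdom c \<Longrightarrow> cinv c y \<in> cdom c \<and> cmap c (cinv c y) = y"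
  unfolding cinv_def by (simp add: inv_into_into f_inv_into_f)

lemma open_preimage_on:
  assumes "open I" "continuous_on I f" "open V" shows "open {t\<in>I. f t \<in> V}"
proof -
  have "open (f -` V \<inter> I)" using assms continuous_on_open_vimage by blast
  moreover have "f -` V \<inter> I = {t\<in>I. f t \<in> V}" by auto
  ultimately show ?thesis by simp
qed

text \<open>What \<open>smooth_manifold\<close> says about the charts alone. The frame bundle comes
  without a topology, so this is the common ground on which surface and bundle are treated.\<close>

locale smooth_atlas =
  fixes A :: "('a, 'e::euclidean_space) chart set"
  assumes inj: "c \<in> A \<Longrightarrow> inj_on (cmap c) (cdom c)"
    and open_overlap: "c \<in> A \<Longrightarrow> c' \<in> A \<Longrightarrow> open (cmap c ` (cdom c \<inter> cdom c'))"
    and smooth_transition: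
      "c \<in> A \<Longrightarrow> c' \<in> A \<Longrightarrow> smooth_on (cmap c ` (cdom c \<inter> cdom c')) (transition c c')"
begin

lemma cinv_cmap: "c \<in> A \<Longrightarrow> p \<in> cdom c \<Longrightarrow> cinv c (cmap c p) = p"
  unfolding cinv_def using inj by (simp add: inv_into_f_f)

lemma transition_cmap: "c \<in> A \<Longrightarrow> p \<in> cdom c \<Longrightarrow> transition c c' (cmap c p) = cmap c' p"
  by (simp add: transition_def cinv_cmap)

lemma open_image: "c \<in> A \<Longrightarrow> open (cmap c ` cdom c)"
  using open_overlap[of c c] by simp

lemma in_overlap:
  "c \<in> A \<Longrightarrow> p \<in> cdom c \<Longrightarrow> cmap c p \<in> cmap c ` (cdom c \<inter> S) \<longleftrightarrow> p \<in> S"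
  using inj_onD[OF inj] by fastforce

lemma transition_has_derivative:
  assumes "c \<in> A" "c' \<in> A" "p \<in> cdom c" "p \<in> cdom c'"
  shows "(transition c c' has_derivative frechet_derivative (transition c c') (at (cmap c p))) (at (cmap c p))"
  by (rule smooth_on_has_derivative[OF smooth_transition]) (use assms in auto)

lemma transition_linear:
  assumes "c \<in> A" "c' \<in> A" "p \<in> cdom c" "p \<in> cdom c'"
  shows "linear (frechet_derivative (transition c c') (at (cmap c p)))"
  using transition_has_derivative[OF assms] has_derivative_linear by blast

text \<open>The chain rule in the form of a cocycle identity; it is what makes
  \<open>coord_tvec\<close> satisfy the compatibility condition in
  \<open>tangent_space\<close>.\<close>

lemma transition_derivative_compose:
  assumes c: "c \<in> A" "c' \<in> A" "c'' \<in> A" and p: "p \<in> cdom c" "p \<in> cdom c'" "p \<in> cdom c''"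
  shows "frechet_derivative (transition c c'') (at (cmap c p)) u
    = frechet_derivative (transition c' c'') (at (cmap c' p))
       (frechet_derivative (transition c c') (at (cmap c p)) u)"
proof -
  let ?V = "cmap c ` (cdom c \<inter> cdom c') \<inter> cmap c ` (cdom c \<inter> cdom c'')"
  have "((transition c' c'' \<circ> transition c c') has_derivative
      (frechet_derivative (transition c' c'') (at (cmap c' p)) \<circ>
       frechet_derivative (transition c c') (at (cmap c p)))) (at (cmap c p))"
    using diff_chain_at[OF transition_has_derivative[OF c(1,2) p(1,2)], of "transition c' c''"]
      transition_has_derivative[OF c(2,3) p(2,3)]
    by (simp add: transition_cmap[OF c(1) p(1)])
  from frechet_derivativeI[OF this]
  have "frechet_derivative (transition c' c'' \<circ> transition c c') (at (cmap c p)) u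
    = frechet_derivative (transition c' c'') (at (cmap c' p))
       (frechet_derivative (transition c c') (at (cmap c p)) u)" by simp
  moreover have "frechet_derivative (transition c c'') (at (cmap c p))
      = frechet_derivative (transition c' c'' \<circ> transition c c') (at (cmap c p))"
  proof (rule frechet_derivative_cong_open)
    show "open ?V" using open_overlap c by blast
    show "cmap c p \<in> ?V" using p by blast
    fix y assume "y \<in> ?V"
    then obtain q where "q \<in> cdom c" "q \<in> cdom c'" "y = cmap c q" by auto
    then show "transition c c'' y = (transition c' c'' \<circ> transition c c') y"
      using c by (simp add: transition_cmap)
  qed
  ultimately show ?thesis by simp
qed

lemma transition_derivative_self:
  assumes "c \<in> A" "p \<in> cdom c"
  shows "frechet_derivative (transition c c) (at (cmap c p)) u = u"
proof -
  have "frechet_derivative (transition c c) (at (cmap c p)) = frechet_derivative (\<lambda>y. y) (at (cmap c p))"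
    by (rule frechet_derivative_cong_open[OF open_image[OF assms(1)]])
      (use assms in \<open>auto simp: transition_cmap\<close>)
  then show ?thesis by simp
qed

lemma transition_derivative_inverse:
  assumes "c \<in> A" "c' \<in> A" "p \<in> cdom c" "p \<in> cdom c'"
  shows "frechet_derivative (transition c' c) (at (cmap c' p))
       (frechet_derivative (transition c c') (at (cmap c p)) u) = u"
  using transition_derivative_compose[of c c' c p u] transition_derivative_self assms by simp

lemma coord_tvec_apply:
  "c' \<in> A \<Longrightarrow> p \<in> cdom c' \<Longrightarrow>
    coord_tvec A c p u c' = frechet_derivative (transition c c') (at (cmap c p)) u"
  by (simp add: coord_tvec_def)

lemma coord_tvec_self: "c \<in> A \<Longrightarrow> p \<in> cdom c \<Longrightarrow> coord_tvec A c p u c = u"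
  by (simp add: coord_tvec_apply transition_derivative_self)

lemma coord_tvec_tangent:
  assumes "c \<in> A" "p \<in> cdom c" shows "coord_tvec A c p u \<in> tangent_space A p"
proof -
  have "coord_tvec A c p u c'' = frechet_derivative (transition c' c'') (at (cmap c' p)) (coord_tvec A c p u c')"
    if "c' \<in> A" "c'' \<in> A" "p \<in> cdom c'" "p \<in> cdom c''" for c' c''
    unfolding coord_tvec_apply[OF that(1,3)] coord_tvec_apply[OF that(2,4)]
    by (rule transition_derivative_compose[OF assms(1) that(1,2) assms(2) that(3,4)])
  moreover have "coord_tvec A c p u c' = 0" if "\<not> (c' \<in> A \<and> p \<in> cdom c')" for c'
    using that by (simp only: coord_tvec_def if_False)
  ultimately show ?thesis unfolding tangent_space_def by blast
qed

lemma tangent_transition: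
  assumes "X \<in> tangent_space A p" "c \<in> A" "c' \<in> A" "p \<in> cdom c" "p \<in> cdom c'"
  shows "X c' = frechet_derivative (transition c c') (at (cmap c p)) (X c)"
  using assms unfolding tangent_space_def by blast

lemma tangent_outside:
  assumes "X \<in> tangent_space A p" "\<not> (c \<in> A \<and> p \<in> cdom c)" shows "X c = 0"
  using assms unfolding tangent_space_def by blast

lemma tangent_eq_coord_tvec:
  assumes "c \<in> A" "p \<in> cdom c" "X \<in> tangent_space A p" shows "X = coord_tvec A c p (X c)"
proof (rule ext)
  fix c'
  show "X c' = coord_tvec A c p (X c) c'"
  proof (cases "c' \<in> A \<and> p \<in> cdom c'")
    case True
    then show ?thesis using tangent_transition[OF assms(3,1) _ assms(2)] by (simp only: coord_tvec_apply)
  next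
    case False
    then show ?thesis using tangent_outside[OF assms(3) False] by (simp only: coord_tvec_def if_False)
  qed
qed

lemma tangent_eqI:
  assumes "c \<in> A" "p \<in> cdom c" "X \<in> tangent_space A p" "Y \<in> tangent_space A p" "X c = Y c"
  shows "X = Y"
  by (metis assms tangent_eq_coord_tvec)

lemma lincomb_tangent:
  assumes "X \<in> tangent_space A p" "Y \<in> tangent_space A p"
  shows "lincomb a X b Y \<in> tangent_space A p"
proof -
  have "lincomb a X b Y c' = frechet_derivative (transition c c') (at (cmap c p)) (lincomb a X b Y c)"
    if "c \<in> A" "c' \<in> A" "p \<in> cdom c" "p \<in> cdom c'" for c c'
    using tangent_transition[OF assms(1) that] tangent_transition[OF assms(2) that] transition_linear[OF that]
    by (simp add: lincomb_def linear_add linear_scale)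
  moreover have "lincomb a X b Y c = 0" if "\<not> (c \<in> A \<and> p \<in> cdom c)" for c
    using tangent_outside[OF assms(1) that] tangent_outside[OF assms(2) that] by (simp add: lincomb_def)
  ultimately show ?thesis unfolding tangent_space_def by blast
qed

lemma lincomb_coord_tvec:
  assumes "c \<in> A" "p \<in> cdom c"
  shows "lincomb a (coord_tvec A c p u) b (coord_tvec A c p v) = coord_tvec A c p (a *\<^sub>R u + b *\<^sub>R v)"
proof (rule tangent_eqI[OF assms])
  show "lincomb a (coord_tvec A c p u) b (coord_tvec A c p v) c = coord_tvec A c p (a *\<^sub>R u + b *\<^sub>R v) c"
    using assms by (simp add: lincomb_def coord_tvec_self)
qed (intro lincomb_tangent coord_tvec_tangent assms)+

subsection \<open>Curves\<close>

text \<open>With no topology on the carrier, openness has to come from the coordinates in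
  \<open>c\<close>: by injectivity of the chart the set is the preimage of the open image of the
  overlap.\<close>

lemma open_curve_overlap:
  assumes "c \<in> A" "c' \<in> A" "open I" "\<gamma> ` I \<subseteq> cdom c" "continuous_on I (cmap c \<circ> \<gamma>)"
  shows "open {t\<in>I. \<gamma> t \<in> cdom c'}"
proof -
  have "{t\<in>I. \<gamma> t \<in> cdom c'} = {t\<in>I. (cmap c \<circ> \<gamma>) t \<in> cmap c ` (cdom c \<inter> cdom c')}"
  proof -
    have "\<gamma> t \<in> cdom c' \<longleftrightarrow> (cmap c \<circ> \<gamma>) t \<in> cmap c ` (cdom c \<inter> cdom c')" if "t \<in> I" for t
      using in_overlap[OF assms(1), of "\<gamma> t"] assms(4) that by (simp add: image_subset_iff)
    then show ?thesis by blast
  qed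
  then show ?thesis using open_preimage_on[OF assms(3,5) open_overlap[OF assms(1,2)]] by simp
qed

lemma smooth_curve_single_chart:
  assumes "c \<in> A" "open I" "\<gamma> ` I \<subseteq> cdom c" "smooth_on I (cmap c \<circ> \<gamma>)"
  shows "smooth_curve A I \<gamma>"
  unfolding smooth_curve_def
proof (intro conjI ballI)
  show "\<gamma> ` I \<subseteq> carrier_of A" using assms(1,3) unfolding carrier_of_def by blast
  fix c' assume c': "c' \<in> A"
  let ?I = "{t\<in>I. \<gamma> t \<in> cdom c'}"
  show op: "open ?I"
    by (rule open_curve_overlap[OF assms(1) c' assms(2,3) smooth_on_continuous[OF assms(4)]])
  have sm: "smooth_on ?I (\<lambda>t. transition c c' ((cmap c \<circ> \<gamma>) t))"
    by (rule smooth_on_compose[OF smooth_transition[OF assms(1) c'] smooth_on_subset[OF assms(4)] op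
          open_overlap[OF assms(1) c']]) (use assms(3) in auto)
  have eq: "transition c c' ((cmap c \<circ> \<gamma>) t) = (cmap c' \<circ> \<gamma>) t" if "t \<in> ?I" for t
    using that assms(1,3) transition_cmap by (auto simp: image_subset_iff)
  show "smooth_on ?I (cmap c' \<circ> \<gamma>)"
    by (rule iffD1[OF smooth_on_cong[OF op eq] sm])
qed

text \<open>\<open>velocity\<close> is defined separately in each chart; the chain rule through the
  transition maps ties these values together, so that one chart determines them all.\<close>

lemma velocity_eq_coord_tvec:
  assumes "c \<in> A" "open I" "\<gamma> ` I \<subseteq> cdom c" "smooth_on I (cmap c \<circ> \<gamma>)" "t \<in> I"
  shows "velocity A \<gamma> t = coord_tvec A c (\<gamma> t) (vector_derivative (cmap c \<circ> \<gamma>) (at t))"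
proof (rule ext)
  fix c'
  show "velocity A \<gamma> t c' = coord_tvec A c (\<gamma> t) (vector_derivative (cmap c \<circ> \<gamma>) (at t)) c'"
  proof (cases "c' \<in> A \<and> \<gamma> t \<in> cdom c'")
    case True
    let ?I = "{t\<in>I. \<gamma> t \<in> cdom c'}"
    have op: "open ?I" using True assms
      by (intro open_curve_overlap[OF assms(1) _ assms(2,3) smooth_on_continuous[OF assms(4)]]) auto
    have pc: "\<gamma> t \<in> cdom c" using assms by auto
    have d: "((cmap c \<circ> \<gamma>) has_vector_derivative vector_derivative (cmap c \<circ> \<gamma>) (at t)) (at t)"
      using smooth_on_differentiable[OF assms(4,5)] vector_derivative_works by blast
    have "((transition c c' \<circ> (cmap c \<circ> \<gamma>)) has_vector_derivative
       frechet_derivative (transition c c') (at (cmap c (\<gamma> t))) (vector_derivative (cmap c \<circ> \<gamma>) (at t))) (at t)"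
      by (rule vector_derivative_diff_chain_within[OF d has_derivative_at_withinI])
        (use transition_has_derivative[OF assms(1) _ pc] True in auto)
    then have "((cmap c' \<circ> \<gamma>) has_vector_derivative
       frechet_derivative (transition c c') (at (cmap c (\<gamma> t))) (vector_derivative (cmap c \<circ> \<gamma>) (at t))) (at t)"
      by (rule has_vector_derivative_transform_within_open[OF _ op])
        (use True assms(1,3,5) transition_cmap in \<open>auto simp: image_subset_iff\<close>)
    then show ?thesis using True by (simp add: velocity_def coord_tvec_def vector_derivative_at)
  qed (auto simp: velocity_def coord_tvec_def)
qed

lemma smooth_curve_chartE:
  assumes "smooth_curve A J \<gamma>" "c \<in> A" "t \<in> J" "\<gamma> t \<in> cdom c"
  obtains e where "e > 0" "{t-e<..<t+e} \<subseteq> J" "\<gamma> ` {t-e<..<t+e} \<subseteq> cdom c"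
    "smooth_on {t-e<..<t+e} (cmap c \<circ> \<gamma>)"
proof -
  have "open {t\<in>J. \<gamma> t \<in> cdom c}" and sm: "smooth_on {t\<in>J. \<gamma> t \<in> cdom c} (cmap c \<circ> \<gamma>)"
    using assms unfolding smooth_curve_def by auto
  then obtain e where "e > 0" "ball t e \<subseteq> {t\<in>J. \<gamma> t \<in> cdom c}"
    using assms(3,4) by (elim openE[of _ t]) auto
  moreover have "ball t e = {t-e<..<t+e}" by (auto simp: dist_real_def)
  ultimately have sub: "{t-e<..<t+e} \<subseteq> {t\<in>J. \<gamma> t \<in> cdom c}" by simp
  show ?thesis by (rule that[OF \<open>e > 0\<close> _ _ smooth_on_subset[OF sm sub]]) (use sub in auto)
qed

text \<open>Supplies the curve that the definition of \<open>horizontal\<close> asks for when a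
  vector is given only by its coordinates.\<close>

lemma coordinate_line:
  fixes w :: 'e
  assumes c: "c \<in> A" "p \<in> cdom c"
  defines "\<sigma> \<equiv> \<lambda>t. cinv c (cmap c p + t *\<^sub>R w)"
  obtains e where "e > 0" "\<And>t. t \<in> {-e<..<e} \<Longrightarrow> \<sigma> t \<in> cdom c \<and> cmap c (\<sigma> t) = cmap c p + t *\<^sub>R w"
    "smooth_curve A {-e<..<e} \<sigma>" "\<sigma> 0 = p" "velocity A \<sigma> 0 = coord_tvec A c p w"
proof -
  have "open {t\<in>UNIV. cmap c p + t *\<^sub>R w \<in> cmap c ` cdom c}"
    by (rule open_preimage_on) (auto intro!: continuous_intros open_image c)
  then obtain e where e: "e > 0" "ball 0 e \<subseteq> {t. cmap c p + t *\<^sub>R w \<in> cmap c ` cdom c}"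
    using c by (elim openE[of _ 0]) auto
  have im: "cmap c p + t *\<^sub>R w \<in> cmap c ` cdom c" if "t \<in> {-e<..<e}" for t
    using that e by (auto simp: subset_eq dist_real_def)
  have sig: "\<sigma> t \<in> cdom c \<and> cmap c (\<sigma> t) = cmap c p + t *\<^sub>R w" if "t \<in> {-e<..<e}" for t
    unfolding \<sigma>_def using cinv_in[OF im[OF that]] .
  have lin: "smooth_on {-e<..<e} (\<lambda>t. cmap c p + t *\<^sub>R w)"
    by (intro smooth_on_add smooth_on_const smooth_on_scaleR smooth_on_ident) auto
  have eq: "cmap c p + t *\<^sub>R w = (cmap c \<circ> \<sigma>) t" if "t \<in> {-e<..<e}" for t
    using sig[OF that] by simp
  have sm: "smooth_on {-e<..<e} (cmap c \<circ> \<sigma>)"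
    by (rule iffD1[OF smooth_on_cong[OF _ eq] lin]) auto
  have p: "\<sigma> 0 = p" unfolding \<sigma>_def using cinv_cmap[OF c] by simp
  have "((\<lambda>t. cmap c p + t *\<^sub>R w) has_vector_derivative w) (at 0)"
    by (auto intro!: derivative_eq_intros)
  then have "((cmap c \<circ> \<sigma>) has_vector_derivative w) (at 0)"
    by (rule has_vector_derivative_transform_within_open[where S = "{-e<..<e}"]) (use e(1) eq in auto)
  moreover have sub: "\<sigma> ` {-e<..<e} \<subseteq> cdom c" using sig by auto
  ultimately have "velocity A \<sigma> 0 = coord_tvec A c p w"
    using velocity_eq_coord_tvec[OF c(1) _ _ sm, of 0] e(1) p vector_derivative_at by fastforce
  then show ?thesis
    using that[OF e(1) sig smooth_curve_single_chart[OF c(1) _ sub sm] p] by simp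
qed

subsection \<open>Riemannian metrics in coordinates\<close>

lemma metric_eq_rep:
  assumes "c \<in> A" "p \<in> cdom c" "X \<in> tangent_space A p" "Y \<in> tangent_space A p"
  shows "g p X Y = metric_rep A g c (cmap c p) (X c) (Y c)"
  unfolding metric_rep_def using assms tangent_eq_coord_tvec by (simp add: cinv_cmap)

lemma metric_rep_properties:
  assumes "riemannian_metric_on A W g" "c \<in> A" "y \<in> cmap c ` (cdom c \<inter> W)"
  shows "metric_rep A g c y u v = metric_rep A g c y v u"
    and "metric_rep A g c y (a *\<^sub>R u + b *\<^sub>R v) w = a * metric_rep A g c y u w + b * metric_rep A g c y v w"
    and "u \<noteq> 0 \<Longrightarrow> metric_rep A g c y u u > 0"
proof -
  obtain p where p: "p \<in> cdom c" "p \<in> W" "y = cmap c p" using assms(3) by blast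
  have X: "coord_tvec A c p u \<in> tangent_space A p" for u
    using coord_tvec_tangent[OF assms(2) p(1)] .
  have m: "metric_rep A g c y u v = g p (coord_tvec A c p u) (coord_tvec A c p v)" for u v
    using p cinv_cmap[OF assms(2)] by (simp add: metric_rep_def)
  have r: "g p X Y = g p Y X \<and>
        (\<forall>Z\<in>tangent_space A p. \<forall>a b. g p (lincomb a X b Y) Z = a * g p X Z + b * g p Y Z) \<and>
        (X \<noteq> (\<lambda>_. 0) \<longrightarrow> g p X X > 0)" if "X \<in> tangent_space A p" "Y \<in> tangent_space A p" for X Y
    using assms(1) p(2) that unfolding riemannian_metric_on_def by blast
  show "metric_rep A g c y u v = metric_rep A g c y v u"
    unfolding m using r X by blast
  show "metric_rep A g c y (a *\<^sub>R u + b *\<^sub>R v) w = a * metric_rep A g c y u w + b * metric_rep A g c y v w"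
    unfolding m using r X by (simp flip: lincomb_coord_tvec[OF assms(2) p(1)])
  assume "u \<noteq> 0"
  then have "coord_tvec A c p u \<noteq> (\<lambda>_. 0)" using coord_tvec_self[OF assms(2) p(1)] by metis
  then show "metric_rep A g c y u u > 0" unfolding m using r X by blast
qed

end

text \<open>The second claim is meant for open sets that are not chart domains; applied to the
  complement of the zero set it turns closedness into openness in coordinates.\<close>

lemma smooth_manifold_atlas:
  assumes "smooth_manifold T A" shows "smooth_atlas A"
    and "c \<in> A \<Longrightarrow> openin T V \<Longrightarrow> open (cmap c ` (cdom c \<inter> V))"
proof -
  have img: "open (cmap c ` (cdom c \<inter> V))" and inj: "inj_on (cmap c) (cdom c)"
    if "is_chart T c" "openin T V" for c V
  proof -
    have h: "homeomorphic_map (subtopology T (cdom c)) (top_of_set (cmap c ` cdom c)) (cmap c)"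
      and o: "openin T (cdom c)" "open (cmap c ` cdom c)"
      using that(1) unfolding is_chart_def by auto
    then have ts: "topspace (subtopology T (cdom c)) = cdom c"
      by (intro topspace_subtopology_subset openin_subset)
    have "openin (subtopology T (cdom c)) (cdom c \<inter> V)"
      using that(2) by (metis Int_commute openin_subtopology)
    then have "openin (top_of_set (cmap c ` cdom c)) (cmap c ` (cdom c \<inter> V))"
      using homeomorphic_map_openness_eq[OF h] by (metis)
    then show "open (cmap c ` (cdom c \<inter> V))" using o(2) openin_open_trans by blast
    show "inj_on (cmap c) (cdom c)" using homeomorphic_imp_injective_map[OF h] ts by simp
  qed
  have ch: "is_chart T c" if "c \<in> A" for c using assms that unfolding smooth_manifold_def by blast
  then have op: "openin T (cdom c)" if "c \<in> A" for c using that unfolding is_chart_def by blast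
  show "smooth_atlas A"
  proof
    show "inj_on (cmap c) (cdom c)" if "c \<in> A" for c using inj[OF ch[OF that] op[OF that]] .
    show "open (cmap c ` (cdom c \<inter> cdom c'))" if "c \<in> A" "c' \<in> A" for c c'
      using img[OF ch[OF that(1)] op[OF that(2)]] .
    show "smooth_on (cmap c ` (cdom c \<inter> cdom c')) (transition c c')" if "c \<in> A" "c' \<in> A" for c c'
      using assms that unfolding smooth_manifold_def compatible_def by blast
  qed
  show "c \<in> A \<Longrightarrow> openin T V \<Longrightarrow> open (cmap c ` (cdom c \<inter> V))" using img ch by blast
qed

text \<open>A slice chart belongs to the maximal atlas and perhaps not to \<open>A\<close>. After
  adding it, the change to slice coordinates is an ordinary transition map to which the lemmas on
  \<open>smooth_atlas\<close> apply.\<close>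

lemma insert_compatible_chart:
  assumes "smooth_manifold T A" "is_chart T c" "\<forall>c'\<in>A. compatible c c'"
  shows "smooth_manifold T (insert c A)"
proof -
  have "cdom c \<subseteq> topspace T" using assms(2) openin_subset unfolding is_chart_def by blast
  moreover have "compatible c c"
  proof -
    have "inj_on (cmap c) (cdom c)" and op: "open (cmap c ` cdom c)"
      using smooth_manifold_atlas(1)[of T "{c}"] assms(2) homeomorphic_imp_injective_map
        openin_subset topspace_subtopology_subset unfolding is_chart_def by metis+
    then have eq: "y = transition c c y" if "y \<in> cmap c ` cdom c" for y
      using that by (auto simp: transition_def cinv_def)
    show ?thesis
      using iffD1[OF smooth_on_cong[OF op eq] smooth_on_ident[OF op]] by (simp add: compatible_def)
  qed
  moreover have "compatible c' c" if "compatible c c'" for c'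
    using that unfolding compatible_def by (auto simp: Int_commute)
  ultimately show ?thesis
    using assms unfolding smooth_manifold_def carrier_of_def by (auto simp: insert_absorb)
qed

section \<open>Riemannian metrics on open subsets of a Euclidean space\<close>

lemma derivative_on_line:
  fixes f :: "'a::euclidean_space \<Rightarrow> 'b::real_normed_vector"
  assumes "f differentiable (at y)"
  shows "((\<lambda>t::real. f (y + t *\<^sub>R u)) has_vector_derivative frechet_derivative f (at y) u) (at 0)"
proof -
  have "((\<lambda>t::real. y + t *\<^sub>R u) has_vector_derivative u) (at 0)"
    by (auto intro!: derivative_eq_intros)
  from vector_derivative_diff_chain_within[OF this, of f "frechet_derivative f (at y)"]
  show ?thesis using assms by (simp add: frechet_derivative_works has_derivative_at_withinI comp_def)
qed

lemma derivative_along_curve: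
  fixes f :: "'a::euclidean_space \<Rightarrow> 'b::real_normed_vector"
  assumes "f differentiable (at (y t))" "(y has_vector_derivative y') (at t)"
  shows "((\<lambda>t. f (y t)) has_vector_derivative frechet_derivative f (at (y t)) y') (at t)"
proof -
  from vector_derivative_diff_chain_within[OF assms(2), of f "frechet_derivative f (at (y t))"]
  show ?thesis using assms(1) by (simp add: frechet_derivative_works has_derivative_at_withinI comp_def)
qed

lemma has_vector_derivative_eventually_in:
  assumes "(y has_vector_derivative y') (at t)" "open U" "y t \<in> U"
  shows "\<forall>\<^sub>F s in at t. y s \<in> U"
proof -
  have "(y \<longlongrightarrow> y t) (at t)"
    using has_vector_derivative_continuous[OF assms(1)] by (simp add: continuous_at)
  then show ?thesis using assms(2,3) topological_tendstoD by blast
qed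

lemma has_vector_derivative_transform_eventually_at:
  assumes "(f has_vector_derivative f') (at t)" "\<forall>\<^sub>F s in at t. f s = g s" "f t = g t"
  shows "(g has_vector_derivative f') (at t)"
  using assms unfolding has_vector_derivative_def
  by (auto intro: has_derivative_transform_eventually)

text \<open>Half the right-hand side of the Koszul formula for coordinate vector fields, whose
  brackets vanish: the Christoffel symbols with lowered index.\<close>

definition koszul ::
    "('e::euclidean_space \<Rightarrow> 'e \<Rightarrow> 'e \<Rightarrow> real) \<Rightarrow> 'e \<Rightarrow> 'e \<Rightarrow> 'e \<Rightarrow> 'e \<Rightarrow> real" where
  "koszul G y u v z = (frechet_derivative (\<lambda>y'. G y' v z) (at y) u +
      frechet_derivative (\<lambda>y'. G y' u z) (at y) v -
      frechet_derivative (\<lambda>y'. G y' u v) (at y) z) / 2"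

text \<open>\<open>christoffel\<close> stripped of the atlas: the same lemmas then serve the metric
  of the surface and the lifted metric, which is a metric only off the zero set.\<close>

definition christoffel_of ::
    "('e::euclidean_space \<Rightarrow> 'e \<Rightarrow> 'e \<Rightarrow> real) \<Rightarrow> 'e \<Rightarrow> 'e \<Rightarrow> 'e \<Rightarrow> 'e" where
  "christoffel_of G y u v = (THE w. \<forall>z. G y w z = koszul G y u v z)"

lemma christoffel_eq: "christoffel A g c = christoffel_of (metric_rep A g c)"
  unfolding christoffel_def christoffel_of_def koszul_def ..

locale local_metric =
  fixes U :: "'e::euclidean_space set" and G :: "'e \<Rightarrow> 'e \<Rightarrow> 'e \<Rightarrow> real"
  assumes open_domain: "open U"
    and sym: "y \<in> U \<Longrightarrow> G y u v = G y v u"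
    and lin: "y \<in> U \<Longrightarrow> G y (a *\<^sub>R u + b *\<^sub>R v) w = a * G y u w + b * G y v w"
    and pos: "y \<in> U \<Longrightarrow> u \<noteq> 0 \<Longrightarrow> G y u u > 0"
    and smooth: "smooth_on U (\<lambda>y. G y u v)"
begin

lemma linear_left: "y \<in> U \<Longrightarrow> linear (\<lambda>u. G y u v)"
  using lin[of y 1 _ 1] lin[of y _ _ 0] by (intro linearI) auto

lemma linear_right: "y \<in> U \<Longrightarrow> linear (\<lambda>v. G y u v)"
  using linear_left[of y u] by (simp add: sym[of y u])

lemmas simps_left = linear_add[OF linear_left] linear_scale[OF linear_left]
  linear_neg[OF linear_left] linear_diff[OF linear_left] linear_0[OF linear_left]
lemmas simps_right = linear_add[OF linear_right] linear_scale[OF linear_right]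
  linear_neg[OF linear_right] linear_diff[OF linear_right] linear_0[OF linear_right]

text \<open>Smoothness of \<open>G\<close> is assumed only for fixed arguments. This expansion lets
  the arguments vary with a parameter, in \<open>smooth_along\<close> and
  \<open>derivative_along\<close>.\<close>

lemma expand:
  assumes "y \<in> U"
  shows "G y u v = (\<Sum>a\<in>Basis. \<Sum>b\<in>Basis. (u \<bullet> a) * ((v \<bullet> b) * G y a b))"
proof -
  have "G y u v = (\<Sum>a\<in>Basis. (u \<bullet> a) *\<^sub>R G y a v)"
    by (rule linear_expand[OF linear_left[OF assms]])
  also have "\<dots> = (\<Sum>a\<in>Basis. (u \<bullet> a) *\<^sub>R (\<Sum>b\<in>Basis. (v \<bullet> b) *\<^sub>R G y a b))"
    by (intro sum.cong arg_cong2[where f = scaleR] refl linear_expand[OF linear_right[OF assms]])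
  finally show ?thesis by (simp add: sum_distrib_left)
qed

lemma smooth_along:
  assumes "open X" "smooth_on X y" "smooth_on X u" "smooth_on X v" "y ` X \<subseteq> U"
  shows "smooth_on X (\<lambda>x::'b::euclidean_space. G (y x) (u x) (v x))"
proof -
  have sm: "smooth_on X (\<lambda>x. \<Sum>a\<in>Basis. \<Sum>b\<in>Basis. (u x \<bullet> a) * ((v x \<bullet> b) * G (y x) a b))"
    by (intro smooth_on_sum smooth_on_mult smooth_on_inner smooth_on_const assms
        smooth_on_compose[OF smooth assms(2,1) open_domain assms(5)])
  have eq: "G (y x) (u x) (v x) = (\<Sum>a\<in>Basis. \<Sum>b\<in>Basis. (u x \<bullet> a) * ((v x \<bullet> b) * G (y x) a b))"
    if "x \<in> X" for x
    by (rule expand) (use that assms(5) in auto)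
  show ?thesis by (rule iffD2[OF smooth_on_cong[OF assms(1) eq] sm])
qed

abbreviation dG :: "'e \<Rightarrow> 'e \<Rightarrow> 'e \<Rightarrow> 'e \<Rightarrow> real" where
  "dG y w u v \<equiv> frechet_derivative (\<lambda>y'. G y' u v) (at y) w"

lemma dG_linear: "y \<in> U \<Longrightarrow> linear (\<lambda>w. dG y w u v)"
  using smooth_on_linear_derivative[OF smooth] by blast

lemma dG_sym: "y \<in> U \<Longrightarrow> dG y w u v = dG y w v u"
  by (rule fun_cong[OF frechet_derivative_cong_open[OF open_domain]]) (auto simp: sym)

lemma dG_linear_left:
  assumes y: "y \<in> U" shows "linear (\<lambda>u. dG y w u v)"
proof -
  have "dG y w (a *\<^sub>R u + b *\<^sub>R u') v = a * dG y w u v + b * dG y w u' v" for a b u u'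
  proof -
    have "frechet_derivative (\<lambda>y'. G y' (a *\<^sub>R u + b *\<^sub>R u') v) (at y)
        = frechet_derivative (\<lambda>y'. a * G y' u v + b * G y' u' v) (at y)"
      by (rule frechet_derivative_cong_open[OF open_domain y]) (rule lin)
    also have "\<dots> = (\<lambda>w. a * dG y w u v + b * dG y w u' v)"
      by (intro frechet_derivativeI has_derivative_add has_derivative_mult_right
          smooth_on_has_derivative[OF smooth y])
    finally show ?thesis by simp
  qed
  from this[of 1 _ 1] this[of _ _ 0] show ?thesis by (intro linearI) auto
qed

lemma dG_linear_right: "y \<in> U \<Longrightarrow> linear (\<lambda>v. dG y w u v)"
  using dG_linear_left[where y = y and w = w and v = u] by (simp add: dG_sym[where u = u])

lemma dG_expand:
  assumes "y \<in> U"
  shows "dG y w u v =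
    (\<Sum>c\<in>Basis. \<Sum>a\<in>Basis. \<Sum>b\<in>Basis. (w \<bullet> c) * ((u \<bullet> a) * ((v \<bullet> b) * dG y c a b)))"
proof -
  have "dG y w u v = (\<Sum>c\<in>Basis. (w \<bullet> c) *\<^sub>R dG y c u v)"
    by (rule linear_expand[OF dG_linear[OF assms]])
  also have "\<dots> = (\<Sum>c\<in>Basis. (w \<bullet> c) *\<^sub>R (\<Sum>a\<in>Basis. (u \<bullet> a) *\<^sub>R dG y c a v))"
    by (intro sum.cong arg_cong2[where f = scaleR] refl linear_expand[OF dG_linear_left[OF assms]])
  also have "\<dots> = (\<Sum>c\<in>Basis. (w \<bullet> c) *\<^sub>R (\<Sum>a\<in>Basis. (u \<bullet> a) *\<^sub>R (\<Sum>b\<in>Basis. (v \<bullet> b) *\<^sub>R dG y c a b)))"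
    by (intro sum.cong arg_cong2[where f = scaleR] refl linear_expand[OF dG_linear_right[OF assms]])
  finally show ?thesis by (simp add: sum_distrib_left)
qed

lemma dG_smooth_along:
  assumes "open X" "smooth_on X y" "smooth_on X w" "smooth_on X u" "smooth_on X v" "y ` X \<subseteq> U"
  shows "smooth_on X (\<lambda>x::'b::euclidean_space. dG (y x) (w x) (u x) (v x))"
proof -
  have sm: "smooth_on X (\<lambda>x. \<Sum>c\<in>Basis. \<Sum>a\<in>Basis. \<Sum>b\<in>Basis.
      (w x \<bullet> c) * ((u x \<bullet> a) * ((v x \<bullet> b) * dG (y x) c a b)))"
    by (intro smooth_on_sum smooth_on_mult smooth_on_inner smooth_on_const assms
        smooth_on_compose[OF smooth_on_derivative[OF smooth] assms(2,1) open_domain assms(6)])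
  have eq: "dG (y x) (w x) (u x) (v x) = (\<Sum>c\<in>Basis. \<Sum>a\<in>Basis. \<Sum>b\<in>Basis.
      (w x \<bullet> c) * ((u x \<bullet> a) * ((v x \<bullet> b) * dG (y x) c a b)))"
    if "x \<in> X" for x
    by (rule dG_expand) (use that assms(6) in auto)
  show ?thesis by (rule iffD2[OF smooth_on_cong[OF assms(1) eq] sm])
qed

lemma koszul_smooth_along:
  assumes "open X" "smooth_on X y" "smooth_on X u" "smooth_on X v" "smooth_on X z" "y ` X \<subseteq> U"
  shows "smooth_on X (\<lambda>x::'b::euclidean_space. koszul G (y x) (u x) (v x) (z x))"
  unfolding koszul_def
  by (intro smooth_on_divide smooth_on_diff smooth_on_add dG_smooth_along smooth_on_const assms) simp

text \<open>The product rule, applied after expansion in the basis. It serves the transformation law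
  of the Christoffel symbols, the skewness of the connection and the first integral.\<close>

lemma derivative_along:
  assumes y: "(y has_vector_derivative y') (at t)" and V: "(V has_vector_derivative V') (at t)"
    and Z: "(Z has_vector_derivative Z') (at t)" and U: "y t \<in> U"
  shows "((\<lambda>s. G (y s) (V s) (Z s)) has_vector_derivative
     dG (y t) y' (V t) (Z t) + G (y t) V' (Z t) + G (y t) (V t) Z') (at t)"
proof -
  have ip: "((\<lambda>s. f s \<bullet> b) has_vector_derivative f' \<bullet> b) (at t)"
    if "(f has_vector_derivative f') (at t)" for f :: "real \<Rightarrow> 'e" and f' b
    by (rule bounded_linear.has_vector_derivative[OF bounded_linear_inner_left that])
  have der: "((\<lambda>s. \<Sum>a\<in>Basis. \<Sum>b\<in>Basis. (V s \<bullet> a) * ((Z s \<bullet> b) * G (y s) a b)) has_vector_derivative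
    (\<Sum>a\<in>Basis. \<Sum>b\<in>Basis. (V t \<bullet> a) * ((Z t \<bullet> b) * dG (y t) y' a b + (Z' \<bullet> b) * G (y t) a b)
      + (V' \<bullet> a) * ((Z t \<bullet> b) * G (y t) a b))) (at t)"
    by (intro has_vector_derivative_sum has_vector_derivative_mult ip V Z
        derivative_along_curve y smooth_on_differentiable[OF smooth U])
  have ev: "\<forall>\<^sub>F s in at t. (\<Sum>a\<in>Basis. \<Sum>b\<in>Basis. (V s \<bullet> a) * ((Z s \<bullet> b) * G (y s) a b)) = G (y s) (V s) (Z s)"
    using has_vector_derivative_eventually_in[OF y open_domain U]
    by (rule eventually_mono) (rule expand[symmetric])
  have eq: "(\<Sum>a\<in>Basis. \<Sum>b\<in>Basis. (V t \<bullet> a) * ((Z t \<bullet> b) * dG (y t) y' a b + (Z' \<bullet> b) * G (y t) a b)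
      + (V' \<bullet> a) * ((Z t \<bullet> b) * G (y t) a b))
    = dG (y t) y' (V t) (Z t) + G (y t) V' (Z t) + G (y t) (V t) Z'"
  proof -
    have e: "dG (y t) y' u v = (\<Sum>a\<in>Basis. \<Sum>b\<in>Basis. (u \<bullet> a) * ((v \<bullet> b) * dG (y t) y' a b))" for u v
    proof -
      have "dG (y t) y' u v = (\<Sum>a\<in>Basis. (u \<bullet> a) *\<^sub>R dG (y t) y' a v)"
        by (rule linear_expand[OF dG_linear_left[OF U]])
      also have "\<dots> = (\<Sum>a\<in>Basis. (u \<bullet> a) *\<^sub>R (\<Sum>b\<in>Basis. (v \<bullet> b) *\<^sub>R dG (y t) y' a b))"
        by (intro sum.cong arg_cong2[where f = scaleR] refl linear_expand[OF dG_linear_right[OF U]])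
      finally show ?thesis by (simp add: sum_distrib_left)
    qed
    show ?thesis
      unfolding expand[OF U, of V' "Z t"] expand[OF U, of "V t" Z'] e[of "V t" "Z t"]
        sum.distrib[symmetric]
      by (intro sum.cong refl) (simp add: algebra_simps)
  qed
  show ?thesis
    by (rule has_vector_derivative_transform_eventually_at[OF der[unfolded eq] ev expand[OF U, symmetric]])
qed

lemma cancel:
  assumes "y \<in> U" "\<And>z. G y w z = G y w' z" shows "w = w'"
proof (rule ccontr)
  assume "w \<noteq> w'"
  then have "G y (w - w') (w - w') > 0" using pos assms(1) by simp
  moreover have "G y (w - w') (w - w') = 0" using assms by (simp add: simps_left)
  ultimately show False by simp
qed

text \<open>Justifies the \<open>THE\<close> in \<open>christoffel_of\<close>: the map
  \<open>H\<close> that lists the values \<open>G y w b\<close> is linear and, as \<open>G\<close>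
  is positive, injective, hence surjective in finite dimension.\<close>

lemma riesz:
  assumes y: "y \<in> U" and f: "linear f" shows "\<exists>!w. \<forall>z. G y w z = f z"
proof -
  define H where "H w = (\<Sum>b\<in>Basis. G y w b *\<^sub>R b)" for w
  have Hb: "H w \<bullet> b = G y w b" if "b \<in> Basis" for w b
    unfolding H_def using that by (simp add: inner_sum_left inner_Basis if_distrib sum.delta cong: if_cong)
  have linH: "linear H"
    unfolding H_def by (intro linear_compose_sum ballI linear_compose_scale_right linearI)
      (simp_all add: simps_left y scaleR_add_left)
  have "inj H"
    unfolding linear_inj_iff_eq_0[OF linH]
  proof (intro allI impI)
    fix w assume "H w = 0"
    then have "G y w b = 0" if "b \<in> Basis" for b using Hb[OF that, of w] by simp
    then have "G y w z = 0" for z using linear_expand[OF linear_right[OF y], of w z] by simp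
    then show "w = 0" using pos[OF y, of w] by fastforce
  qed
  then have "surj H" using linear_injective_imp_surjective linH by blast
  then obtain w where w: "H w = (\<Sum>b\<in>Basis. f b *\<^sub>R b)" by (metis surjD)
  have "G y w b = f b" if "b \<in> Basis" for b
    using Hb[OF that, of w] that unfolding w
    by (simp add: inner_sum_left inner_Basis if_distrib sum.delta cong: if_cong)
  then have "G y w z = f z" for z
    using linear_expand[OF linear_right[OF y], of w z] linear_expand[OF f, of z] by simp
  then show ?thesis using cancel[OF y] by metis
qed

lemma koszul_linear:
  assumes y: "y \<in> U"
  shows "linear (\<lambda>u. koszul G y u v z)" "linear (\<lambda>v. koszul G y u v z)" "linear (\<lambda>z. koszul G y u v z)"
proof -
  note l = linear_add[OF dG_linear[OF y]] linear_scale[OF dG_linear[OF y]]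
    linear_add[OF dG_linear_left[OF y]] linear_scale[OF dG_linear_left[OF y]]
    linear_add[OF dG_linear_right[OF y]] linear_scale[OF dG_linear_right[OF y]]
  show "linear (\<lambda>u. koszul G y u v z)" "linear (\<lambda>v. koszul G y u v z)" "linear (\<lambda>z. koszul G y u v z)"
    unfolding koszul_def by (intro linearI; simp add: l field_simps)+
qed

abbreviation \<Gamma> :: "'e \<Rightarrow> 'e \<Rightarrow> 'e \<Rightarrow> 'e" where "\<Gamma> \<equiv> christoffel_of G"

lemma christoffel_koszul: "y \<in> U \<Longrightarrow> G y (\<Gamma> y u v) z = koszul G y u v z"
  using theI'[OF riesz[OF _ koszul_linear(3)], of y y u v] unfolding christoffel_of_def by blast

lemma christoffel_linear:
  assumes y: "y \<in> U" shows "linear (\<lambda>u. \<Gamma> y u v)" "linear (\<lambda>v. \<Gamma> y u v)"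
proof -
  note k = linear_add[OF koszul_linear(1)[OF y]] linear_scale[OF koszul_linear(1)[OF y]]
    linear_add[OF koszul_linear(2)[OF y]] linear_scale[OF koszul_linear(2)[OF y]]
  show "linear (\<lambda>u. \<Gamma> y u v)" "linear (\<lambda>v. \<Gamma> y u v)"
    by (intro linearI cancel[OF y]; simp add: simps_left[OF y] christoffel_koszul[OF y] k)+
qed

text \<open>Metric compatibility of the Levi-Civita connection: in the sum of the two Koszul
  expressions with \<open>v\<close> and \<open>z\<close> exchanged, the derivatives in directions
  \<open>v\<close> and \<open>z\<close> cancel.\<close>

lemma christoffel_compatible:
  assumes y: "y \<in> U" shows "G y (\<Gamma> y u v) z + G y v (\<Gamma> y u z) = dG y u v z"
proof -
  have "G y (\<Gamma> y u v) z + G y v (\<Gamma> y u z) = koszul G y u v z + koszul G y u z v"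
    by (simp only: sym[OF y, of v "\<Gamma> y u z"] christoffel_koszul[OF y])
  also have "\<dots> = dG y u v z"
    unfolding koszul_def dG_sym[OF y, of z v u] by (simp add: field_simps)
  finally show ?thesis .
qed

end

lemma (in smooth_atlas) local_metric_rep:
  assumes "riemannian_metric_on A W g" "c \<in> A" "open (cmap c ` (cdom c \<inter> W))"
  shows "local_metric (cmap c ` (cdom c \<inter> W)) (metric_rep A g c)"
proof
  show "smooth_on (cmap c ` (cdom c \<inter> W)) (\<lambda>y. metric_rep A g c y u v)" for u v
    using assms(1,2) unfolding riemannian_metric_on_def by blast
qed (use metric_rep_properties[OF assms(1,2)] assms(3) in auto)

text \<open>The inhomogeneous transformation law of the Christoffel symbols. The second derivative of \<open>\<tau>\<close>
  contributes only one of three terms because it is symmetric.\<close>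

lemma christoffel_transform:
  fixes \<tau> :: "'e::euclidean_space \<Rightarrow> 'e"
  assumes "local_metric U G" "local_metric U' G'" and V: "open V" "V \<subseteq> U" "\<tau> ` V \<subseteq> U'" and sm: "smooth_on V \<tau>"
    and isom: "\<And>y u v. y \<in> V \<Longrightarrow> G y u v = G' (\<tau> y) (frechet_derivative \<tau> (at y) u) (frechet_derivative \<tau> (at y) v)"
    and y: "y \<in> V" and onto: "surj (frechet_derivative \<tau> (at y))"
  shows "frechet_derivative \<tau> (at y) (christoffel_of G y u v)
    = christoffel_of G' (\<tau> y) (frechet_derivative \<tau> (at y) u) (frechet_derivative \<tau> (at y) v)
      + frechet_derivative (\<lambda>y. frechet_derivative \<tau> (at y) v) (at y) u"
proof -
  interpret M: local_metric U G by fact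
  interpret M': local_metric U' G' by fact
  let ?D = "frechet_derivative \<tau> (at y)"
  define D2 where "D2 u v = frechet_derivative (\<lambda>y. frechet_derivative \<tau> (at y) v) (at y) u" for u v
  have yU: "y \<in> U" "\<tau> y \<in> U'" using V y by auto
  have D2: "D2 u v = D2 v u" for u v
    unfolding D2_def by (rule second_derivative_symmetric[OF sm V(1) y])
  \<comment> \<open>The isometry relation differentiated along the line through \<open>y\<close> in
    direction \<open>w\<close>; the terms with \<open>D2\<close> come from the change of the
    derivative of \<open>\<tau>\<close> along that line.\<close>
  have dG: "M.dG y w u v = M'.dG (\<tau> y) (?D w) (?D u) (?D v) + G' (\<tau> y) (D2 w u) (?D v) + G' (\<tau> y) (?D u) (D2 w v)"
    for w u v
  proof -
    let ?l = "\<lambda>t::real. y + t *\<^sub>R w"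
    have dl: "((\<lambda>t. frechet_derivative \<tau> (at (?l t)) u) has_vector_derivative D2 w u) (at 0)" for u
      unfolding D2_def
      by (rule derivative_on_line[OF smooth_on_differentiable[OF smooth_on_derivative[OF sm] y]])
    have "((\<lambda>t. G' (\<tau> (?l t)) (frechet_derivative \<tau> (at (?l t)) u) (frechet_derivative \<tau> (at (?l t)) v))
      has_vector_derivative M'.dG (\<tau> y) (?D w) (?D u) (?D v) + G' (\<tau> y) (D2 w u) (?D v) + G' (\<tau> y) (?D u) (D2 w v)) (at 0)"
      using M'.derivative_along[OF derivative_on_line[OF smooth_on_differentiable[OF sm y], of w] dl[of u] dl[of v]] yU
      by simp
    moreover have "\<forall>\<^sub>F t in at 0. ?l t \<in> V"
      by (rule has_vector_derivative_eventually_in[OF _ V(1)]) (use y in \<open>auto intro!: derivative_eq_intros\<close>)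
    then have "\<forall>\<^sub>F t in at 0. G' (\<tau> (?l t)) (frechet_derivative \<tau> (at (?l t)) u) (frechet_derivative \<tau> (at (?l t)) v)
        = G (?l t) u v"
      by (rule eventually_mono) (simp add: isom)
    ultimately have "((\<lambda>t. G (?l t) u v) has_vector_derivative
       M'.dG (\<tau> y) (?D w) (?D u) (?D v) + G' (\<tau> y) (D2 w u) (?D v) + G' (\<tau> y) (?D u) (D2 w v)) (at 0)"
      by (rule has_vector_derivative_transform_eventually_at) (simp add: isom y)
    then show ?thesis
      using derivative_on_line[OF smooth_on_differentiable[OF M.smooth yU(1)]] vector_derivative_unique_at by blast
  qed
  have "G' (\<tau> y) (?D (christoffel_of G y u v)) (?D z)
      = G' (\<tau> y) (christoffel_of G' (\<tau> y) (?D u) (?D v) + D2 u v) (?D z)" for z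
  proof -
    have "G' (\<tau> y) (?D (christoffel_of G y u v)) (?D z) = koszul G y u v z"
      using isom[OF y] M.christoffel_koszul[OF yU(1)] by simp
    also have "\<dots> = koszul G' (\<tau> y) (?D u) (?D v) (?D z) + G' (\<tau> y) (D2 u v) (?D z)"
      unfolding koszul_def dG
      using M'.sym[OF yU(2)] D2[of v u] D2[of z u] D2[of z v] by (simp add: field_simps)
    finally show ?thesis
      by (simp add: M'.simps_left[OF yU(2)] M'.christoffel_koszul[OF yU(2)])
  qed
  then have "G' (\<tau> y) (?D (christoffel_of G y u v)) z
      = G' (\<tau> y) (christoffel_of G' (\<tau> y) (?D u) (?D v) + D2 u v) z" for z
    using onto by (metis surjD)
  from M'.cancel[OF yU(2) this] show ?thesis unfolding D2_def .
qed

text \<open>Product rule for a vector \<open>V s\<close> transported by the derivative of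
  \<open>f\<close> at a moving point. With a transition map for \<open>f\<close> it differentiates
  the components of a vector field in the other chart.\<close>

lemma second_derivative_along:
  fixes f :: "'a::euclidean_space \<Rightarrow> 'b::real_normed_vector"
  assumes sm: "smooth_on U f" and op: "open U" and U: "y t \<in> U"
    and y: "(y has_vector_derivative y') (at t)" and V: "(V has_vector_derivative V') (at t)"
  shows "((\<lambda>s. frechet_derivative f (at (y s)) (V s)) has_vector_derivative
    frechet_derivative (\<lambda>z. frechet_derivative f (at z) (V t)) (at (y t)) y'
     + frechet_derivative f (at (y t)) V') (at t)"
proof -
  let ?F = "\<lambda>z b. frechet_derivative f (at z) b"
  have ip: "((\<lambda>s. V s \<bullet> b) has_real_derivative V' \<bullet> b) (at t)" for b
    using bounded_linear.has_vector_derivative[OF bounded_linear_inner_left V]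
    by (simp add: has_real_derivative_iff_has_vector_derivative)
  have der: "((\<lambda>s. \<Sum>b\<in>Basis. (V s \<bullet> b) *\<^sub>R ?F (y s) b) has_vector_derivative
      (\<Sum>b\<in>Basis. (V t \<bullet> b) *\<^sub>R frechet_derivative (\<lambda>z. ?F z b) (at (y t)) y' + (V' \<bullet> b) *\<^sub>R ?F (y t) b)) (at t)"
    by (intro has_vector_derivative_sum has_vector_derivative_scaleR ip
        derivative_along_curve y smooth_on_differentiable[OF smooth_on_derivative[OF sm] U])
  have lin: "z \<in> U \<Longrightarrow> ?F z v = (\<Sum>b\<in>Basis. (v \<bullet> b) *\<^sub>R ?F z b)" for z v
    by (rule linear_expand[OF smooth_on_linear_derivative[OF sm]])
  have ev: "\<forall>\<^sub>F s in at t. (\<Sum>b\<in>Basis. (V s \<bullet> b) *\<^sub>R ?F (y s) b) = ?F (y s) (V s)"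
    using has_vector_derivative_eventually_in[OF y op U] by (rule eventually_mono) (rule lin[symmetric])
  have "frechet_derivative (\<lambda>z. ?F z (V t)) (at (y t))
      = frechet_derivative (\<lambda>z. \<Sum>b\<in>Basis. (V t \<bullet> b) *\<^sub>R ?F z b) (at (y t))"
    by (rule frechet_derivative_cong_open[OF op U]) (rule lin)
  also have "\<dots> = (\<lambda>w. \<Sum>b\<in>Basis. (V t \<bullet> b) *\<^sub>R frechet_derivative (\<lambda>z. ?F z b) (at (y t)) w)"
    by (intro frechet_derivativeI has_derivative_sum has_derivative_scaleR_right
        smooth_on_has_derivative[OF smooth_on_derivative[OF sm] U])
  finally have eq: "(\<Sum>b\<in>Basis. (V t \<bullet> b) *\<^sub>R frechet_derivative (\<lambda>z. ?F z b) (at (y t)) y' + (V' \<bullet> b) *\<^sub>R ?F (y t) b)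
      = frechet_derivative (\<lambda>z. ?F z (V t)) (at (y t)) y' + ?F (y t) V'"
    by (simp add: sum.distrib lin[OF U, of V'])
  show ?thesis
    by (rule has_vector_derivative_transform_eventually_at[OF der[unfolded eq] ev lin[OF U, symmetric]])
qed

section \<open>Covariant derivatives under change of chart\<close>

locale riemannian_atlas = smooth_atlas A for A :: "('a, 'e::euclidean_space) chart set" +
  fixes g :: "('a, 'e) metric"
  assumes metric: "riemannian_metric_on A (carrier_of A) g"
begin

lemma chart_in_carrier: "c \<in> A \<Longrightarrow> cdom c \<inter> carrier_of A = cdom c"
  unfolding carrier_of_def by blast

lemma local_metric: "c \<in> A \<Longrightarrow> local_metric (cmap c ` cdom c) (metric_rep A g c)"
  using local_metric_rep[OF metric, of c] by (simp add: chart_in_carrier open_image)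

lemma metric_rep_transition:
  assumes "c \<in> A" "c' \<in> A" "p \<in> cdom c" "p \<in> cdom c'"
  shows "metric_rep A g c (cmap c p) u v = metric_rep A g c' (cmap c' p)
     (frechet_derivative (transition c c') (at (cmap c p)) u)
     (frechet_derivative (transition c c') (at (cmap c p)) v)"
proof -
  have t: "coord_tvec A c p u \<in> tangent_space A p" for u using coord_tvec_tangent assms by blast
  show ?thesis
    using metric_eq_rep[OF assms(1,3) t t, of g u v] metric_eq_rep[OF assms(2,4) t t, of g u v] assms
    by (simp add: coord_tvec_self coord_tvec_apply)
qed

lemma christoffel_transition:
  assumes "c \<in> A" "c' \<in> A" "p \<in> cdom c" "p \<in> cdom c'"
  defines "D \<equiv> frechet_derivative (transition c c') (at (cmap c p))"
  shows "D (christoffel A g c (cmap c p) u v) = christoffel A g c' (cmap c' p) (D u) (D v)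
     + frechet_derivative (\<lambda>y. frechet_derivative (transition c c') (at y) v) (at (cmap c p)) u"
proof -
  have "surj D"
    using transition_derivative_inverse[OF assms(2,1,4,3)] unfolding D_def surj_def by metis
  moreover have "metric_rep A g c y u v = metric_rep A g c' (transition c c' y)
     (frechet_derivative (transition c c') (at y) u) (frechet_derivative (transition c c') (at y) v)"
    if "y \<in> cmap c ` (cdom c \<inter> cdom c')" for y u v
  proof -
    obtain q where "q \<in> cdom c" "q \<in> cdom c'" "y = cmap c q" using \<open>y \<in> _\<close> by blast
    then show ?thesis
      using metric_rep_transition[OF assms(1,2)] by (simp only: transition_cmap[OF assms(1)])
  qed
  moreover have "transition c c' ` cmap c ` (cdom c \<inter> cdom c') \<subseteq> cmap c' ` cdom c'"
    by (auto simp: transition_cmap[OF assms(1), of _ c'])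
  ultimately show ?thesis
    using christoffel_transform[OF local_metric[OF assms(1)] local_metric[OF assms(2)]
        open_overlap[OF assms(1,2)] _ _ smooth_transition[OF assms(1,2)], of "cmap c p" u v] assms(3,4)
    unfolding christoffel_eq D_def by (auto simp: transition_cmap[OF assms(1)])
qed

text \<open>Differentiating the components of \<open>E\<close> in the new chart produces a second
  derivative of the transition map; it is exactly the inhomogeneous term in
  \<open>christoffel_transition\<close>, and the two cancel.\<close>

lemma cov_deriv_transition:
  assumes c: "c \<in> A" "c' \<in> A" and I: "open I" "t \<in> I" "x ` I \<subseteq> cdom c" "smooth_on I (cmap c \<circ> x)"
    and E: "\<And>s. s \<in> I \<Longrightarrow> E s \<in> tangent_space A (x s)" "(\<lambda>s. E s c) differentiable (at t)"
    and p: "x t \<in> cdom c'"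
  shows "cov_deriv A g x E t c'
     = frechet_derivative (transition c c') (at (cmap c (x t))) (cov_deriv A g x E t c)"
proof -
  let ?\<tau> = "transition c c'" and ?y = "cmap c \<circ> x"
  let ?D = "frechet_derivative ?\<tau> (at (cmap c (x t)))"
  have pc: "x t \<in> cdom c" using I by auto
  define y' where "y' = vector_derivative ?y (at t)"
  define E' where "E' = vector_derivative (\<lambda>s. E s c) (at t)"
  have y: "(?y has_vector_derivative y') (at t)" and E': "((\<lambda>s. E s c) has_vector_derivative E') (at t)"
    unfolding y'_def E'_def
    using smooth_on_differentiable[OF I(4,2)] E(2) vector_derivative_works by blast+
  have vel: "velocity A x t = coord_tvec A c (x t) y'"
    unfolding y'_def by (rule velocity_eq_coord_tvec[OF c(1) I(1,3,4,2)])
  have "((\<lambda>s. frechet_derivative ?\<tau> (at (?y s)) (E s c)) has_vector_derivative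
      frechet_derivative (\<lambda>z. frechet_derivative ?\<tau> (at z) (E t c)) (at (?y t)) y' + ?D E') (at t)"
    using second_derivative_along[OF smooth_transition[OF c] open_overlap[OF c] _ y E'] p pc by auto
  moreover have "open {s\<in>I. x s \<in> cdom c'}"
    by (rule open_curve_overlap[OF c I(1,3) smooth_on_continuous[OF I(4)]])
  ultimately have "((\<lambda>s. E s c') has_vector_derivative
      frechet_derivative (\<lambda>z. frechet_derivative ?\<tau> (at z) (E t c)) (at (?y t)) y' + ?D E') (at t)"
  proof (rule has_vector_derivative_transform_within_open)
    show "t \<in> {s \<in> I. x s \<in> cdom c'}" using I p by auto
    fix s assume "s \<in> {s \<in> I. x s \<in> cdom c'}"
    then show "frechet_derivative ?\<tau> (at (?y s)) (E s c) = E s c'"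
      using tangent_transition[OF E(1) c, of s] I(3) by auto
  qed
  then have "vector_derivative (\<lambda>s. E s c') (at t)
      = frechet_derivative (\<lambda>z. frechet_derivative ?\<tau> (at z) (E t c)) (at (cmap c (x t))) y' + ?D E'"
    using vector_derivative_at by fastforce
  then have "cov_deriv A g x E t c' = frechet_derivative (\<lambda>z. frechet_derivative ?\<tau> (at z) (E t c)) (at (cmap c (x t))) y'
      + ?D E' + christoffel A g c' (cmap c' (x t)) (?D y') (?D (E t c))"
    using c p pc I vel tangent_transition[OF E(1)[OF I(2)] c pc p]
    by (simp add: cov_deriv_def coord_tvec_apply)
  also have "\<dots> = ?D (christoffel A g c (cmap c (x t)) y' (E t c)) + ?D E'"
    unfolding christoffel_transition[OF c pc p] by simp
  also have "\<dots> = ?D (E' + christoffel A g c (cmap c (x t)) y' (E t c))"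
    using linear_add[OF transition_linear[OF c pc p]] by simp
  also have "\<dots> = ?D (cov_deriv A g x E t c)"
    using c pc vel by (simp add: cov_deriv_def coord_tvec_self E'_def)
  finally show ?thesis .
qed

text \<open>\<open>horizontal\<close> asks for vanishing in all charts; since the transition
  derivatives are linear, a computation in one chart is enough.\<close>

lemma cov_deriv_zeroI:
  assumes "c \<in> A" "open I" "t \<in> I" "x ` I \<subseteq> cdom c" "smooth_on I (cmap c \<circ> x)"
    and "\<And>s. s \<in> I \<Longrightarrow> E s \<in> tangent_space A (x s)" "(\<lambda>s. E s c) differentiable (at t)"
    and "cov_deriv A g x E t c = 0"
  shows "cov_deriv A g x E t = (\<lambda>_. 0)"
proof (rule ext)
  fix c'
  show "cov_deriv A g x E t c' = 0"
  proof (cases "c' \<in> A \<and> x t \<in> cdom c'")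
    case True
    then show ?thesis
      using cov_deriv_transition[OF assms(1) _ assms(2-7), of c'] assms(1,3,4,8)
        linear_0[OF transition_linear, of c c' "x t"] by auto
  qed (auto simp: cov_deriv_def)
qed

end


section \<open>Oriented orthonormal frames\<close>

definition det2 :: "real^2 \<Rightarrow> real^2 \<Rightarrow> real" where
  "det2 u v = u $ 1 * v $ 2 - u $ 2 * v $ 1"

lemma det_vector_eq_det2: "det (vector [u, v] :: real^2^2) = det2 u v"
  by (simp add: det_2 det2_def)

lemma det2_simps:
  "det2 (u + v) w = det2 u w + det2 v w" "det2 w (u + v) = det2 w u + det2 w v"
  "det2 (u - v) w = det2 u w - det2 v w" "det2 w (u - v) = det2 w u - det2 w v"
  "det2 (a *\<^sub>R u) w = a * det2 u w" "det2 w (a *\<^sub>R u) = a * det2 w u" "det2 u u = 0"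
  by (simp_all add: det2_def algebra_simps)

lemma det2_swap: "det2 v u = - det2 u v"
  by (simp add: det2_def)

lemma det2_cramer:
  assumes "det2 u1 u2 \<noteq> 0"
  shows "v = (det2 v u2 / det2 u1 u2) *\<^sub>R u1 + (det2 u1 v / det2 u1 u2) *\<^sub>R u2"
proof -
  have "det2 u1 u2 *\<^sub>R v = det2 v u2 *\<^sub>R u1 + det2 u1 v *\<^sub>R u2"
    by (simp add: vec_eq_iff forall_2 det2_def algebra_simps)
  then have "v = inverse (det2 u1 u2) *\<^sub>R (det2 v u2 *\<^sub>R u1 + det2 u1 v *\<^sub>R u2)"
    using assms by (metis scaleR_scaleR left_inverse scaleR_one)
  then show ?thesis by (simp add: scaleR_add_right divide_inverse_commute)
qed

lemma smooth_on_det2: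
  fixes u v :: "'b::euclidean_space \<Rightarrow> real^2"
  assumes "open S" "smooth_on S u" "smooth_on S v" shows "smooth_on S (\<lambda>x. det2 (u x) (v x))"
proof -
  have nth: "smooth_on S (\<lambda>x. f x $ i)" if "smooth_on S f" for f :: "'b \<Rightarrow> real^2" and i
    by (rule smooth_on_linear_compose[OF bounded_linear_vec_nth that assms(1)])
  show ?thesis unfolding det2_def
    by (intro smooth_on_diff smooth_on_mult nth assms)
qed

section \<open>Rotations and angles of frames\<close>

lemma fst_rot [simp]: "fst (rot \<theta> p) = fst p"
  and frame1_rot: "frame1 (rot \<theta> p) c = cos \<theta> *\<^sub>R frame1 p c + sin \<theta> *\<^sub>R frame2 p c"
  and frame2_rot: "frame2 (rot \<theta> p) c = - sin \<theta> *\<^sub>R frame1 p c + cos \<theta> *\<^sub>R frame2 p c"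
  by (simp_all add: rot_def lincomb_def)

lemma rot_rot: "rot a (rot b p) = rot (a + b) p"
  by (cases p) (auto simp: rot_def lincomb_def cos_add sin_add fun_eq_iff algebra_simps)

text \<open>The angle in \<open>(\<alpha>, \<alpha> + 2\<pi>)\<close> with cosine \<open>a\<close> and sine \<open>b\<close>: half of the angle measured from
  \<open>\<alpha> + \<pi>\<close> has tangent \<open>sin / (1 + cos)\<close>.\<close>

definition angle_from :: "real \<Rightarrow> real \<Rightarrow> real \<Rightarrow> real" where
  "angle_from \<alpha> a b = \<alpha> + pi + 2 * arctan ((a * sin \<alpha> - b * cos \<alpha>) / (1 - (a * cos \<alpha> + b * sin \<alpha>)))"

lemma angle_from_cos_sin:
  assumes "\<alpha> < \<theta>" "\<theta> < \<alpha> + 2 * pi"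
  shows "1 - (cos \<theta> * cos \<alpha> + sin \<theta> * sin \<alpha>) \<noteq> 0" "angle_from \<alpha> (cos \<theta>) (sin \<theta>) = \<theta>"
proof -
  define h where "h = (\<theta> - \<alpha> - pi) / 2"
  have h: "- (pi / 2) < h" "h < pi / 2" "\<theta> = \<alpha> + pi + 2 * h" using assms by (auto simp: h_def field_simps)
  then have ch: "cos h > 0" by (intro cos_gt_zero_pi) auto
  have c: "cos \<theta> * cos \<alpha> + sin \<theta> * sin \<alpha> = - cos (2 * h)"
    using cos_diff[of \<theta> \<alpha>] by (simp add: h(3) add.commute)
  have s: "cos \<theta> * sin \<alpha> - sin \<theta> * cos \<alpha> = sin (2 * h)"
    using sin_diff[of \<theta> \<alpha>] by (simp add: h(3) add.commute)
  have d: "1 + cos (2 * h) = 2 * (cos h)\<^sup>2" by (simp add: cos_double_cos)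
  show "1 - (cos \<theta> * cos \<alpha> + sin \<theta> * sin \<alpha>) \<noteq> 0" unfolding c using d ch by simp
  have "sin (2 * h) / (1 + cos (2 * h)) = tan h"
    unfolding d sin_double tan_def using ch by (simp add: power2_eq_square field_simps)
  then show "angle_from \<alpha> (cos \<theta>) (sin \<theta>) = \<theta>"
    unfolding angle_from_def s c using h by (simp add: arctan_tan)
qed

text \<open>The hypothesis reads \<open>cos (\<psi> - \<alpha>) \<noteq> 1\<close>: it excludes the
  angles equal to \<open>\<alpha>\<close> modulo \<open>2 * pi\<close>, the only ones without a
  representative in the open interval.\<close>

lemma angle_exists:
  assumes "1 - (cos \<psi> * cos \<alpha> + sin \<psi> * sin \<alpha>) \<noteq> 0"
  obtains \<theta> where "\<alpha> < \<theta>" "\<theta> < \<alpha> + 2 * pi" "cos \<theta> = cos \<psi>" "sin \<theta> = sin \<psi>"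
proof -
  obtain \<phi> where \<phi>: "0 \<le> \<phi>" "\<phi> < 2 * pi" "cos (\<psi> - \<alpha>) = cos \<phi>" "sin (\<psi> - \<alpha>) = sin \<phi>"
    using sincos_total_2pi[of "cos (\<psi> - \<alpha>)" "sin (\<psi> - \<alpha>)"] by (metis sin_cos_squared_add2)
  have "\<phi> \<noteq> 0" using assms \<phi>(3) cos_diff[of \<psi> \<alpha>] by auto
  moreover have "cos (\<alpha> + \<phi>) = cos \<psi>" "sin (\<alpha> + \<phi>) = sin \<psi>"
    using \<phi>(3,4) cos_add[of \<alpha> "\<psi> - \<alpha>"] sin_add[of \<alpha> "\<psi> - \<alpha>"] cos_add[of \<alpha> \<phi>] sin_add[of \<alpha> \<phi>] by simp_all
  ultimately show ?thesis using that[of "\<alpha> + \<phi>"] \<phi> by simp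
qed

lemma smooth_on_angle_from:
  fixes a b :: "'b::euclidean_space \<Rightarrow> real"
  assumes "open S" "smooth_on S a" "smooth_on S b" "\<And>x. x \<in> S \<Longrightarrow> 1 - (a x * cos \<alpha> + b x * sin \<alpha>) \<noteq> 0"
  shows "smooth_on S (\<lambda>x. angle_from \<alpha> (a x) (b x))"
  unfolding angle_from_def
  by (intro smooth_on_add smooth_on_const smooth_on_mult smooth_on_compose[OF smooth_on_arctan]
      smooth_on_divide smooth_on_diff assms) simp_all

lemma base_of_SO: "p \<in> SO A g \<Longrightarrow> fst p \<in> carrier_of A"
  by (cases p) (auto simp: SO_def)

locale riemannian_surface = riemannian_atlas A g
  for A :: "('a, real^2) chart set" and g :: "('a, real^2) metric"
begin

lemma SO_frame:
  assumes "p \<in> SO A g"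
  shows "frame1 p \<in> tangent_space A (fst p)" "frame2 p \<in> tangent_space A (fst p)"
    and "c \<in> A \<Longrightarrow> fst p \<in> cdom c \<Longrightarrow> 0 < det2 (frame1 p c) (frame2 p c)"
    and "c \<in> A \<Longrightarrow> fst p \<in> cdom c \<Longrightarrow>
      metric_rep A g c (cmap c (fst p)) (frame1 p c) (frame1 p c) = 1 \<and>
      metric_rep A g c (cmap c (fst p)) (frame2 p c) (frame2 p c) = 1 \<and>
      metric_rep A g c (cmap c (fst p)) (frame1 p c) (frame2 p c) = 0"
  using assms by (cases p; auto simp: SO_def det_vector_eq_det2 metric_eq_rep)+

lemma SO_intro:
  assumes "x \<in> carrier_of A" "e1 \<in> tangent_space A x" "e2 \<in> tangent_space A x"
    and "\<And>c. c \<in> A \<Longrightarrow> x \<in> cdom c \<Longrightarrow> 0 < det2 (e1 c) (e2 c) \<and>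
      metric_rep A g c (cmap c x) (e1 c) (e1 c) = 1 \<and> metric_rep A g c (cmap c x) (e2 c) (e2 c) = 1 \<and>
      metric_rep A g c (cmap c x) (e1 c) (e2 c) = 0"
  shows "(x, e1, e2) \<in> SO A g"
proof -
  obtain c where "c \<in> A" "x \<in> cdom c" using assms(1) unfolding carrier_of_def by blast
  then show ?thesis
    using assms by (auto simp: SO_def det_vector_eq_det2 metric_eq_rep)
qed

lemma rot_SO:
  assumes "p \<in> SO A g" shows "rot \<theta> p \<in> SO A g"
proof -
  have "(fst p, frame1 (rot \<theta> p), frame2 (rot \<theta> p)) \<in> SO A g"
  proof (rule SO_intro)
    show "fst p \<in> carrier_of A" using base_of_SO[OF assms] .
    show "frame1 (rot \<theta> p) \<in> tangent_space A (fst p)" "frame2 (rot \<theta> p) \<in> tangent_space A (fst p)"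
      unfolding rot_def by (auto intro!: lincomb_tangent SO_frame assms)
    fix c assume c: "c \<in> A" "fst p \<in> cdom c"
    interpret M: local_metric "cmap c ` cdom c" "metric_rep A g c" by (rule local_metric[OF c(1)])
    have y: "cmap c (fst p) \<in> cmap c ` cdom c" using c by simp
    note G = SO_frame(4)[OF assms c] and d = SO_frame(3)[OF assms c]
    have sc: "cos \<theta> * cos \<theta> + sin \<theta> * sin \<theta> = 1"
      using sin_cos_squared_add2[of \<theta>] by (simp add: power2_eq_square)
    have "det2 (frame1 (rot \<theta> p) c) (frame2 (rot \<theta> p) c)
        = (cos \<theta> * cos \<theta> + sin \<theta> * sin \<theta>) * det2 (frame1 p c) (frame2 p c)"
      unfolding frame1_rot frame2_rot
      using arg_cong[OF sc, of "\<lambda>r. r * det2 (frame1 p c) (frame2 p c)", unfolded distrib_right mult.assoc mult_1]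
      by (simp add: det2_simps det2_swap[of "frame2 p c" "frame1 p c"])
    then show "0 < det2 (frame1 (rot \<theta> p) c) (frame2 (rot \<theta> p) c) \<and>
      metric_rep A g c (cmap c (fst p)) (frame1 (rot \<theta> p) c) (frame1 (rot \<theta> p) c) = 1 \<and>
      metric_rep A g c (cmap c (fst p)) (frame2 (rot \<theta> p) c) (frame2 (rot \<theta> p) c) = 1 \<and>
      metric_rep A g c (cmap c (fst p)) (frame1 (rot \<theta> p) c) (frame2 (rot \<theta> p) c) = 0"
      using d G sc M.sym[OF y, of "frame2 p c" "frame1 p c"] unfolding frame1_rot frame2_rot
      by (simp add: M.simps_left[OF y] M.simps_right[OF y] algebra_simps)
  qed
  then show ?thesis by (simp add: rot_def)
qed

text \<open>Cramer's rule for the first frame vector. It makes the angle unique up to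
  \<open>2 * pi\<close> in \<open>rot_inject\<close>, and it writes cosine and sine through
  components, which gives their smoothness in \<open>frame_chart_overlap\<close>.\<close>

lemma rot_cramer:
  assumes "q \<in> SO A g" "c \<in> A" "fst q \<in> cdom c" "p = rot \<psi> q"
  shows "cos \<psi> = det2 (frame1 p c) (frame2 q c) / det2 (frame1 q c) (frame2 q c)"
    and "sin \<psi> = det2 (frame1 q c) (frame1 p c) / det2 (frame1 q c) (frame2 q c)"
  using SO_frame(3)[OF assms(1-3)] unfolding assms(4) by (simp_all add: frame1_rot det2_simps)

lemma rot_inject:
  assumes "q \<in> SO A g" "rot \<theta> q = rot \<theta>' q" shows "cos \<theta> = cos \<theta>' \<and> sin \<theta> = sin \<theta>'"
proof -
  obtain c where "c \<in> A" "fst q \<in> cdom c" using base_of_SO[OF assms(1)] unfolding carrier_of_def by blast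
  then show ?thesis
    using rot_cramer[OF assms(1), of c _ \<theta>] rot_cramer[OF assms(1), of c _ \<theta>'] assms(2) by metis
qed

lemma rot_cong: "cos \<theta> = cos \<theta>' \<Longrightarrow> sin \<theta> = sin \<theta>' \<Longrightarrow> rot \<theta> q = rot \<theta>' q"
  by (simp add: rot_def)

text \<open>The matrix that expresses one frame in the other is orthogonal with positive
  determinant, hence a rotation; its first row supplies the angle.\<close>

lemma SO_rot_exists:
  assumes p: "p \<in> SO A g" and q: "q \<in> SO A g" and pq: "fst p = fst q"
  obtains \<psi> where "p = rot \<psi> q"
proof -
  obtain c where c: "c \<in> A" "fst q \<in> cdom c" using base_of_SO[OF q] unfolding carrier_of_def by blast
  interpret M: local_metric "cmap c ` cdom c" "metric_rep A g c" by (rule local_metric[OF c(1)])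
  define y where "y = cmap c (fst q)"
  have y: "y \<in> cmap c ` cdom c" using c by (simp add: y_def)
  define u1 u2 v1 v2 where "u1 = frame1 q c" "u2 = frame2 q c" "v1 = frame1 p c" "v2 = frame2 p c"
  note uv = this
  have du: "0 < det2 u1 u2" and Gu: "metric_rep A g c y u1 u1 = 1" "metric_rep A g c y u2 u2 = 1"
    "metric_rep A g c y u1 u2 = 0"
    using SO_frame(3,4)[OF q c] by (auto simp: uv y_def)
  have dv: "0 < det2 v1 v2" and Gv: "metric_rep A g c y v1 v1 = 1" "metric_rep A g c y v2 v2 = 1"
    "metric_rep A g c y v1 v2 = 0"
    using SO_frame(3,4)[OF p c(1)] c pq by (auto simp: uv y_def)
  obtain a b where v1: "v1 = a *\<^sub>R u1 + b *\<^sub>R u2" using det2_cramer[of u1 u2 v1] du by auto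
  obtain k l where v2: "v2 = k *\<^sub>R u1 + l *\<^sub>R u2" using det2_cramer[of u1 u2 v2] du by auto
  have G21: "metric_rep A g c y u2 u1 = 0" using M.sym[OF y] Gu(3) by metis
  have ab: "a * a + b * b = 1" and kl: "k * k + l * l = 1" and akbl: "a * k + b * l = 0"
    using Gv Gu G21 unfolding v1 v2 by (simp_all add: M.simps_left[OF y] M.simps_right[OF y] mult.commute)
  have "det2 v1 v2 = (a * l - b * k) * det2 u1 u2"
    unfolding v1 v2 by (simp add: det2_simps det2_swap[of u2 u1] algebra_simps)
  then have posd: "a * l - b * k > 0" using dv du by (simp add: zero_less_mult_iff)
  \<comment> \<open>Lagrange's identity turns orthonormality of the rows into determinant 1 or -1;
    orientation selects 1.\<close>
  have "(a * l - b * k)\<^sup>2 = (a * a + b * b) * (k * k + l * l) - (a * k + b * l)\<^sup>2"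
    by (simp add: power2_eq_square algebra_simps)
  then have "(a * l - b * k)\<^sup>2 = 1" by (simp add: ab kl akbl)
  then have one: "a * l - b * k = 1" using posd by (simp add: power2_eq_1_iff)
  have "k = k * (a * a + b * b) - a * (a * k + b * l)" by (simp add: ab akbl)
  also have "\<dots> = - b * (a * l - b * k)" by (simp add: algebra_simps)
  finally have k: "k = - b" by (simp add: one)
  have "l = l * (a * a + b * b) - b * (a * k + b * l)" by (simp add: ab akbl)
  also have "\<dots> = a * (a * l - b * k)" by (simp add: algebra_simps)
  finally have l: "l = a" by (simp add: one)
  obtain \<psi> where \<psi>: "a = cos \<psi>" "b = sin \<psi>"
    using sincos_total_2pi[of a b] ab by (metis power2_eq_square)
  have "rot \<psi> q \<in> SO A g" by (rule rot_SO[OF q])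
  note fr = SO_frame(1,2)[OF p] SO_frame(1,2)[OF this]
  have "frame1 p = frame1 (rot \<psi> q)"
    by (rule tangent_eqI[OF c fr(1)[unfolded pq] fr(3)[unfolded fst_rot]])
      (use v1 in \<open>simp add: uv \<psi> frame1_rot\<close>)
  moreover have "frame2 p = frame2 (rot \<psi> q)"
    by (rule tangent_eqI[OF c fr(2)[unfolded pq] fr(4)[unfolded fst_rot]])
      (use v2 in \<open>simp add: uv \<psi> k l frame2_rot\<close>)
  ultimately have "p = rot \<psi> q" using pq by (intro prod_eqI) auto
  then show ?thesis by (rule that)
qed

end

section \<open>The frame bundle\<close>

locale framed_chart = riemannian_surface A g
  for A :: "('a, real^2) chart set" and g :: "('a, real^2) metric" +
  fixes c :: "('a, real^2) chart" and s :: "'a \<Rightarrow> 'a frame"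
  assumes chart: "c \<in> A" and frame_field: "smooth_frame_field A g c s"
begin

definition S1 :: "real^2 \<Rightarrow> real^2" where "S1 y = frame1 (s (cinv c y)) c"
definition S2 :: "real^2 \<Rightarrow> real^2" where "S2 y = frame2 (s (cinv c y)) c"

lemma s_SO: "x \<in> cdom c \<Longrightarrow> s x \<in> SO A g" and fst_s: "x \<in> cdom c \<Longrightarrow> fst (s x) = x"
  using frame_field unfolding smooth_frame_field_def by blast+

lemma S1_cmap: "x \<in> cdom c \<Longrightarrow> frame1 (s x) c = S1 (cmap c x)"
  and S2_cmap: "x \<in> cdom c \<Longrightarrow> frame2 (s x) c = S2 (cmap c x)"
  by (simp_all add: S1_def S2_def cinv_cmap chart)

lemma smooth_S: "smooth_on (cmap c ` cdom c) S1" "smooth_on (cmap c ` cdom c) S2"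
  using frame_field unfolding smooth_frame_field_def S1_def[abs_def] S2_def[abs_def] by blast+

lemma det2_S: "y \<in> cmap c ` cdom c \<Longrightarrow> det2 (S1 y) (S2 y) > 0"
  using SO_frame(3)[OF s_SO chart] by (auto simp: fst_s S1_cmap S2_cmap)

lemma orthonormal_S:
  assumes "y \<in> cmap c ` cdom c"
  shows "metric_rep A g c y (S1 y) (S1 y) = 1" "metric_rep A g c y (S2 y) (S2 y) = 1"
    "metric_rep A g c y (S1 y) (S2 y) = 0"
  using SO_frame(4)[OF s_SO chart] assms by (auto simp: fst_s S1_cmap S2_cmap)

lemma frame_chart_mem:
  assumes "x \<in> cdom c" "\<alpha> < \<theta>" "\<theta> < \<alpha> + 2 * pi"
  shows "rot \<theta> (s x) \<in> cdom (frame_chart c s \<alpha>)"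
    "cmap (frame_chart c s \<alpha>) (rot \<theta> (s x)) = (cmap c x, \<theta>)"
proof -
  show "rot \<theta> (s x) \<in> cdom (frame_chart c s \<alpha>)"
    unfolding frame_chart_def using assms by auto
  have "(THE \<theta>'. \<theta>' \<in> {\<alpha><..<\<alpha> + 2 * pi} \<and> rot \<theta> (s x) = rot \<theta>' (s x)) = \<theta>"
  proof (rule the_equality)
    fix \<theta>' assume a: "\<theta>' \<in> {\<alpha><..<\<alpha> + 2 * pi} \<and> rot \<theta> (s x) = rot \<theta>' (s x)"
    then have "cos \<theta> = cos \<theta>'" "sin \<theta> = sin \<theta>'" using rot_inject[OF s_SO[OF assms(1)]] by blast+
    then show "\<theta>' = \<theta>"
      using angle_from_cos_sin(2)[of \<alpha> \<theta>] angle_from_cos_sin(2)[of \<alpha> \<theta>'] a assms by auto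
  qed (use assms in auto)
  then show "cmap (frame_chart c s \<alpha>) (rot \<theta> (s x)) = (cmap c x, \<theta>)"
    unfolding frame_chart_def by (simp add: fst_s assms(1))
qed

lemma frame_chartE:
  assumes "p \<in> cdom (frame_chart c s \<alpha>)"
  obtains x \<theta> where "x \<in> cdom c" "\<alpha> < \<theta>" "\<theta> < \<alpha> + 2 * pi" "p = rot \<theta> (s x)" "fst p = x"
    "cmap (frame_chart c s \<alpha>) p = (cmap c x, \<theta>)"
proof -
  obtain x \<theta> where "x \<in> cdom c" "\<alpha> < \<theta>" "\<theta> < \<alpha> + 2 * pi" "p = rot \<theta> (s x)"
    using assms unfolding frame_chart_def by auto
  then show ?thesis using that[of x \<theta>] frame_chart_mem(2)[of x \<alpha> \<theta>] by (simp add: fst_s)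
qed

lemma frame_chart_fst:
  assumes "p \<in> cdom (frame_chart c s \<alpha>)"
  shows "fst p \<in> cdom c" "fst (cmap (frame_chart c s \<alpha>) p) = cmap c (fst p)" "p \<in> SO A g"
proof -
  obtain x \<theta> where p: "x \<in> cdom c" "p = rot \<theta> (s x)" "fst p = x"
    "cmap (frame_chart c s \<alpha>) p = (cmap c x, \<theta>)" using assms by (rule frame_chartE)
  show "fst p \<in> cdom c" "fst (cmap (frame_chart c s \<alpha>) p) = cmap c (fst p)" using p(1,3,4) by simp_all
  show "p \<in> SO A g" unfolding p(2) by (rule rot_SO[OF s_SO[OF p(1)]])
qed

lemma inj_frame_chart: "inj_on (cmap (frame_chart c s \<alpha>)) (cdom (frame_chart c s \<alpha>))"
proof (rule inj_onI)
  fix p q assume "p \<in> cdom (frame_chart c s \<alpha>)" "q \<in> cdom (frame_chart c s \<alpha>)"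
    and eq: "cmap (frame_chart c s \<alpha>) p = cmap (frame_chart c s \<alpha>) q"
  then obtain x \<theta> y \<phi> where "x \<in> cdom c" "p = rot \<theta> (s x)" "cmap (frame_chart c s \<alpha>) p = (cmap c x, \<theta>)"
    "y \<in> cdom c" "q = rot \<phi> (s y)" "cmap (frame_chart c s \<alpha>) q = (cmap c y, \<phi>)"
    by (metis frame_chartE)
  then show "p = q" using eq inj_onD[OF inj[OF chart]] by auto
qed

text \<open>Reduces openness of the domain of the lifted metric to openness in the base.\<close>

lemma image_frame_chart:
  "cmap (frame_chart c s \<alpha>) ` (cdom (frame_chart c s \<alpha>) \<inter> {p. fst p \<in> V})
    = cmap c ` (cdom c \<inter> V) \<times> {\<alpha><..<\<alpha> + 2 * pi}" (is "?L = ?R")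
proof
  show "?L \<subseteq> ?R"
  proof clarify
    fix y \<theta> p1 p2 p3
    assume p: "(y, \<theta>) = cmap (frame_chart c s \<alpha>) (p1, p2, p3)" "(p1, p2, p3) \<in> cdom (frame_chart c s \<alpha>)"
      "fst (p1, p2, p3) \<in> V"
    obtain x \<phi> where "x \<in> cdom c" "\<alpha> < \<phi>" "\<phi> < \<alpha> + 2 * pi" "fst (p1, p2, p3) = x"
      "cmap (frame_chart c s \<alpha>) (p1, p2, p3) = (cmap c x, \<phi>)" using p(2) by (rule frame_chartE)
    then show "y \<in> cmap c ` (cdom c \<inter> V) \<and> \<theta> \<in> {\<alpha><..<\<alpha> + 2 * pi}" using p by auto
  qed
  show "?R \<subseteq> ?L"
  proof clarify
    fix x \<theta> assume x: "x \<in> cdom c" "x \<in> V" "\<theta> \<in> {\<alpha><..<\<alpha> + 2 * pi}"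
    then have "(cmap c x, \<theta>) = cmap (frame_chart c s \<alpha>) (rot \<theta> (s x))"
      using frame_chart_mem(2) by simp
    moreover have "rot \<theta> (s x) \<in> cdom (frame_chart c s \<alpha>) \<inter> {p. fst p \<in> V}"
      using x frame_chart_mem(1) by (simp add: fst_s)
    ultimately show "(cmap c x, \<theta>) \<in> ?L" by (rule image_eqI)
  qed
qed

text \<open>Here \<open>\<psi>\<close> need not lie in the interval of the chart: membership and
  coordinates are expressed by cosine and sine alone, so that a change of frame field never requires
  a choice of representative.\<close>

lemma rot_in_frame_chart:
  assumes x: "x \<in> cdom c"
  shows "rot \<psi> (s x) \<in> cdom (frame_chart c s \<alpha>) \<longleftrightarrow> 1 - (cos \<psi> * cos \<alpha> + sin \<psi> * sin \<alpha>) \<noteq> 0"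
    and "rot \<psi> (s x) \<in> cdom (frame_chart c s \<alpha>) \<Longrightarrow>
      cmap (frame_chart c s \<alpha>) (rot \<psi> (s x)) = (cmap c x, angle_from \<alpha> (cos \<psi>) (sin \<psi>))"
proof -
  have 1: "1 - (cos \<psi> * cos \<alpha> + sin \<psi> * sin \<alpha>) \<noteq> 0 \<and>
      cmap (frame_chart c s \<alpha>) (rot \<psi> (s x)) = (cmap c x, angle_from \<alpha> (cos \<psi>) (sin \<psi>))"
    if mem: "rot \<psi> (s x) \<in> cdom (frame_chart c s \<alpha>)"
  proof -
    obtain x' \<theta> where x': "x' \<in> cdom c" "\<alpha> < \<theta>" "\<theta> < \<alpha> + 2 * pi" "rot \<psi> (s x) = rot \<theta> (s x')"
      "fst (rot \<psi> (s x)) = x'" "cmap (frame_chart c s \<alpha>) (rot \<psi> (s x)) = (cmap c x', \<theta>)"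
      using mem by (rule frame_chartE)
    from x'(5) have "x' = x" by (simp add: fst_s x)
    with x'(4) have cs: "cos \<psi> = cos \<theta>" "sin \<psi> = sin \<theta>"
      using rot_inject[OF s_SO[OF x], of \<psi> \<theta>] by simp_all
    show ?thesis unfolding cs using angle_from_cos_sin[OF x'(2,3)] x'(6) \<open>x' = x\<close> by auto
  qed
  have 2: "rot \<psi> (s x) \<in> cdom (frame_chart c s \<alpha>)"
    if ne: "1 - (cos \<psi> * cos \<alpha> + sin \<psi> * sin \<alpha>) \<noteq> 0"
  proof -
    obtain \<theta> where \<theta>: "\<alpha> < \<theta>" "\<theta> < \<alpha> + 2 * pi" "cos \<theta> = cos \<psi>" "sin \<theta> = sin \<psi>"
      using angle_exists[OF ne] .
    show ?thesis
      using frame_chart_mem(1)[OF x \<theta>(1,2)] rot_cong[OF \<theta>(3,4)] by metis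
  qed
  show "rot \<psi> (s x) \<in> cdom (frame_chart c s \<alpha>) \<longleftrightarrow> 1 - (cos \<psi> * cos \<alpha> + sin \<psi> * sin \<alpha>) \<noteq> 0"
    using 1 2 by blast
  show "rot \<psi> (s x) \<in> cdom (frame_chart c s \<alpha>) \<Longrightarrow>
      cmap (frame_chart c s \<alpha>) (rot \<psi> (s x)) = (cmap c x, angle_from \<alpha> (cos \<psi>) (sin \<psi>))"
    using 1 by blast
qed

end

section \<open>The smooth structure of the frame bundle\<close>

context riemannian_surface
begin

lemma frame_atlasE:
  assumes "D \<in> frame_atlas A g"
  obtains c s \<alpha> where "D = frame_chart c s \<alpha>" "framed_chart A g c s"
  using assms that riemannian_surface_axioms
  unfolding frame_atlas_def framed_chart_def framed_chart_axioms_def by auto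

text \<open>The new angle is found without lifting anything to the line: its cosine \<open>a\<close>
  and sine \<open>b\<close> relative to \<open>s'\<close> are smooth by Cramer's rule, and
  \<open>angle_from\<close> recovers the angle smoothly away from the direction that the chart
  omits.\<close>

lemma frame_chart_overlap:
  fixes \<alpha> \<alpha>' :: real
  assumes F: "framed_chart A g c s" "framed_chart A g c' s'"
  defines "D \<equiv> frame_chart c s \<alpha>" and "D' \<equiv> frame_chart c' s' \<alpha>'"
  shows "open (cmap D ` (cdom D \<inter> cdom D'))" "smooth_on (cmap D ` (cdom D \<inter> cdom D')) (transition D D')"
proof -
  interpret F: framed_chart A g c s by fact
  interpret F': framed_chart A g c' s' by fact
  let ?\<tau> = "transition c c'"
  let ?V = "cmap c ` (cdom c \<inter> cdom c')"
  let ?O = "?V \<times> {\<alpha><..<\<alpha> + 2 * pi}"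
  \<comment> \<open>The first vector of the frame with coordinates \<open>(y, \<theta>)\<close>,
    transported to the chart \<open>c'\<close>.\<close>
  let ?E = "\<lambda>z. frechet_derivative ?\<tau> (at (fst z)) (cos (snd z) *\<^sub>R F.S1 (fst z) + sin (snd z) *\<^sub>R F.S2 (fst z))"
  let ?d = "\<lambda>z. det2 (F'.S1 (?\<tau> (fst z))) (F'.S2 (?\<tau> (fst z)))"
  define a where "a z = det2 (?E z) (F'.S2 (?\<tau> (fst z))) / ?d z" for z
  define b where "b z = det2 (F'.S1 (?\<tau> (fst z))) (?E z) / ?d z" for z
  have Oo: "open ?O" by (intro open_Times open_overlap F.chart F'.chart open_greaterThanLessThan)
  have fstO: "fst ` ?O \<subseteq> ?V" by auto
  have im: "?\<tau> ` ?V \<subseteq> cmap c' ` cdom c'" using F.chart by (auto simp: transition_cmap[of _ _ c'])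
  have sfst: "smooth_on ?O fst" and ssnd: "smooth_on ?O snd"
    by (intro smooth_on_bounded_linear bounded_linear_fst bounded_linear_snd Oo)+
  have st: "smooth_on ?O (\<lambda>z. ?\<tau> (fst z))"
    by (rule smooth_on_compose[OF smooth_transition[OF F.chart F'.chart] sfst Oo open_overlap[OF F.chart F'.chart] fstO])
  have sS: "smooth_on ?O (\<lambda>z. F.S1 (fst z))" "smooth_on ?O (\<lambda>z. F.S2 (fst z))"
    by (rule smooth_on_compose[OF _ sfst Oo open_image[OF F.chart]], rule F.smooth_S, use fstO in blast)+
  have sS': "smooth_on ?O (\<lambda>z. F'.S1 (?\<tau> (fst z)))" "smooth_on ?O (\<lambda>z. F'.S2 (?\<tau> (fst z)))"
    by (rule smooth_on_compose[OF _ st Oo open_image[OF F'.chart]], rule F'.smooth_S, use fstO im in blast)+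
  have cs: "smooth_on ?O (\<lambda>z. cos (snd z))" "smooth_on ?O (\<lambda>z. sin (snd z))"
    using smooth_on_compose[OF smooth_on_sin_cos(1) ssnd Oo] smooth_on_compose[OF smooth_on_sin_cos(2) ssnd Oo] by auto
  have sE: "smooth_on ?O ?E"
    by (rule smooth_on_derivative_along[OF smooth_transition[OF F.chart F'.chart] open_overlap[OF F.chart F'.chart] Oo sfst _ fstO])
      (intro smooth_on_add smooth_on_scaleR sS cs Oo)
  have d0: "?d z \<noteq> 0" if "z \<in> ?O" for z
  proof -
    have "?\<tau> (fst z) \<in> cmap c' ` cdom c'" using that fstO im by blast
    then show ?thesis using F'.det2_S by fastforce
  qed
  have sa: "smooth_on ?O a" and sb: "smooth_on ?O b"
    unfolding a_def[abs_def] b_def[abs_def] by (intro smooth_on_divide smooth_on_det2 sS' sE Oo d0; assumption)+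
  have key: "\<exists>\<psi>. rot \<theta> (s x) = rot \<psi> (s' x) \<and> cos \<psi> = a (cmap c x, \<theta>) \<and> sin \<psi> = b (cmap c x, \<theta>)"
    if x: "x \<in> cdom c" "x \<in> cdom c'" for x \<theta>
  proof -
    obtain \<psi> where \<psi>: "rot \<theta> (s x) = rot \<psi> (s' x)"
      by (rule SO_rot_exists[OF rot_SO[OF F.s_SO[OF x(1)]] F'.s_SO[OF x(2)]]) (simp add: F.fst_s F'.fst_s x)
    have "frame1 (rot \<theta> (s x)) \<in> tangent_space A x"
      using SO_frame(1)[OF rot_SO[OF F.s_SO[OF x(1)]]] by (simp add: F.fst_s x)
    from tangent_transition[OF this F.chart F'.chart x]
    have "frame1 (rot \<theta> (s x)) c' = ?E (cmap c x, \<theta>)"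
      by (simp add: frame1_rot F.S1_cmap F.S2_cmap x)
    then show ?thesis
      using rot_cramer[OF F'.s_SO[OF x(2)] F'.chart _ \<psi>] \<psi> x
      by (auto simp: F'.fst_s a_def b_def F'.S1_cmap F'.S2_cmap transition_cmap[OF F.chart x(1), of c'])
  qed
  \<comment> \<open>\<open>a\<close> and \<open>b\<close> make sense over the whole common base
    domain; the condition removes the frames whose angle relative to \<open>s'\<close> is
    \<open>\<alpha>'\<close> modulo \<open>2 * pi\<close>, which \<open>D'\<close> does not
    cover.\<close>
  let ?B = "{z \<in> ?O. 1 - (a z * cos \<alpha>' + b z * sin \<alpha>') \<in> - {0}}"
  have mem: "rot \<theta> (s x) \<in> cdom D' \<longleftrightarrow> x \<in> cdom c' \<and> 1 - (a (cmap c x, \<theta>) * cos \<alpha>' + b (cmap c x, \<theta>) * sin \<alpha>') \<noteq> 0"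
    if x: "x \<in> cdom c" for x \<theta>
  proof (cases "x \<in> cdom c'")
    case True
    then show ?thesis using key[OF x True, of \<theta>] F'.rot_in_frame_chart(1)[OF True] unfolding D'_def by metis
  next
    case False
    then show ?thesis using F'.frame_chart_fst(1)[of "rot \<theta> (s x)" \<alpha>'] x by (auto simp: D'_def F.fst_s)
  qed
  have B: "cmap D ` (cdom D \<inter> cdom D') = ?B"
  proof
    show "cmap D ` (cdom D \<inter> cdom D') \<subseteq> ?B"
    proof (rule image_subsetI)
      fix p assume p: "p \<in> cdom D \<inter> cdom D'"
      then obtain x \<theta> where x: "x \<in> cdom c" "\<alpha> < \<theta>" "\<theta> < \<alpha> + 2 * pi" "p = rot \<theta> (s x)"
          "cmap D p = (cmap c x, \<theta>)" unfolding D_def by (elim IntE F.frame_chartE) auto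
      then show "cmap D p \<in> ?B" using mem[OF x(1), of \<theta>] p by auto
    qed
    show "?B \<subseteq> cmap D ` (cdom D \<inter> cdom D')"
    proof
      fix z assume z: "z \<in> ?B"
      then obtain x \<theta> where x: "x \<in> cdom c" "\<alpha> < \<theta>" "\<theta> < \<alpha> + 2 * pi" "z = (cmap c x, \<theta>)" "x \<in> cdom c'" by auto
      then show "z \<in> cmap D ` (cdom D \<inter> cdom D')"
        using mem[OF x(1), of \<theta>] z F.frame_chart_mem[OF x(1-3)] unfolding D_def
        by (intro image_eqI[of _ _ "rot \<theta> (s x)"]) auto
    qed
  qed
  have Bo: "open ?B"
    by (rule open_preimage_on[OF Oo smooth_on_continuous])
      (intro smooth_on_diff smooth_on_add smooth_on_mult smooth_on_const sa sb Oo, auto)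
  then show "open (cmap D ` (cdom D \<inter> cdom D'))" unfolding B .
  have sub: "?B \<subseteq> ?O" by auto
  have sm: "smooth_on ?B (\<lambda>z. (?\<tau> (fst z), angle_from \<alpha>' (a z) (b z)))"
    by (intro smooth_on_Pair smooth_on_angle_from Bo smooth_on_subset[OF st] smooth_on_subset[OF sa]
        smooth_on_subset[OF sb] sub) auto
  have eq: "(?\<tau> (fst z), angle_from \<alpha>' (a z) (b z)) = transition D D' z" if "z \<in> ?B" for z
  proof -
    obtain x \<theta> where x: "x \<in> cdom c" "\<alpha> < \<theta>" "\<theta> < \<alpha> + 2 * pi" "z = (cmap c x, \<theta>)" "x \<in> cdom c'"
      using \<open>z \<in> ?B\<close> by auto
    have "rot \<theta> (s x) \<in> cdom D'" using mem[OF x(1), of \<theta>] \<open>z \<in> ?B\<close> x by auto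
    moreover have "transition D D' z = cmap D' (rot \<theta> (s x))"
      using inv_into_f_f[OF F.inj_frame_chart F.frame_chart_mem(1)[OF x(1-3)]]
      unfolding transition_def cinv_def D_def comp_apply x(4) F.frame_chart_mem(2)[OF x(1-3)] by simp
    moreover obtain \<psi> where "rot \<theta> (s x) = rot \<psi> (s' x)" "cos \<psi> = a z" "sin \<psi> = b z"
      using key[OF x(1,5)] x(4) by blast
    ultimately show ?thesis
      using F'.rot_in_frame_chart(2)[OF x(5), of \<psi> \<alpha>'] transition_cmap[OF F.chart x(1), of c']
      unfolding D'_def by (simp add: x(4))
  qed
  show "smooth_on (cmap D ` (cdom D \<inter> cdom D')) (transition D D')"
    unfolding B by (rule iffD1[OF smooth_on_cong[OF Bo eq] sm])
qed

lemma smooth_frame_atlas: "smooth_atlas (frame_atlas A g)"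
proof
  fix D assume "D \<in> frame_atlas A g"
  then show "inj_on (cmap D) (cdom D)" using framed_chart.inj_frame_chart by (metis frame_atlasE)
next
  fix D D' assume "D \<in> frame_atlas A g" "D' \<in> frame_atlas A g"
  then show "open (cmap D ` (cdom D \<inter> cdom D'))" "smooth_on (cmap D ` (cdom D \<inter> cdom D')) (transition D D')"
    using frame_chart_overlap by (metis frame_atlasE)+
qed

end

section \<open>The connection form\<close>

lemma has_vector_derivative_locally_constant:
  assumes "(f has_vector_derivative f') (at t)" "\<forall>\<^sub>F s in at t. f s = k" "f t = k"
  shows "f' = 0"
  using has_vector_derivative_transform_eventually_at[OF assms(1,2,3)]
    vector_derivative_unique_at has_vector_derivative_const by blast

context framed_chart
begin

abbreviation U where "U \<equiv> cmap c ` cdom c"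
abbreviation G where "G \<equiv> metric_rep A g c"

sublocale M: local_metric U G by (rule local_metric[OF chart])

text \<open>The Levi-Civita connection form pulled back by the frame field: the component along
  \<open>S2\<close> of the covariant derivative of \<open>S1\<close> in direction
  \<open>u\<close>.\<close>

definition \<omega> :: "real^2 \<Rightarrow> real^2 \<Rightarrow> real" where
  "\<omega> y u = G y (frechet_derivative S1 (at y) u + christoffel_of G y u (S1 y)) (S2 y)"

lemma S_expand:
  assumes y: "y \<in> U" shows "w = G y w (S1 y) *\<^sub>R S1 y + G y w (S2 y) *\<^sub>R S2 y"
proof -
  obtain a b where w: "w = a *\<^sub>R S1 y + b *\<^sub>R S2 y" using det2_cramer[of "S1 y" "S2 y" w] det2_S[OF y] by auto
  have "G y w (S1 y) = a" "G y w (S2 y) = b"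
    unfolding w using orthonormal_S[OF y] M.sym[OF y, of "S2 y" "S1 y"] by (simp_all add: M.simps_left[OF y])
  then show ?thesis using w by simp
qed

text \<open>A constant inner product is differentiated along a line; metric compatibility turns the
  derivative of \<open>G\<close> into Christoffel terms.\<close>

lemma covariant_skew:
  assumes y: "y \<in> U" and S: "smooth_on U P" "smooth_on U Q" and k: "\<And>y. y \<in> U \<Longrightarrow> G y (P y) (Q y) = k"
  shows "G y (frechet_derivative P (at y) u + christoffel_of G y u (P y)) (Q y)
    + G y (P y) (frechet_derivative Q (at y) u + christoffel_of G y u (Q y)) = 0"
proof -
  let ?l = "\<lambda>t::real. y + t *\<^sub>R u"
  have l: "(?l has_vector_derivative u) (at 0)" by (auto intro!: derivative_eq_intros)
  have "((\<lambda>t. G (?l t) (P (?l t)) (Q (?l t))) has_vector_derivative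
      M.dG (?l 0) u (P (?l 0)) (Q (?l 0)) + G (?l 0) (frechet_derivative P (at y) u) (Q (?l 0))
      + G (?l 0) (P (?l 0)) (frechet_derivative Q (at y) u)) (at 0)"
    by (rule M.derivative_along[OF l derivative_on_line derivative_on_line])
      (use smooth_on_differentiable S y in auto)
  moreover have "\<forall>\<^sub>F t in at 0. ?l t \<in> U"
    by (rule has_vector_derivative_eventually_in[OF l M.open_domain]) (use y in simp)
  then have "\<forall>\<^sub>F t in at 0. G (?l t) (P (?l t)) (Q (?l t)) = k" by (rule eventually_mono) (rule k)
  ultimately have "M.dG (?l 0) u (P (?l 0)) (Q (?l 0)) + G (?l 0) (frechet_derivative P (at y) u) (Q (?l 0))
      + G (?l 0) (P (?l 0)) (frechet_derivative Q (at y) u) = 0"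
    by (rule has_vector_derivative_locally_constant) (simp add: k y)
  then show ?thesis
    using M.christoffel_compatible[OF y, of u "P y" "Q y"] by (simp add: M.simps_left[OF y] M.simps_right[OF y])
qed

text \<open>Skewness for a unit vector with itself leaves only the component along the other vector;
  skewness for the pair makes the two remaining components opposite, so one form
  \<open>\<omega>\<close> describes the connection.\<close>

lemma covariant_S:
  assumes y: "y \<in> U"
  shows "frechet_derivative S1 (at y) u + christoffel_of G y u (S1 y) = \<omega> y u *\<^sub>R S2 y" (is "?N1 = _")
    and "frechet_derivative S2 (at y) u + christoffel_of G y u (S2 y) = - \<omega> y u *\<^sub>R S1 y" (is "?N2 = _")
proof -
  have "G y ?N1 (S1 y) = 0"
    using covariant_skew[OF y smooth_S(1) smooth_S(1) orthonormal_S(1), of u] M.sym[OF y, of "S1 y" ?N1] by simp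
  then show "?N1 = \<omega> y u *\<^sub>R S2 y"
    using S_expand[OF y, of ?N1] by (simp add: \<omega>_def)
  have "G y ?N2 (S2 y) = 0"
    using covariant_skew[OF y smooth_S(2) smooth_S(2) orthonormal_S(2), of u] M.sym[OF y, of "S2 y" ?N2] by simp
  moreover have "G y ?N2 (S1 y) = - \<omega> y u"
    using covariant_skew[OF y smooth_S orthonormal_S(3), of u] M.sym[OF y, of "S1 y" ?N2] by (simp add: \<omega>_def)
  ultimately show "?N2 = - \<omega> y u *\<^sub>R S1 y"
    using S_expand[OF y, of ?N2] by simp
qed

lemma smooth_S_along:
  fixes y :: "'b::euclidean_space \<Rightarrow> real^2"
  assumes "open X" "smooth_on X y" "y ` X \<subseteq> U"
  shows "smooth_on X (\<lambda>x. S1 (y x))" "smooth_on X (\<lambda>x. S2 (y x))"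
  by (rule smooth_on_compose[OF smooth_S(1) assms(2,1) M.open_domain assms(3)])
    (rule smooth_on_compose[OF smooth_S(2) assms(2,1) M.open_domain assms(3)])

text \<open>\<open>christoffel_of\<close> is a definite description, so its smoothness is read off
  from its components in the orthonormal frame, which are Koszul expressions.\<close>

lemma christoffel_smooth_along:
  fixes y :: "'b::euclidean_space \<Rightarrow> real^2"
  assumes "open X" "smooth_on X y" "smooth_on X u" "smooth_on X v" "y ` X \<subseteq> U"
  shows "smooth_on X (\<lambda>x. christoffel_of G (y x) (u x) (v x))"
proof -
  have sm: "smooth_on X (\<lambda>x. koszul G (y x) (u x) (v x) (S1 (y x)) *\<^sub>R S1 (y x)
      + koszul G (y x) (u x) (v x) (S2 (y x)) *\<^sub>R S2 (y x))"
    by (intro smooth_on_add smooth_on_scaleR M.koszul_smooth_along smooth_S_along assms)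
  have eq: "christoffel_of G (y x) (u x) (v x) = koszul G (y x) (u x) (v x) (S1 (y x)) *\<^sub>R S1 (y x)
      + koszul G (y x) (u x) (v x) (S2 (y x)) *\<^sub>R S2 (y x)" if "x \<in> X" for x
  proof -
    have "y x \<in> U" using that assms(5) by blast
    then show ?thesis
      using S_expand[of "y x" "christoffel_of G (y x) (u x) (v x)"] by (simp only: M.christoffel_koszul)
  qed
  show ?thesis by (rule iffD2[OF smooth_on_cong[OF assms(1) eq] sm])
qed

lemma \<omega>_smooth_along:
  fixes y :: "'b::euclidean_space \<Rightarrow> real^2"
  assumes "open X" "smooth_on X y" "smooth_on X u" "y ` X \<subseteq> U"
  shows "smooth_on X (\<lambda>x. \<omega> (y x) (u x))"
  unfolding \<omega>_def
  by (intro M.smooth_along smooth_on_add christoffel_smooth_along smooth_S_along assms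
      smooth_on_derivative_along[OF smooth_S(1) M.open_domain])

text \<open>Provides the continuity of \<open>K\<close> along a curve, on which the argument at the
  zero set rests.\<close>

lemma smooth_gauss_rep: "smooth_on U (gauss_rep A g c)"
proof -
  let ?u = "axis 1 1 :: real^2" and ?v = "axis 2 1 :: real^2"
  note chr = christoffel_smooth_along[OF M.open_domain smooth_on_ident[OF M.open_domain]]
  have sR: "smooth_on U (\<lambda>y. riemann_rep A g c y u v w)" for u v w
    unfolding riemann_rep_def christoffel_eq
    by (intro smooth_on_add smooth_on_diff smooth_on_derivative chr smooth_on_const M.open_domain; simp)
  have det: "G y ?u ?u * G y ?v ?v - (G y ?u ?v)\<^sup>2 \<noteq> 0" if y: "y \<in> U" for y
  proof -
    \<comment> \<open>\<open>G y ?v ?v\<close> times the part of \<open>?u\<close> orthogonal to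
      \<open>?v\<close>; hence \<open>G y w w\<close> is the Gram determinant up to a positive
      factor.\<close>
    define w where "w = G y ?v ?v *\<^sub>R ?u - G y ?u ?v *\<^sub>R ?v"
    have v: "G y ?v ?v > 0" using M.pos[OF y, of ?v] by (simp add: axis_eq_0_iff)
    have "w $ 1 = G y ?v ?v" by (simp add: w_def axis_def)
    then have "w \<noteq> 0" using v by (metis less_irrefl zero_index)
    then have "G y w w > 0" by (rule M.pos[OF y])
    moreover have "G y w w = G y ?v ?v * (G y ?u ?u * G y ?v ?v - (G y ?u ?v)\<^sup>2)"
      unfolding w_def using M.sym[OF y, of ?v ?u]
      by (simp add: M.simps_left[OF y] M.simps_right[OF y] power2_eq_square algebra_simps)
    ultimately show ?thesis by (metis less_irrefl mult_zero_right)
  qed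
  show ?thesis
    unfolding gauss_rep_def[abs_def] Let_def power2_eq_square
    by (intro smooth_on_divide smooth_on_diff smooth_on_mult M.smooth_along smooth_on_ident sR smooth_on_const
        M.open_domain det[unfolded power2_eq_square]; simp)
qed

text \<open>In the terms \<open>cos \<theta> S1 + sin \<theta> S2\<close> the turning of the angle
  adds to the turning of the frame field given by \<open>covariant_S\<close>. Thus both frame
  vectors rotate at the same rate \<open>\<theta>' + \<omega> y y'\<close>, the quantity
  \<open>\<mu>\<close> of the overview.\<close>

lemma frame_curve_covariant:
  assumes I: "open I" "t \<in> I" "\<gamma> ` I \<subseteq> cdom (frame_chart c s \<alpha>)"
    and z: "((cmap (frame_chart c s \<alpha>) \<circ> \<gamma>) has_vector_derivative (y', \<theta>')) (at t)"
  defines "y \<equiv> cmap c (fst (\<gamma> t))"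
  shows "((\<lambda>r. cmap c (fst (\<gamma> r))) has_vector_derivative y') (at t)"
    "(\<lambda>r. frame1 (\<gamma> r) c) differentiable (at t)" "(\<lambda>r. frame2 (\<gamma> r) c) differentiable (at t)"
    "cov_deriv A g (fst \<circ> \<gamma>) (\<lambda>r. frame1 (\<gamma> r)) t c = (\<theta>' + \<omega> y y') *\<^sub>R frame2 (\<gamma> t) c"
    "cov_deriv A g (fst \<circ> \<gamma>) (\<lambda>r. frame2 (\<gamma> r)) t c = - (\<theta>' + \<omega> y y') *\<^sub>R frame1 (\<gamma> t) c"
proof -
  let ?D = "frame_chart c s \<alpha>"
  let ?z = "cmap ?D \<circ> \<gamma>"
  let ?y = "\<lambda>r. fst (?z r)" and ?\<theta> = "\<lambda>r. snd (?z r)"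
  have coords: "fst (\<gamma> r) \<in> cdom c" "cmap c (fst (\<gamma> r)) = ?y r"
    "frame1 (\<gamma> r) c = cos (?\<theta> r) *\<^sub>R S1 (?y r) + sin (?\<theta> r) *\<^sub>R S2 (?y r)"
    "frame2 (\<gamma> r) c = - sin (?\<theta> r) *\<^sub>R S1 (?y r) + cos (?\<theta> r) *\<^sub>R S2 (?y r)" if "r \<in> I" for r
  proof -
    have "\<gamma> r \<in> cdom ?D" using I(3) that by blast
    then obtain x \<theta> where x: "x \<in> cdom c" "\<gamma> r = rot \<theta> (s x)" "fst (\<gamma> r) = x" "cmap ?D (\<gamma> r) = (cmap c x, \<theta>)"
      by (rule frame_chartE)
    then show "fst (\<gamma> r) \<in> cdom c" "cmap c (fst (\<gamma> r)) = ?y r" by simp_all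
    show "frame1 (\<gamma> r) c = cos (?\<theta> r) *\<^sub>R S1 (?y r) + sin (?\<theta> r) *\<^sub>R S2 (?y r)"
      "frame2 (\<gamma> r) c = - sin (?\<theta> r) *\<^sub>R S1 (?y r) + cos (?\<theta> r) *\<^sub>R S2 (?y r)"
      using x(1,4) unfolding x(2) comp_apply by (simp_all add: frame1_rot frame2_rot S1_cmap S2_cmap)
  qed
  have yt: "?y t = y" "y \<in> U"
    unfolding y_def by (rule coords(2)[OF I(2), symmetric]) (rule imageI[OF coords(1)[OF I(2)]])
  have dy: "(?y has_vector_derivative y') (at t)"
    using bounded_linear.has_vector_derivative[OF bounded_linear_fst z] by simp
  have d\<theta>: "(?\<theta> has_vector_derivative \<theta>') (at t)"
    using bounded_linear.has_vector_derivative[OF bounded_linear_snd z] by simp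
  show dy': "((\<lambda>r. cmap c (fst (\<gamma> r))) has_vector_derivative y') (at t)"
    by (rule has_vector_derivative_transform_within_open[OF dy I(1,2)]) (simp add: coords)
  have cs: "((\<lambda>r. cos (?\<theta> r)) has_real_derivative - sin (?\<theta> t) * \<theta>') (at t)"
    "((\<lambda>r. sin (?\<theta> r)) has_real_derivative cos (?\<theta> t) * \<theta>') (at t)"
    using d\<theta> by (auto simp flip: has_real_derivative_iff_has_vector_derivative intro!: derivative_eq_intros)
  note dS = derivative_along_curve[OF smooth_on_differentiable[OF smooth_S(1)] dy, unfolded yt(1), OF yt(2)]
    derivative_along_curve[OF smooth_on_differentiable[OF smooth_S(2)] dy, unfolded yt(1), OF yt(2)]
  have dE1: "((\<lambda>r. frame1 (\<gamma> r) c) has_vector_derivative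
      (cos (?\<theta> t) *\<^sub>R frechet_derivative S1 (at y) y' + (- sin (?\<theta> t) * \<theta>') *\<^sub>R S1 (?y t))
      + (sin (?\<theta> t) *\<^sub>R frechet_derivative S2 (at y) y' + (cos (?\<theta> t) * \<theta>') *\<^sub>R S2 (?y t))) (at t)" (is "(_ has_vector_derivative ?E1) _")
    by (rule has_vector_derivative_transform_within_open[OF _ I(1,2)],
        rule has_vector_derivative_add[OF has_vector_derivative_scaleR[OF cs(1) dS(1)] has_vector_derivative_scaleR[OF cs(2) dS(2)]])
      (simp add: coords)
  have dE2: "((\<lambda>r. frame2 (\<gamma> r) c) has_vector_derivative
      (- sin (?\<theta> t) *\<^sub>R frechet_derivative S1 (at y) y' + (- (cos (?\<theta> t) * \<theta>')) *\<^sub>R S1 (?y t))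
      + (cos (?\<theta> t) *\<^sub>R frechet_derivative S2 (at y) y' + (- sin (?\<theta> t) * \<theta>') *\<^sub>R S2 (?y t))) (at t)" (is "(_ has_vector_derivative ?E2) _")
    by (rule has_vector_derivative_transform_within_open[OF _ I(1,2)],
        rule has_vector_derivative_add[OF has_vector_derivative_scaleR[OF DERIV_minus[OF cs(2)] dS(1)] has_vector_derivative_scaleR[OF cs(1) dS(2)]])
      (simp add: coords)
  show "(\<lambda>r. frame1 (\<gamma> r) c) differentiable (at t)" "(\<lambda>r. frame2 (\<gamma> r) c) differentiable (at t)"
    using dE1 dE2 differentiableI_vector by blast+
  have cov: "cov_deriv A g (fst \<circ> \<gamma>) E t c = E' + christoffel_of G y y' (E t c)"
    if "((\<lambda>r. E r c) has_vector_derivative E') (at t)" for E E'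
    using vector_derivative_at[OF that] vector_derivative_at[OF dy'] chart coords(1)[OF I(2)]
    by (simp add: cov_deriv_def velocity_def comp_def christoffel_eq y_def)
  have \<Gamma>: "christoffel_of G y y' (a *\<^sub>R v + b *\<^sub>R w) = a *\<^sub>R christoffel_of G y y' v + b *\<^sub>R christoffel_of G y y' w" for a b v w
    using M.christoffel_linear(2)[OF yt(2)] by (simp add: linear_add linear_scale)
  have N: "christoffel_of G y y' (S1 y) = \<omega> y y' *\<^sub>R S2 y - frechet_derivative S1 (at y) y'"
    "christoffel_of G y y' (S2 y) = - \<omega> y y' *\<^sub>R S1 y - frechet_derivative S2 (at y) y'"
    using covariant_S[OF yt(2), of y'] by (simp_all add: algebra_simps)
  show "cov_deriv A g (fst \<circ> \<gamma>) (\<lambda>r. frame1 (\<gamma> r)) t c = (\<theta>' + \<omega> y y') *\<^sub>R frame2 (\<gamma> t) c"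
    unfolding cov[of "\<lambda>r. frame1 (\<gamma> r)", OF dE1] unfolding coords[OF I(2)] yt(1) \<Gamma> N by (simp add: algebra_simps)
  show "cov_deriv A g (fst \<circ> \<gamma>) (\<lambda>r. frame2 (\<gamma> r)) t c = - (\<theta>' + \<omega> y y') *\<^sub>R frame1 (\<gamma> t) c"
    unfolding cov[of "\<lambda>r. frame2 (\<gamma> r)", OF dE2] unfolding coords[OF I(2)] yt(1) \<Gamma> N by (simp add: algebra_simps)
qed

text \<open>The criterion for horizontality used from here on: the rate of rotation vanishes at the
  single time \<open>t\<close>, and \<open>cov_deriv_zeroI\<close> carries this from the chart
  \<open>c\<close> to all charts.\<close>

lemma frame_curve_parallel:
  assumes I: "open I" "t \<in> I" "\<gamma> ` I \<subseteq> cdom (frame_chart c s \<alpha>)"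
    and sm: "smooth_on I (cmap (frame_chart c s \<alpha>) \<circ> \<gamma>)"
    and z: "((cmap (frame_chart c s \<alpha>) \<circ> \<gamma>) has_vector_derivative (y', \<theta>')) (at t)"
    and zero: "\<theta>' + \<omega> (cmap c (fst (\<gamma> t))) y' = 0"
  shows "cov_deriv A g (fst \<circ> \<gamma>) (\<lambda>r. frame1 (\<gamma> r)) t = (\<lambda>_. 0)"
    and "cov_deriv A g (fst \<circ> \<gamma>) (\<lambda>r. frame2 (\<gamma> r)) t = (\<lambda>_. 0)"
proof -
  note cv = frame_curve_covariant[OF I z]
  have fst: "(fst \<circ> \<gamma>) ` I \<subseteq> cdom c"
    using I(3) frame_chart_fst(1)[of _ \<alpha>] by (simp add: image_subset_iff)
  have eq: "fst ((cmap (frame_chart c s \<alpha>) \<circ> \<gamma>) r) = (cmap c \<circ> (fst \<circ> \<gamma>)) r" if "r \<in> I" for r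
    using I(3) frame_chart_fst(2)[of "\<gamma> r" \<alpha>] that by auto
  have smy: "smooth_on I (cmap c \<circ> (fst \<circ> \<gamma>))"
    by (rule iffD1[OF smooth_on_cong[OF I(1) eq] smooth_on_linear_compose[OF bounded_linear_fst sm I(1)]])
  have tan: "frame1 (\<gamma> r) \<in> tangent_space A ((fst \<circ> \<gamma>) r)" "frame2 (\<gamma> r) \<in> tangent_space A ((fst \<circ> \<gamma>) r)"
    if "r \<in> I" for r
  proof -
    have "\<gamma> r \<in> SO A g" using frame_chart_fst(3) I(3) that by blast
    then show "frame1 (\<gamma> r) \<in> tangent_space A ((fst \<circ> \<gamma>) r)" "frame2 (\<gamma> r) \<in> tangent_space A ((fst \<circ> \<gamma>) r)"
      using SO_frame(1,2) by simp_all
  qed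
  show "cov_deriv A g (fst \<circ> \<gamma>) (\<lambda>r. frame1 (\<gamma> r)) t = (\<lambda>_. 0)"
    by (rule cov_deriv_zeroI[OF chart I(1,2) fst smy tan(1) cv(2)]) (simp_all only: cv(4) zero scaleR_zero_left)
  show "cov_deriv A g (fst \<circ> \<gamma>) (\<lambda>r. frame2 (\<gamma> r)) t = (\<lambda>_. 0)"
    by (rule cov_deriv_zeroI[OF chart I(1,2) fst smy tan(2) cv(3)])
      (simp_all only: cv(5) zero minus_zero scaleR_zero_left)
qed

end

section \<open>The Wagner lift\<close>

context riemannian_surface
begin

sublocale F: smooth_atlas "frame_atlas A g" by (rule smooth_frame_atlas)

end

section \<open>Horizontal and vertical vectors in bundle coordinates\<close>

context framed_chart
begin

lemma frame_chart_in_atlas: "frame_chart c s \<alpha> \<in> frame_atlas A g"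
  unfolding frame_atlas_def using chart frame_field by blast

text \<open>The witness is the straight coordinate line in this direction: its rate of rotation
  vanishes at time 0, and \<open>horizontal\<close> demands nothing at other times.\<close>

lemma horizontal_coord:
  assumes p: "p \<in> cdom (frame_chart c s \<alpha>)"
  shows "coord_tvec (frame_atlas A g) (frame_chart c s \<alpha>) p (u, - \<omega> (cmap c (fst p)) u) \<in> horizontal A g p"
proof -
  let ?D = "frame_chart c s \<alpha>" and ?w = "(u, - \<omega> (cmap c (fst p)) u)"
  define \<sigma> where "\<sigma> t = cinv ?D (cmap ?D p + t *\<^sub>R ?w)" for t
  obtain e where e: "e > 0" "\<And>t. t \<in> {-e<..<e} \<Longrightarrow> \<sigma> t \<in> cdom ?D \<and> cmap ?D (\<sigma> t) = cmap ?D p + t *\<^sub>R ?w"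
    "smooth_curve (frame_atlas A g) {-e<..<e} \<sigma>" "\<sigma> 0 = p"
    "velocity (frame_atlas A g) \<sigma> 0 = coord_tvec (frame_atlas A g) ?D p ?w"
    unfolding \<sigma>_def[abs_def] using F.coordinate_line[OF frame_chart_in_atlas p, where w = ?w] by blast
  have z: "((cmap ?D \<circ> \<sigma>) has_vector_derivative ?w) (at 0)"
    by (rule has_vector_derivative_transform_within_open[where S = "{-e<..<e}"
          and f = "\<lambda>t. cmap ?D p + t *\<^sub>R ?w"])
      (use e(1,2) in \<open>auto intro!: derivative_eq_intros\<close>)
  have eq: "cmap ?D p + t *\<^sub>R ?w = (cmap ?D \<circ> \<sigma>) t" if "t \<in> {-e<..<e}" for t
    using e(2)[OF that] by simp
  have lin: "smooth_on {-e<..<e} (\<lambda>t. cmap ?D p + t *\<^sub>R ?w)"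
    by (intro smooth_on_add smooth_on_const smooth_on_scaleR smooth_on_ident open_greaterThanLessThan)
  have sm: "smooth_on {-e<..<e} (cmap ?D \<circ> \<sigma>)"
    by (rule iffD1[OF smooth_on_cong[OF _ eq] lin]) simp_all
  have sub: "\<sigma> ` {-e<..<e} \<subseteq> cdom ?D" using e(2) by blast
  note par = frame_curve_parallel[OF open_greaterThanLessThan _ sub sm z]
  have "cov_deriv A g (fst \<circ> \<sigma>) (\<lambda>t. frame1 (\<sigma> t)) 0 = (\<lambda>_. 0)"
    "cov_deriv A g (fst \<circ> \<sigma>) (\<lambda>t. frame2 (\<sigma> t)) 0 = (\<lambda>_. 0)"
    by (rule par(1) par(2); use e in simp)+
  then show ?thesis
    unfolding horizontal_def using e by (intro CollectI exI[of _ \<sigma>] exI[of _ e]) simp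
qed

text \<open>Rotations act as translations of the angle coordinate, so the orbit is a coordinate line
  as long as it stays in the chart.\<close>

lemma d_phi_coord:
  assumes p: "p \<in> cdom (frame_chart c s \<alpha>)"
  shows "d_phi A g p = coord_tvec (frame_atlas A g) (frame_chart c s \<alpha>) p (0, 1)"
    and "d_phi A g p \<in> vertical A g p"
proof -
  let ?D = "frame_chart c s \<alpha>"
  obtain x \<theta> where x: "x \<in> cdom c" "\<alpha> < \<theta>" "\<theta> < \<alpha> + 2 * pi" "p = rot \<theta> (s x)" "fst p = x"
    "cmap ?D p = (cmap c x, \<theta>)" using p by (rule frame_chartE)
  \<comment> \<open>The distance from \<open>\<theta>\<close> to the ends of the angle interval of
    the chart.\<close>
  define e where "e = min (\<theta> - \<alpha>) (\<alpha> + 2 * pi - \<theta>)"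
  have e: "e > 0" using x by (auto simp: e_def)
  let ?I = "{-e<..<e}" and ?\<sigma> = "\<lambda>t. rot t p"
  have \<sigma>: "?\<sigma> t \<in> cdom ?D" "cmap ?D p + t *\<^sub>R (0, 1) = (cmap ?D \<circ> ?\<sigma>) t" if "t \<in> ?I" for t
  proof -
    have "?\<sigma> t = rot (t + \<theta>) (s x)" by (simp add: x(4) rot_rot)
    moreover have "\<alpha> < t + \<theta>" "t + \<theta> < \<alpha> + 2 * pi" using that by (auto simp: e_def)
    ultimately show "?\<sigma> t \<in> cdom ?D" "cmap ?D p + t *\<^sub>R (0, 1) = (cmap ?D \<circ> ?\<sigma>) t"
      using frame_chart_mem[OF x(1), of \<alpha> "t + \<theta>"] x(6) by (simp_all add: add.commute)
  qed
  have lin: "smooth_on ?I (\<lambda>t. cmap ?D p + t *\<^sub>R (0, 1))"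
    by (intro smooth_on_add smooth_on_const smooth_on_scaleR smooth_on_ident open_greaterThanLessThan)
  have sm: "smooth_on ?I (cmap ?D \<circ> ?\<sigma>)"
    by (rule iffD1[OF smooth_on_cong[OF _ \<sigma>(2)] lin]) simp_all
  have sub: "?\<sigma> ` ?I \<subseteq> cdom ?D" using \<sigma>(1) by blast
  have "((cmap ?D \<circ> ?\<sigma>) has_vector_derivative (0, 1)) (at 0)"
    by (rule has_vector_derivative_transform_within_open[where S = ?I
          and f = "\<lambda>t. cmap ?D p + t *\<^sub>R (0, 1)"])
      (use e \<sigma>(2) in \<open>auto intro!: derivative_eq_intros\<close>)
  moreover have p0: "?\<sigma> 0 = p" by (simp add: x(4) rot_rot)
  ultimately show "d_phi A g p = coord_tvec (frame_atlas A g) ?D p (0, 1)"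
    unfolding d_phi_def
    using F.velocity_eq_coord_tvec[OF frame_chart_in_atlas open_greaterThanLessThan sub sm, of 0] e
    by (simp add: vector_derivative_at)
  have "p \<in> SO A g" by (rule frame_chart_fst(3)[OF p])
  then have "?\<sigma> ` ?I \<subseteq> {q \<in> SO A g. fst q = fst p}" by (auto simp: rot_SO)
  moreover have "smooth_curve (frame_atlas A g) ?I ?\<sigma>"
    by (rule F.smooth_curve_single_chart[OF frame_chart_in_atlas open_greaterThanLessThan sub sm])
  ultimately show "d_phi A g p \<in> vertical A g p"
    unfolding d_phi_def vertical_def tangent_to_def
    using e p0 by (intro CollectI exI[of _ ?\<sigma>] exI[of _ e]) simp
qed

text \<open>Transition maps of the bundle cover those of the base: the base component of the new
  coordinates does not depend on the angle.\<close>

lemma frame_transition_base: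
  assumes F': "framed_chart A g c' s'" and p: "p \<in> cdom (frame_chart c s \<alpha>)" "p \<in> cdom (frame_chart c' s' \<alpha>')"
  shows "fst (frechet_derivative (transition (frame_chart c s \<alpha>) (frame_chart c' s' \<alpha>')) (at (cmap (frame_chart c s \<alpha>) p)) w)
    = frechet_derivative (transition c c') (at (cmap c (fst p))) (fst w)"
proof -
  interpret F': framed_chart A g c' s' by fact
  let ?D = "frame_chart c s \<alpha>" and ?D' = "frame_chart c' s' \<alpha>'"
  let ?S = "cmap ?D ` (cdom ?D \<inter> cdom ?D')"
  have fp: "fst p \<in> cdom c" "fst p \<in> cdom c'" "fst (cmap ?D p) = cmap c (fst p)"
    using frame_chart_fst[OF p(1)] F'.frame_chart_fst[OF p(2)] by auto
  have "((\<lambda>z. fst (transition ?D ?D' z)) has_derivative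
      (\<lambda>w. fst (frechet_derivative (transition ?D ?D') (at (cmap ?D p)) w))) (at (cmap ?D p))"
    by (intro has_derivative_fst F.transition_has_derivative frame_chart_in_atlas F'.frame_chart_in_atlas p)
  then have d1: "frechet_derivative (\<lambda>z. fst (transition ?D ?D' z)) (at (cmap ?D p))
      = (\<lambda>w. fst (frechet_derivative (transition ?D ?D') (at (cmap ?D p)) w))"
    by (rule frechet_derivativeI)
  have "((\<lambda>z. transition c c' (fst z)) has_derivative
      (\<lambda>w. frechet_derivative (transition c c') (at (cmap c (fst p))) (fst w))) (at (cmap ?D p))"
    by (rule has_derivative_compose[OF has_derivative_fst[OF has_derivative_ident]])
      (use transition_has_derivative[OF chart F'.chart fp(1,2)] fp(3) in simp)
  then have d2: "frechet_derivative (\<lambda>z. transition c c' (fst z)) (at (cmap ?D p))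
      = (\<lambda>w. frechet_derivative (transition c c') (at (cmap c (fst p))) (fst w))"
    by (rule frechet_derivativeI)
  have "frechet_derivative (\<lambda>z. fst (transition ?D ?D' z)) (at (cmap ?D p))
      = frechet_derivative (\<lambda>z. transition c c' (fst z)) (at (cmap ?D p))"
  proof (rule frechet_derivative_cong_open)
    show "open ?S" by (rule F.open_overlap[OF frame_chart_in_atlas F'.frame_chart_in_atlas])
    show "cmap ?D p \<in> ?S" using p by blast
    fix z assume "z \<in> ?S"
    then obtain q where q: "q \<in> cdom ?D" "q \<in> cdom ?D'" "z = cmap ?D q" by blast
    then show "fst (transition ?D ?D' z) = transition c c' (fst z)"
      using frame_chart_fst[OF q(1)] F'.frame_chart_fst[OF q(2)]
      by (simp add: F.transition_cmap[OF frame_chart_in_atlas q(1), of ?D'] transition_cmap[OF chart, of _ c'])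
  qed
  then show ?thesis unfolding d1 d2 by (rule fun_cong)
qed

text \<open>\<open>differential\<close> works in a chart \<open>D1\<close> picked by choice,
  possibly over another base chart and frame field; \<open>frame_transition_base\<close> transfers
  the result to the given chart.\<close>

lemma dproj_coord:
  assumes p: "p \<in> cdom (frame_chart c s \<alpha>)" and X: "X \<in> tangent_space (frame_atlas A g) p"
  shows "dproj A g p X = coord_tvec A c (fst p) (fst (X (frame_chart c s \<alpha>)))"
proof -
  let ?D = "frame_chart c s \<alpha>"
  define D1 where "D1 = (SOME d. d \<in> frame_atlas A g \<and> p \<in> cdom d)"
  have "D1 \<in> frame_atlas A g \<and> p \<in> cdom D1"
    unfolding D1_def by (rule someI[of _ ?D]) (use frame_chart_in_atlas p in blast)
  then obtain c1 s1 \<alpha>1 where D1: "D1 = frame_chart c1 s1 \<alpha>1" "framed_chart A g c1 s1" and p1: "p \<in> cdom D1"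
    by (metis frame_atlasE)
  interpret F1: framed_chart A g c1 s1 by fact
  note p1' = p1[unfolded D1(1)]
  have inA: "D1 \<in> frame_atlas A g" unfolding D1(1) by (rule F1.frame_chart_in_atlas)
  have fp: "fst p \<in> cdom c1" "fst (cmap D1 p) = cmap c1 (fst p)" "fst p \<in> cdom c"
    using F1.frame_chart_fst[OF p1'] frame_chart_fst[OF p] by (simp_all add: D1(1))
  have der: "frechet_derivative (cmap d \<circ> fst \<circ> cinv D1) (at (cmap D1 p)) w
      = frechet_derivative (transition c1 d) (at (cmap c1 (fst p))) (fst w)"
    if d: "d \<in> A" "fst p \<in> cdom d" for d w
  proof -
    have "((\<lambda>z. transition c1 d (fst z)) has_derivative
        (\<lambda>w. frechet_derivative (transition c1 d) (at (cmap c1 (fst p))) (fst w))) (at (cmap D1 p))"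
      by (rule has_derivative_compose[OF has_derivative_fst[OF has_derivative_ident]])
        (use transition_has_derivative[OF F1.chart d(1) fp(1) d(2)] fp(2) in simp)
    then have "frechet_derivative (\<lambda>z. transition c1 d (fst z)) (at (cmap D1 p))
        = (\<lambda>w. frechet_derivative (transition c1 d) (at (cmap c1 (fst p))) (fst w))"
      by (rule frechet_derivativeI)
    moreover have "frechet_derivative (cmap d \<circ> fst \<circ> cinv D1) (at (cmap D1 p))
        = frechet_derivative (\<lambda>z. transition c1 d (fst z)) (at (cmap D1 p))"
    proof (rule frechet_derivative_cong_open[OF F.open_image[OF inA]])
      show "cmap D1 p \<in> cmap D1 ` cdom D1" using p1 by blast
      fix z assume "z \<in> cmap D1 ` cdom D1"
      then obtain q where q: "q \<in> cdom D1" "z = cmap D1 q" by blast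
      then have "fst q \<in> cdom c1" "fst z = cmap c1 (fst q)"
        using F1.frame_chart_fst[of q \<alpha>1] by (simp_all add: D1(1))
      then show "(cmap d \<circ> fst \<circ> cinv D1) z = transition c1 d (fst z)"
        using transition_cmap[OF F1.chart, of "fst q" d] F.cinv_cmap[OF inA q(1)] q(2) by simp
    qed
    ultimately show ?thesis by simp
  qed
  have "dproj A g p X = coord_tvec A c1 (fst p) (fst (X D1))"
    unfolding dproj_def differential_def Let_def D1_def[symmetric] coord_tvec_def
    by (rule ext) (simp add: der)
  also have "\<dots> = coord_tvec A c (fst p) (fst (X ?D))"
  proof (rule tangent_eqI[OF chart fp(3)])
    show "coord_tvec A c1 (fst p) (fst (X D1)) c = coord_tvec A c (fst p) (fst (X ?D)) c"
      using F.tangent_transition[OF X inA frame_chart_in_atlas p1 p]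
        F1.frame_transition_base[OF framed_chart_axioms p1' p, of "X D1"]
      by (simp only: coord_tvec_self[OF chart fp(3)] coord_tvec_apply[OF chart fp(3), of c1] D1(1))
  qed (intro coord_tvec_tangent chart F1.chart fp)+
  finally show ?thesis .
qed

end

section \<open>The lifted metric and its first integral\<close>

locale wagner_chart = framed_chart A g c s
  for A :: "('a, real^2) chart set" and g :: "('a, real^2) metric" and c s +
  fixes K :: "'a \<Rightarrow> real" and gh :: "('a frame, (real^2) \<times> real) metric"
  assumes wagner: "wagner_lift A g K gh"
    and open_nonzero: "open (cmap c ` (cdom c - zero_set A K))"
begin

abbreviation W where "W \<equiv> SO A g - zero_set_lift A g K"

abbreviation Gh where "Gh \<alpha> \<equiv> metric_rep (frame_atlas A g) gh (frame_chart c s \<alpha>)"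

lemma chart_inter_W:
  "cdom (frame_chart c s \<alpha>) \<inter> W = cdom (frame_chart c s \<alpha>) \<inter> {p. fst p \<in> - zero_set A K}"
  using frame_chart_fst(3)[of _ \<alpha>] unfolding zero_set_lift_def by blast

lemma image_W: "cmap (frame_chart c s \<alpha>) ` (cdom (frame_chart c s \<alpha>) \<inter> W)
    = cmap c ` (cdom c - zero_set A K) \<times> {\<alpha><..<\<alpha> + 2 * pi}"
  unfolding chart_inter_W image_frame_chart by (simp add: Diff_eq)

lemma local_metric_lift:
  "local_metric (cmap (frame_chart c s \<alpha>) ` (cdom (frame_chart c s \<alpha>) \<inter> W)) (Gh \<alpha>)"
  by (rule F.local_metric_rep[OF _ frame_chart_in_atlas])
    (use wagner in \<open>auto simp: wagner_lift_def image_W intro!: open_Times open_nonzero\<close>)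

text \<open>Every vector splits as \<open>(u, \<tau>) = (u, - \<omega> y u) + (\<tau> + \<omega> y
  u) *\<^sub>R (0, 1)\<close> into a horizontal lift and a multiple of \<open>d_phi\<close>, on
  which the defining conditions of the lift can be evaluated. The second claim identifies the
  momentum: the inner product of a vector with \<open>d_phi\<close>.\<close>

lemma lift_metric_rep:
  assumes p: "p \<in> cdom (frame_chart c s \<alpha>)" "p \<in> W"
  defines "y \<equiv> cmap c (fst p)"
  shows "Gh \<alpha> (cmap (frame_chart c s \<alpha>) p) (u, \<tau>) (u', \<tau>')
      = G y u u' + (\<tau> + \<omega> y u) * (\<tau>' + \<omega> y u') / (K (fst p))\<^sup>2"
    and "Gh \<alpha> (cmap (frame_chart c s \<alpha>) p) (u, \<tau>) (0, 1) = (\<tau> + \<omega> y u) / (K (fst p))\<^sup>2"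
proof -
  let ?D = "frame_chart c s \<alpha>" and ?FA = "frame_atlas A g"
  let ?m = "Gh \<alpha> (cmap ?D p)"
  interpret L: local_metric "cmap ?D ` (cdom ?D \<inter> W)" "Gh \<alpha>" by (rule local_metric_lift)
  have z: "cmap ?D p \<in> cmap ?D ` (cdom ?D \<inter> W)" using p by blast
  have fp: "fst p \<in> cdom c" using frame_chart_fst(1)[OF p(1)] .
  have m: "?m w w' = gh p (coord_tvec ?FA ?D p w) (coord_tvec ?FA ?D p w')" for w w'
    by (simp add: metric_rep_def F.cinv_cmap[OF frame_chart_in_atlas p(1)])
  have w: "\<forall>X\<in>horizontal A g p. \<forall>Y\<in>horizontal A g p. gh p X Y = g (fst p) (dproj A g p X) (dproj A g p Y)"
    "\<forall>X\<in>horizontal A g p. \<forall>Y\<in>vertical A g p. gh p X Y = 0"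
    "gh p (d_phi A g p) (d_phi A g p) = 1 / (K (fst p))\<^sup>2"
    using wagner p(2) unfolding wagner_lift_def by blast+
  let ?H = "\<lambda>u. (u, - \<omega> y u)"
  have hor: "coord_tvec ?FA ?D p (?H u) \<in> horizontal A g p" for u
    unfolding y_def by (rule horizontal_coord[OF p(1)])
  have dp: "dproj A g p (coord_tvec ?FA ?D p (?H u)) = coord_tvec A c (fst p) u" for u
    by (simp add: dproj_coord[OF p(1) F.coord_tvec_tangent[OF frame_chart_in_atlas p(1)]]
        F.coord_tvec_self[OF frame_chart_in_atlas p(1)])
  have HH: "?m (?H u) (?H u') = G y u u'" for u u'
    unfolding m using w(1) hor by (simp add: dp metric_rep_def) (simp add: y_def cinv_cmap[OF chart fp])
  have HV: "?m (?H u) (0, 1) = 0" for u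
    using w(2) hor d_phi_coord[OF p(1)] unfolding m by metis
  then have VH: "?m (0, 1) (?H u) = 0" for u using L.sym[OF z] by metis
  have VV: "?m (0, 1) (0, 1) = 1 / (K (fst p))\<^sup>2"
    using w(3) d_phi_coord(1)[OF p(1)] unfolding m by metis
  have dec: "(u, \<tau>) = ?H u + (\<tau> + \<omega> y u) *\<^sub>R (0, 1)" for u \<tau> by simp
  show "?m (u, \<tau>) (u', \<tau>') = G y u u' + (\<tau> + \<omega> y u) * (\<tau>' + \<omega> y u') / (K (fst p))\<^sup>2"
    unfolding dec[of u \<tau>] dec[of u' \<tau>'] L.simps_left[OF z] L.simps_right[OF z] HH HV VH VV by simp
  show "?m (u, \<tau>) (0, 1) = (\<tau> + \<omega> y u) / (K (fst p))\<^sup>2"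
    unfolding dec[of u \<tau>] L.simps_left[OF z] HV VV by simp
qed

text \<open>The lifted metric is invariant under rotations of the frame, so \<open>\<partial>\<^sub>\<phi>\<close> is a Killing field and its
  inner product with the velocity of a geodesic is a first integral.\<close>

lemma momentum_conserved:
  assumes I: "open I" "t \<in> I" "\<gamma> ` I \<subseteq> cdom (frame_chart c s \<alpha>) \<inter> W"
    and sm: "smooth_on I (cmap (frame_chart c s \<alpha>) \<circ> \<gamma>)"
    and geo: "cov_deriv (frame_atlas A g) gh \<gamma> (velocity (frame_atlas A g) \<gamma>) t = (\<lambda>_. 0)"
  defines "z' \<equiv> \<lambda>r. vector_derivative (cmap (frame_chart c s \<alpha>) \<circ> \<gamma>) (at r)"
  shows "((\<lambda>r. (snd (z' r) + \<omega> (cmap c (fst (\<gamma> r))) (fst (z' r))) / (K (fst (\<gamma> r)))\<^sup>2)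
     has_real_derivative 0) (at t)"
proof -
  let ?D = "frame_chart c s \<alpha>" and ?FA = "frame_atlas A g"
  let ?z = "cmap ?D \<circ> \<gamma>" and ?V = "(0, 1) :: (real^2) \<times> real"
  interpret L: local_metric "cmap ?D ` (cdom ?D \<inter> W)" "Gh \<alpha>" by (rule local_metric_lift)
  have zt: "?z t \<in> cmap ?D ` (cdom ?D \<inter> W)" using I(2,3) by auto
  have pt: "\<gamma> t \<in> cdom ?D" "\<gamma> t \<in> W" using I(2,3) by blast+
  have dz: "(?z has_vector_derivative z' r) (at r)" if "r \<in> I" for r
    unfolding z'_def using smooth_on_differentiable[OF sm that] vector_derivative_works by blast
  have eqz': "frechet_derivative ?z (at r) 1 = z' r" if "r \<in> I" for r
    using frechet_derivativeI[OF dz[OF that, unfolded has_vector_derivative_def]] by simp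
  have "smooth_on I z'"
    by (rule iffD1[OF smooth_on_cong[OF I(1) eqz'] smooth_on_derivative[OF sm]])
  define z'' where "z'' = vector_derivative z' (at t)"
  have dz': "(z' has_vector_derivative z'') (at t)"
    unfolding z''_def using smooth_on_differentiable[OF \<open>smooth_on I z'\<close> I(2)] vector_derivative_works by blast
  have vel: "velocity ?FA \<gamma> r ?D = z' r" if "r \<in> I" for r
    using that I(3) frame_chart_in_atlas unfolding velocity_def z'_def by auto
  have "((\<lambda>r. velocity ?FA \<gamma> r ?D) has_vector_derivative z'') (at t)"
    by (rule has_vector_derivative_transform_within_open[OF dz' I(1,2)]) (simp add: vel)
  \<comment> \<open>The geodesic equation in bundle coordinates.\<close>
  then have acc: "z'' = - christoffel_of (Gh \<alpha>) (?z t) (z' t) (z' t)"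
    using fun_cong[OF geo, of ?D] pt(1) frame_chart_in_atlas vel[OF I(2)]
    by (simp add: cov_deriv_def vector_derivative_at christoffel_eq eq_neg_iff_add_eq_0)
  \<comment> \<open>By \<open>lift_metric_rep\<close> the components of the metric depend on the
    base point alone, and a step in direction \<open>?V\<close> keeps the base point.\<close>
  have killing: "L.dG (?z t) ?V w w = 0" for w
  proof (rule has_vector_derivative_locally_constant)
    show "((\<lambda>r. Gh \<alpha> (?z t + r *\<^sub>R ?V) w w) has_vector_derivative L.dG (?z t) ?V w w) (at 0)"
      by (rule derivative_on_line[OF smooth_on_differentiable[OF L.smooth zt]])
    have "\<forall>\<^sub>F r in at 0. ?z t + r *\<^sub>R ?V \<in> cmap ?D ` (cdom ?D \<inter> W)"
    proof (rule has_vector_derivative_eventually_in[OF _ L.open_domain])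
      show "((\<lambda>r. ?z t + r *\<^sub>R ?V) has_vector_derivative ?V) (at 0)"
        by (auto intro!: derivative_eq_intros)
      show "?z t + 0 *\<^sub>R ?V \<in> cmap ?D ` (cdom ?D \<inter> W)"
        unfolding scaleR_zero_left add_0_right by (rule zt)
    qed
    then show "\<forall>\<^sub>F r in at 0. Gh \<alpha> (?z t + r *\<^sub>R ?V) w w = Gh \<alpha> (?z t) w w"
    proof (rule eventually_mono)
      fix r assume "?z t + r *\<^sub>R ?V \<in> cmap ?D ` (cdom ?D \<inter> W)"
      then obtain q where q: "q \<in> cdom ?D" "q \<in> W" "?z t + r *\<^sub>R ?V = cmap ?D q" by blast
      have "cmap c (fst q) = cmap c (fst (\<gamma> t))"
        using arg_cong[OF q(3), of fst] frame_chart_fst(2)[OF q(1)] frame_chart_fst(2)[OF pt(1)] by simp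
      then have "fst q = fst (\<gamma> t)"
        using inj_onD[OF inj[OF chart]] frame_chart_fst(1)[OF q(1)] frame_chart_fst(1)[OF pt(1)] by blast
      then show "Gh \<alpha> (?z t + r *\<^sub>R ?V) w w = Gh \<alpha> (?z t) w w"
        using lift_metric_rep(1)[OF q(1,2), of "fst w" "snd w" "fst w" "snd w"]
          lift_metric_rep(1)[OF pt, of "fst w" "snd w" "fst w" "snd w"]
        unfolding q(3) unfolding comp_apply by simp
    qed
    show "Gh \<alpha> (?z t + 0 *\<^sub>R ?V) w w = Gh \<alpha> (?z t) w w" by (simp only: scaleR_zero_left add_0_right)
  qed
  \<comment> \<open>The acceleration contributes minus the Koszul expression at
    \<open>(z', z', ?V)\<close>. By \<open>killing\<close> this is minus the derivative of the
    metric in direction \<open>z'\<close>, which cancels the first summand of the product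
    rule.\<close>
  have "((\<lambda>r. Gh \<alpha> (?z r) (z' r) ?V) has_vector_derivative
      L.dG (?z t) (z' t) (z' t) ?V + Gh \<alpha> (?z t) z'' ?V + Gh \<alpha> (?z t) (z' t) 0) (at t)"
    by (rule L.derivative_along[OF dz[OF I(2)] dz' has_vector_derivative_const zt])
  moreover have "Gh \<alpha> (?z t) z'' ?V = - L.dG (?z t) (z' t) (z' t) ?V"
    unfolding acc L.simps_left[OF zt] L.christoffel_koszul[OF zt] koszul_def killing by simp
  ultimately have "((\<lambda>r. Gh \<alpha> (?z r) (z' r) ?V) has_vector_derivative 0) (at t)"
    by (simp add: L.simps_right(5)[OF zt, unfolded comp_apply])
  then have "((\<lambda>r. (snd (z' r) + \<omega> (cmap c (fst (\<gamma> r))) (fst (z' r))) / (K (fst (\<gamma> r)))\<^sup>2)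
      has_vector_derivative 0) (at t)"
  proof (rule has_vector_derivative_transform_within_open[OF _ I(1,2)])
    fix r assume "r \<in> I"
    then have "\<gamma> r \<in> cdom ?D" "\<gamma> r \<in> W" using I(3) by blast+
    from lift_metric_rep(2)[OF this, of "fst (z' r)" "snd (z' r)"]
    show "Gh \<alpha> (?z r) (z' r) ?V = (snd (z' r) + \<omega> (cmap c (fst (\<gamma> r))) (fst (z' r))) / (K (fst (\<gamma> r)))\<^sup>2"
      by simp
  qed
  then show ?thesis by (simp add: has_real_derivative_iff_has_vector_derivative)
qed

end

text \<open>If \<open>\<mu>/k\<^sup>2\<close> is locally constant where \<open>k \<noteq> 0\<close>, then \<open>k\<^sup>2/\<mu>\<close> is continuous where \<open>\<mu> \<noteq> 0\<close> and each
  of its nonzero values is attained on an open and closed set.\<close>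

lemma denominator_vanishes_locally:
  fixes \<mu> k :: "real \<Rightarrow> real"
  assumes I: "open I" "t0 \<in> I" and cont: "continuous_on I \<mu>" "continuous_on I k"
    and t0: "k t0 = 0" "\<mu> t0 \<noteq> 0"
    and const: "\<And>r. r \<in> I \<Longrightarrow> k r \<noteq> 0 \<Longrightarrow> ((\<lambda>r. \<mu> r / (k r)\<^sup>2) has_real_derivative 0) (at r)"
  obtains d where "d > 0" "{t0-d<..<t0+d} \<subseteq> I" "\<And>r. r \<in> {t0-d<..<t0+d} \<Longrightarrow> k r = 0"
proof -
  have "open {r\<in>I. \<mu> r \<in> - {0}}" by (rule open_preimage_on[OF I(1) cont(1)]) auto
  then obtain d where d: "d > 0" "ball t0 d \<subseteq> {r\<in>I. \<mu> r \<in> - {0}}"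
    using I t0 by (elim openE[of _ t0]) auto
  define J where "J = {t0-d<..<t0+d}"
  have "ball t0 d = J" by (auto simp: J_def dist_real_def)
  with d have J: "J \<subseteq> I" "\<And>r. r \<in> J \<Longrightarrow> \<mu> r \<noteq> 0" and t0J: "t0 \<in> J" by (auto simp: J_def)
  define q where "q r = (k r)\<^sup>2 / \<mu> r" for r
  have contq: "continuous_on J q"
    unfolding q_def by (intro continuous_intros continuous_on_subset[OF cont(1)] continuous_on_subset[OF cont(2)])
      (use J in auto)
  have "k t1 = 0" if t1: "t1 \<in> J" for t1
  proof (rule ccontr)
    assume k1: "k t1 \<noteq> 0"
    define S where "S = {r\<in>J. q r = q t1}"
    have "q t1 \<noteq> 0" using k1 J(2)[OF t1] by (simp add: q_def)
    have "closedin (top_of_set J) S"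
      unfolding S_def by (rule continuous_closedin_preimage_constant[OF contq])
    moreover have "open S"
    proof (rule openI)
      fix r assume r: "r \<in> S"
      then have "r \<in> J" "k r \<noteq> 0" using \<open>q t1 \<noteq> 0\<close> by (auto simp: S_def q_def)
      have "open {r\<in>J. k r \<in> - {0}}"
        by (rule open_preimage_on[OF _ continuous_on_subset[OF cont(2) J(1)]]) (auto simp: J_def)
      then obtain e where e: "e > 0" "ball r e \<subseteq> {r\<in>J. k r \<in> - {0}}"
        using \<open>r \<in> J\<close> \<open>k r \<noteq> 0\<close> by (elim openE[of _ r]) auto
      have "ball r e \<subseteq> S"
      proof
        fix s assume s: "s \<in> ball r e"
        have "((\<lambda>r. \<mu> r / (k r)\<^sup>2) has_real_derivative 0) (at x within ball r e)" if "x \<in> ball r e" for x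
          using const[of x] that e(2) J(1) has_field_derivative_at_within by blast
        from has_field_derivative_zero_constant[OF convex_ball this]
        obtain C where "\<And>x. x \<in> ball r e \<Longrightarrow> \<mu> x / (k x)\<^sup>2 = C" by blast
        then have "\<mu> s / (k s)\<^sup>2 = \<mu> r / (k r)\<^sup>2" using s e(1) by simp
        then have "inverse (q s) = inverse (q r)" unfolding q_def inverse_divide by simp
        then have "q s = q r" by simp
        then show "s \<in> S" using r s e(2) by (auto simp: S_def)
      qed
      then show "\<exists>e>0. ball r e \<subseteq> S" using e(1) by blast
    qed
    then have "openin (top_of_set J) S" by (rule open_subset[rotated]) (auto simp: S_def)
    moreover have "connected J" by (simp add: J_def)
    ultimately have "S = {} \<or> S = J" by (simp add: connected_clopen)
    then have "S = J" using t1 by (auto simp: S_def)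
    then have "q t0 = q t1" using t0J by (auto simp: S_def)
    then show False using t0(1) \<open>q t1 \<noteq> 0\<close> by (simp add: q_def)
  qed
  then show ?thesis using that[OF d(1)] J(1) by (simp add: J_def)
qed

text \<open>Along a curve over \<open>\<Sigma>\<close> the function \<open>n \<bullet>\<close>
  (slice coordinates) is identically 0, and so is its derivative. This covers the velocity of
  \<open>\<gamma>\<close>, once it runs over the zero set, as well as the vectors in
  \<open>tangent_to\<close> the lifted zero set.\<close>

lemma (in framed_chart) slice_velocity:
  assumes B: "smooth_atlas (insert e A)"
    and slice: "cmap e ` (cdom e \<inter> \<Sigma>) \<subseteq> L" and n: "\<And>l. l \<in> L \<Longrightarrow> n \<bullet> l = 0"
    and I: "open I" "t \<in> I" "\<sigma> ` I \<subseteq> cdom (frame_chart c s \<alpha>)"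
    and sm: "smooth_on I (cmap (frame_chart c s \<alpha>) \<circ> \<sigma>)"
    and \<Sigma>: "\<And>r. r \<in> I \<Longrightarrow> fst (\<sigma> r) \<in> \<Sigma>" and e: "fst (\<sigma> t) \<in> cdom e"
  shows "n \<bullet> frechet_derivative (transition c e) (at (cmap c (fst (\<sigma> t))))
    (fst (velocity (frame_atlas A g) \<sigma> t (frame_chart c s \<alpha>))) = 0"
proof -
  interpret B: smooth_atlas "insert e A" by fact
  let ?D = "frame_chart c s \<alpha>"
  let ?y = "cmap c \<circ> (fst \<circ> \<sigma>)"
  have cB: "c \<in> insert e A" "e \<in> insert e A" using chart by auto
  have sub: "(fst \<circ> \<sigma>) ` I \<subseteq> cdom c" using I(3) frame_chart_fst(1)[of _ \<alpha>] by (simp add: image_subset_iff)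
  have eq: "fst ((cmap ?D \<circ> \<sigma>) r) = ?y r" if "r \<in> I" for r
    using I(3) frame_chart_fst(2)[of "\<sigma> r" \<alpha>] that by auto
  have smy: "smooth_on I ?y"
    by (rule iffD1[OF smooth_on_cong[OF I(1) eq] smooth_on_linear_compose[OF bounded_linear_fst sm I(1)]])
  define z' where "z' = vector_derivative (cmap ?D \<circ> \<sigma>) (at t)"
  have "((cmap ?D \<circ> \<sigma>) has_vector_derivative z') (at t)"
    unfolding z'_def using smooth_on_differentiable[OF sm I(2)] vector_derivative_works by blast
  then have "((\<lambda>r. fst ((cmap ?D \<circ> \<sigma>) r)) has_vector_derivative fst z') (at t)"
    by (rule bounded_linear.has_vector_derivative[OF bounded_linear_fst])
  then have dy: "(?y has_vector_derivative fst z') (at t)"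
    by (rule has_vector_derivative_transform_within_open[OF _ I(1,2)]) (rule eq)
  have pc: "fst (\<sigma> t) \<in> cdom c" using sub I(2) by auto
  have "(transition c e) differentiable (at (?y t))"
    using B.transition_has_derivative[OF cB pc e] by (auto simp: differentiable_def)
  from derivative_along_curve[OF this dy]
  have der: "((\<lambda>r. n \<bullet> transition c e (?y r)) has_vector_derivative
      n \<bullet> frechet_derivative (transition c e) (at (?y t)) (fst z')) (at t)"
    by (rule bounded_linear.has_vector_derivative[OF bounded_linear_inner_right])
  have zero: "n \<bullet> transition c e (?y r) = 0" if "r \<in> {r\<in>I. (fst \<circ> \<sigma>) r \<in> cdom e}" for r
  proof -
    have "fst (\<sigma> r) \<in> cdom c" using that sub by auto
    then have "transition c e (?y r) = cmap e (fst (\<sigma> r))"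
      using B.transition_cmap[OF cB(1), of "fst (\<sigma> r)" e] by simp
    moreover have "cmap e (fst (\<sigma> r)) \<in> L" using slice \<Sigma> that by auto
    ultimately show ?thesis using n by simp
  qed
  have "\<forall>\<^sub>F r in at t. r \<in> {r\<in>I. (fst \<circ> \<sigma>) r \<in> cdom e}"
    by (rule eventually_at_in_open'[OF B.open_curve_overlap[OF cB I(1) sub smooth_on_continuous[OF smy]]])
      (use I(2) e in simp)
  then have "\<forall>\<^sub>F r in at t. n \<bullet> transition c e (?y r) = 0" by (rule eventually_mono) (rule zero)
  then have "n \<bullet> frechet_derivative (transition c e) (at (?y t)) (fst z') = 0"
    by (rule has_vector_derivative_locally_constant[OF der]) (rule zero, use I(2) e in simp)
  moreover have "velocity (frame_atlas A g) \<sigma> t ?D = z'"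
    using I(2,3) frame_chart_in_atlas[of \<alpha>] unfolding velocity_def z'_def by auto
  ultimately show ?thesis by simp
qed

theorem theorem4p4:
  fixes T :: "'a topology"
    and A :: "('a, real^2) chart set"
    and g :: "('a, real^2) metric"
    and K :: "'a \<Rightarrow> real"
    and gh :: "('a frame, (real^2) \<times> real) metric"
    and \<gamma> :: "real \<Rightarrow> 'a frame"
    and a b :: ereal
    and t0 :: real
  assumes "oriented_riemannian_surface T A g"
    and "gaussian_curvature A g K"
    and "closedin T (zero_set A K)"
    and "embedded_submanifold T A 1 (zero_set A K)"
    and "wagner_lift A g K gh"
    and "generalized_geodesic A g K gh (einterval a b) \<gamma>"
    and "transversal_curve (frame_atlas A g) (einterval a b) \<gamma> (zero_set_lift A g K)"
    and "t0 \<in> einterval a b"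
    and "\<gamma> t0 \<in> zero_set_lift A g K"
  shows "velocity (frame_atlas A g) \<gamma> t0 \<in> horizontal A g (\<gamma> t0)"
proof -
  let ?FA = "frame_atlas A g" and ?\<Sigma> = "zero_set A K" and ?\<Sigma>h = "zero_set_lift A g K"
  have man: "smooth_manifold T A" and met: "riemannian_metric_on A (topspace T) g"
    using assms(1) unfolding oriented_riemannian_surface_def by blast+
  have carrier: "carrier_of A = topspace T" using man unfolding smooth_manifold_def by blast
  interpret riemannian_surface A g
    using smooth_manifold_atlas(1)[OF man] met
    unfolding riemannian_surface_def riemannian_atlas_def riemannian_atlas_axioms_def carrier by blast
  have curve: "smooth_curve ?FA (einterval a b) \<gamma>"
    and geo: "geodesic_on ?FA gh {t\<in>einterval a b. \<gamma> t \<in> SO A g - ?\<Sigma>h} \<gamma>"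
    using assms(6) unfolding generalized_geodesic_def by blast+
  obtain D where D: "D \<in> ?FA" "\<gamma> t0 \<in> cdom D"
    using curve assms(8) unfolding smooth_curve_def carrier_of_def by blast
  obtain c s \<alpha> where Deq: "D = frame_chart c s \<alpha>" and fc: "framed_chart A g c s"
    using frame_atlasE[OF D(1)] .
  interpret framed_chart A g c s by (rule fc)
  \<comment> \<open>Closedness of the zero set makes the coordinates of the points with nonzero
    curvature an open set, as \<open>wagner_chart\<close> requires.\<close>
  have "openin T (topspace T - ?\<Sigma>)" using assms(3) by (rule openin_diff[OF openin_topspace])
  from smooth_manifold_atlas(2)[OF man chart this]
  have "open (cmap c ` (cdom c - ?\<Sigma>))"
    using chart_in_carrier[OF chart] unfolding carrier by (simp add: Int_Diff[symmetric])
  then interpret wagner_chart A g c s K gh by unfold_locales (rule assms(5))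
  obtain e where e: "e > 0" "{t0-e<..<t0+e} \<subseteq> einterval a b" "\<gamma> ` {t0-e<..<t0+e} \<subseteq> cdom D"
    "smooth_on {t0-e<..<t0+e} (cmap D \<circ> \<gamma>)"
    by (rule F.smooth_curve_chartE[OF curve D(1) assms(8) D(2)])
  define I where "I = {t0-e<..<t0+e}"
  have I: "open I" "t0 \<in> I" "\<gamma> ` I \<subseteq> cdom D" "I \<subseteq> einterval a b" and sm: "smooth_on I (cmap D \<circ> \<gamma>)"
    using e by (auto simp: I_def)
  define z' where "z' r = vector_derivative (cmap D \<circ> \<gamma>) (at r)" for r
  define y where "y r = cmap c (fst (\<gamma> r))" for r
  define \<mu> where "\<mu> r = snd (z' r) + \<omega> (y r) (fst (z' r))" for r
  define k where "k r = K (fst (\<gamma> r))" for r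
  have dz: "((cmap D \<circ> \<gamma>) has_vector_derivative z' r) (at r)" if "r \<in> I" for r
    unfolding z'_def using smooth_on_differentiable[OF sm that] vector_derivative_works by blast
  have eqz': "frechet_derivative (cmap D \<circ> \<gamma>) (at r) 1 = z' r" if "r \<in> I" for r
    using frechet_derivativeI[OF dz[OF that, unfolded has_vector_derivative_def]] by simp
  have smz': "smooth_on I z'"
    by (rule iffD1[OF smooth_on_cong[OF I(1) eqz'] smooth_on_derivative[OF sm]])
  have inD: "\<gamma> r \<in> cdom (frame_chart c s \<alpha>)" if "r \<in> I" for r using that I(3) Deq by blast
  have eqy: "fst ((cmap D \<circ> \<gamma>) r) = y r" if "r \<in> I" for r
    using frame_chart_fst(2)[OF inD[OF that]] by (simp add: y_def Deq)
  have smy: "smooth_on I y"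
    by (rule iffD1[OF smooth_on_cong[OF I(1) eqy] smooth_on_linear_compose[OF bounded_linear_fst sm I(1)]])
  have yU: "y ` I \<subseteq> cmap c ` cdom c" using frame_chart_fst(1)[OF inD] by (auto simp: y_def)
  have "smooth_on I \<mu>"
    unfolding \<mu>_def[abs_def]
    by (intro smooth_on_add \<omega>_smooth_along smooth_on_linear_compose[OF bounded_linear_fst]
        smooth_on_linear_compose[OF bounded_linear_snd] I(1) smz' smy yU)
  then have cont\<mu>: "continuous_on I \<mu>" by (rule smooth_on_continuous)
  \<comment> \<open>\<open>K\<close> is known only through its expressions in charts, so its
    continuity along \<open>\<gamma>\<close> is that of \<open>gauss_rep\<close>.\<close>
  have "smooth_on I (\<lambda>r. gauss_rep A g c (y r))"
    by (rule smooth_on_compose[OF smooth_gauss_rep smy I(1) M.open_domain yU])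
  moreover have "gauss_rep A g c (y r) = k r" if "r \<in> I" for r
    using assms(2) chart frame_chart_fst(1)[OF inD[OF that]]
    unfolding gaussian_curvature_def y_def k_def by simp
  ultimately have contk: "continuous_on I k"
    using smooth_on_continuous continuous_on_cong by (metis (no_types, lifting))
  have k0: "k t0 = 0" using assms(9) by (auto simp: k_def zero_set_lift_def zero_set_def)
  have inW: "\<gamma> r \<in> W \<longleftrightarrow> k r \<noteq> 0" and in\<Sigma>: "fst (\<gamma> r) \<in> ?\<Sigma> \<longleftrightarrow> k r = 0" if "r \<in> I" for r
    using frame_chart_fst(3)[OF inD[OF that]] base_of_SO[OF frame_chart_fst(3)[OF inD[OF that]]]
    by (auto simp: k_def zero_set_lift_def zero_set_def)
  have integral: "((\<lambda>r. \<mu> r / (k r)\<^sup>2) has_real_derivative 0) (at r)" if r: "r \<in> I" "k r \<noteq> 0" for r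
  proof -
    let ?I = "{r\<in>I. k r \<in> - {0}}"
    have "open ?I" by (rule open_preimage_on[OF I(1) contk]) auto
    moreover have "\<gamma> ` ?I \<subseteq> cdom (frame_chart c s \<alpha>) \<inter> W" using inD inW by blast
    moreover have "cov_deriv ?FA gh \<gamma> (velocity ?FA \<gamma>) r = (\<lambda>_. 0)"
      using geo r inW[OF r(1)] I(4) unfolding geodesic_on_def by blast
    moreover have "smooth_on ?I (cmap (frame_chart c s \<alpha>) \<circ> \<gamma>)"
      using smooth_on_subset[OF sm] Deq by auto
    ultimately show ?thesis
      using momentum_conserved[of ?I r \<gamma> \<alpha>] r unfolding \<mu>_def k_def y_def z'_def Deq by simp
  qed
  have \<mu>0: "\<mu> t0 = 0"
  proof (rule ccontr)
    assume ne: "\<mu> t0 \<noteq> 0"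
    obtain d where d: "d > 0" "{t0-d<..<t0+d} \<subseteq> I" "\<And>r. r \<in> {t0-d<..<t0+d} \<Longrightarrow> k r = 0"
      using denominator_vanishes_locally[OF I(1,2) cont\<mu> contk k0 ne integral] by blast
    have "fst (\<gamma> t0) \<in> ?\<Sigma>" using in\<Sigma>[OF I(2)] k0 by blast
    then obtain c' L where c': "is_chart T c'" "\<forall>c''\<in>A. compatible c' c''" "fst (\<gamma> t0) \<in> cdom c'"
      and L: "subspace L" "dim L = 1" "cmap c' ` (cdom c' \<inter> ?\<Sigma>) = cmap c' ` cdom c' \<inter> L"
      using assms(4) unfolding embedded_submanifold_def by blast
    have B: "smooth_atlas (insert c' A)"
      by (rule smooth_manifold_atlas(1)[OF insert_compatible_chart[OF man c'(1,2)]])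
    \<comment> \<open>\<open>L\<close> is a line in the plane and so has a nonzero normal
      \<open>n\<close>; pairing with \<open>n\<close> in slice coordinates gives the functional
      \<open>?N\<close> on base vectors.\<close>
    have "dim L < DIM(real^2)" using L(2) by simp
    then obtain n where n: "n \<noteq> 0" "\<And>l. l \<in> span L \<Longrightarrow> orthogonal n l"
      by (rule orthogonal_to_subspace_exists) blast
    have nL: "n \<bullet> l = 0" if "l \<in> L" for l
      using n(2)[OF span_base[OF that]] by (simp add: orthogonal_def)
    let ?N = "\<lambda>w. n \<bullet> frechet_derivative (transition c c') (at (cmap c (fst (\<gamma> t0)))) w"
    have slice: "cmap c' ` (cdom c' \<inter> ?\<Sigma>) \<subseteq> L" using L(3) by blast
    have p0: "fst (\<gamma> t0) \<in> cdom c" using frame_chart_fst(1)[OF inD[OF I(2)]] .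
    \<comment> \<open>The base vector whose slice coordinates are \<open>n\<close>. It is as far
      from tangent to the zero set as possible: \<open>?N u = n \<bullet> n\<close>.\<close>
    define u where "u = frechet_derivative (transition c' c) (at (cmap c' (fst (\<gamma> t0)))) n"
    have u: "?N u = n \<bullet> n"
      unfolding u_def using smooth_atlas.transition_derivative_inverse[OF B, of c' c "fst (\<gamma> t0)" n] chart c'(3) p0
      by simp
    have linN: "linear ?N"
      using linear_compose[OF smooth_atlas.transition_linear[OF B, of c c' "fst (\<gamma> t0)"]
          bounded_linear.linear[OF bounded_linear_inner_right[of n]]] chart c'(3) p0
      by (simp add: comp_def)
    \<comment> \<open>On the interval given by \<open>d\<close> the curve runs over the zero set, so
      its own velocity is killed by \<open>?N\<close>.\<close>
    have v0: "?N (fst (velocity ?FA \<gamma> t0 D)) = 0"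
      unfolding Deq
      by (rule slice_velocity[OF B slice nL, where I = "{t0-d<..<t0+d}"])
        (use d inD in\<Sigma> c'(3) smooth_on_subset[OF sm d(2)] Deq in auto)
    \<comment> \<open>Transversality is applied to the lift of \<open>u\<close> with fibre component
      0. Both summands of the resulting decomposition are killed by \<open>?N\<close>, whereas
      \<open>u\<close> is not.\<close>
    have "coord_tvec ?FA D (\<gamma> t0) (u, 0) \<in> tangent_space ?FA (\<gamma> t0)"
      by (rule F.coord_tvec_tangent[OF D])
    then obtain a' Y where Y: "Y \<in> tangent_to ?FA ?\<Sigma>h (\<gamma> t0)"
      "coord_tvec ?FA D (\<gamma> t0) (u, 0) = lincomb a' (velocity ?FA \<gamma> t0) 1 Y"
      using assms(7,8,9) unfolding transversal_curve_def by blast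
    obtain \<sigma> \<epsilon> where \<sigma>: "Y = velocity ?FA \<sigma> 0" "\<epsilon> > 0" "smooth_curve ?FA {-\<epsilon><..<\<epsilon>} \<sigma>"
      "\<sigma> ` {-\<epsilon><..<\<epsilon>} \<subseteq> ?\<Sigma>h" "\<sigma> 0 = \<gamma> t0"
      using Y(1) unfolding tangent_to_def by blast
    obtain \<delta> where \<delta>: "\<delta> > 0" "{0-\<delta><..<0+\<delta>} \<subseteq> {-\<epsilon><..<\<epsilon>}" "\<sigma> ` {0-\<delta><..<0+\<delta>} \<subseteq> cdom D"
      "smooth_on {0-\<delta><..<0+\<delta>} (cmap D \<circ> \<sigma>)"
      by (rule F.smooth_curve_chartE[OF \<sigma>(3) D(1), of 0]) (use \<sigma>(2,5) D(2) in auto)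
    have "fst (\<sigma> r) \<in> ?\<Sigma>" if "r \<in> {0-\<delta><..<0+\<delta>}" for r
      using that \<delta>(2) \<sigma>(4) unfolding zero_set_lift_def by blast
    then have v1: "?N (fst (velocity ?FA \<sigma> 0 D)) = 0"
      using slice_velocity[OF B slice nL, of "{0-\<delta><..<0+\<delta>}" 0 \<sigma> \<alpha>] \<delta> \<sigma>(5) c'(3) unfolding Deq by simp
    have "(u, 0) = a' *\<^sub>R velocity ?FA \<gamma> t0 D + velocity ?FA \<sigma> 0 D"
      using fun_cong[OF Y(2), of D] by (simp add: lincomb_def \<sigma>(1) F.coord_tvec_self[OF D])
    then have "u = a' *\<^sub>R fst (velocity ?FA \<gamma> t0 D) + fst (velocity ?FA \<sigma> 0 D)"
      by (metis fst_conv fst_add fst_scaleR)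
    then have "?N u = a' * ?N (fst (velocity ?FA \<gamma> t0 D)) + ?N (fst (velocity ?FA \<sigma> 0 D))"
      using linear_add[OF linN] linear_scale[OF linN] by simp
    then show False using u v0 v1 n(1) by simp
  qed
  \<comment> \<open>\<open>horizontal\<close> wants a curve that passes through the point at time 0:
    the witness is \<open>\<gamma>\<close> itself, shifted in time.\<close>
  define \<sigma> where "\<sigma> r = \<gamma> (t0 + r)" for r
  let ?I = "{-e<..<e}"
  have sub: "\<sigma> ` ?I \<subseteq> cdom D" using I(3) by (auto simp: \<sigma>_def I_def)
  have sm\<sigma>: "smooth_on ?I (cmap D \<circ> \<sigma>)"
  proof -
    have "smooth_on ?I (\<lambda>r. (cmap D \<circ> \<gamma>) (t0 + r))"
      by (rule smooth_on_compose[OF sm _ _ I(1)])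
        (auto intro!: smooth_on_add smooth_on_const smooth_on_ident simp: I_def)
    then show ?thesis by (simp add: comp_def \<sigma>_def)
  qed
  have d\<sigma>: "((cmap D \<circ> \<sigma>) has_vector_derivative z' t0) (at 0)"
    using derivative_on_line[OF smooth_on_differentiable[OF sm I(2)], of 1] eqz'[OF I(2)]
    by (simp add: comp_def \<sigma>_def)
  have zero: "snd (z' t0) + \<omega> (cmap c (fst (\<sigma> 0))) (fst (z' t0)) = 0"
    using \<mu>0 by (simp add: \<mu>_def y_def \<sigma>_def)
  note par = frame_curve_parallel[OF open_greaterThanLessThan _ sub[unfolded Deq] sm\<sigma>[unfolded Deq] _ zero]
  have "cov_deriv A g (fst \<circ> \<sigma>) (\<lambda>t. frame1 (\<sigma> t)) 0 = (\<lambda>_. 0)"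
    "cov_deriv A g (fst \<circ> \<sigma>) (\<lambda>t. frame2 (\<sigma> t)) 0 = (\<lambda>_. 0)"
    by (rule par(1) par(2); use e(1) d\<sigma> Deq in simp)+
  moreover have "smooth_curve ?FA ?I \<sigma>"
    by (rule F.smooth_curve_single_chart[OF D(1) open_greaterThanLessThan sub sm\<sigma>])
  moreover have "velocity ?FA \<gamma> t0 = velocity ?FA \<sigma> 0"
    using F.velocity_eq_coord_tvec[OF D(1) I(1,3) sm I(2)]
      F.velocity_eq_coord_tvec[OF D(1) open_greaterThanLessThan sub sm\<sigma>, of 0] e(1)
    by (simp add: vector_derivative_at[OF d\<sigma>] vector_derivative_at[OF dz[OF I(2)]]) (simp add: \<sigma>_def)
  ultimately show ?thesis
    unfolding horizontal_def using e(1)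
    by (intro CollectI exI[of _ \<sigma>] exI[of _ e]) (simp add: \<sigma>_def)
qed

end
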